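(* Let $n$ and $d$ be large integers such that $\omega(\log^2 n)\leq d\leq n^{0.01}$. Any depth four $\Sigma\wedge\Sigma\Pi$ circuit (syntactically) computing $\mathsf{IMM}_{n,d}$ must have size at least $n^{\Omega(\sqrt d)}$.
   Context: $\mathsf{IMM}_{n,d}$: let $X^{(1)},\dots,X^{(d)}$ be $n\times n$ matrices of distinct variables (disjoint across matrices), $x^{(k)}_{i,j}$ the $(i,j)$ entry of $X^{(k)}$; $\mathsf{IMM}_{n,d}(X)=\sum_{i_1,\dots,i_{d-1}\in[n]} x^{(1)}_{1,i_1}x^{(2)}_{i_1,i_2}\cdots x^{(d-1)}_{i_{d-2},i_{d-1}}x^{(d)}_{i_{d-1},1}$. A depth four $\Sigma\wedge\Sigma\Pi$ circuit is an arithmetic circuit computing a polynomial of the form $\sum_{i} Q_i^{e_i}$ (a sum of powers of polynomials); its size is its number of nodes. Computing means the output polynomial equals $\mathsf{IMM}_{n,d}$ as a formal polynomial. *)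

theory Defs
  imports
    "HOL-Analysis.Analysis"
    "HOL-Library.Poly_Mapping"
    "HOL-Library.Landau_Symbols"
begin

section \<open>Formal multivariate polynomials\<close>

text \<open>Finitely supported maps from exponent vectors to coefficients; multiplication on
  \<^type>\<open>poly_mapping\<close> is convolution. Equality is equality of formal polynomials.\<close>

type_synonym ('v, 'a) mpoly = "('v \<Rightarrow>\<^sub>0 nat) \<Rightarrow>\<^sub>0 'a"

definition mvar :: "'v \<Rightarrow> ('v, 'a::field) mpoly" where
  "mvar v = Poly_Mapping.single (Poly_Mapping.single v 1) 1"

definition mconst :: "'a \<Rightarrow> ('v, 'a::field) mpoly" where
  "mconst c = Poly_Mapping.single 0 c"


section \<open>Iterated matrix multiplication\<close>

text \<open>The triple \<open>(k, i, j)\<close> names the \<open>(i, j)\<close> entry of the \<open>k\<close>-th matrix,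
  with \<open>k \<in> {1..d}\<close> and \<open>i, j \<in> {1..n}\<close>.\<close>

type_synonym imm_var = "nat \<times> nat \<times> nat"

text \<open>A summand is given by a walk \<open>1 = i\<^sub>0, i\<^sub>1, \<dots>, i\<^sub>d = 1\<close> whose inner vertices
  \<open>i\<^sub>1, \<dots>, i\<^bsub>d-1\<^esub>\<close> are chosen freely in \<open>{1..n}\<close>.\<close>

definition walk_vertex :: "nat \<Rightarrow> (nat \<Rightarrow> nat) \<Rightarrow> nat \<Rightarrow> nat" where
  "walk_vertex d p k = (if k = 0 \<or> k = d then 1 else p k)"

definition IMM :: "nat \<Rightarrow> nat \<Rightarrow> (imm_var, 'a::field) mpoly" where
  "IMM n d = (\<Sum>p \<in> {1..<d} \<rightarrow>\<^sub>E {1..n}.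
                \<Prod>k\<in>{1..d}. mvar (k, walk_vertex d p (k - 1), walk_vertex d p k))"


section \<open>Arithmetic circuits\<close>

text \<open>A circuit is a directed acyclic graph with nodes \<open>0, \<dots>, length C - 1\<close>, listed in a
  topological order; each gate lists the nodes feeding into it, and the last node is the output.
  Fan-in and fan-out are unbounded, and a repeated list entry is a multiple edge (so that
  \<open>x * x\<close> is a product gate over a single leaf).\<close>

datatype ('v, 'a) gate =
    Var_Leaf 'v
  | Const_Leaf 'a
  | Sum_Gate "nat list"
  | Prod_Gate "nat list"
  | Pow_Gate nat nat  \<comment> \<open>child and exponent\<close>

type_synonym ('v, 'a) circuit = "('v, 'a) gate list"

fun gate_children :: "('v, 'a) gate \<Rightarrow> nat set" where
  "gate_children (Var_Leaf v) = {}"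
| "gate_children (Const_Leaf c) = {}"
| "gate_children (Sum_Gate js) = set js"
| "gate_children (Prod_Gate js) = set js"
| "gate_children (Pow_Gate j e) = {j}"

definition arith_circuit :: "('v, 'a) circuit \<Rightarrow> bool" where
  "arith_circuit C \<longleftrightarrow> C \<noteq> [] \<and> (\<forall>k < length C. \<forall>j \<in> gate_children (C ! k). j < k)"

definition circuit_size :: "('v, 'a) circuit \<Rightarrow> nat" where
  "circuit_size C = length C"

definition output_node :: "('v, 'a) circuit \<Rightarrow> nat" where
  "output_node C = length C - 1"

fun gate_poly :: "(nat \<Rightarrow> ('v, 'a::field) mpoly) \<Rightarrow> ('v, 'a) gate \<Rightarrow> ('v, 'a) mpoly" where
  "gate_poly P (Var_Leaf v) = mvar v"
| "gate_poly P (Const_Leaf c) = mconst c"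
| "gate_poly P (Sum_Gate js) = (\<Sum>j\<leftarrow>js. P j)"
| "gate_poly P (Prod_Gate js) = (\<Prod>j\<leftarrow>js. P j)"
| "gate_poly P (Pow_Gate j e) = P j ^ e"

text \<open>The guard \<open>j < k\<close> only serves termination: for an \<open>arith_circuit\<close> it always holds,
  see \<open>node_poly_eq\<close> below.\<close>

fun node_poly :: "('v, 'a::field) circuit \<Rightarrow> nat \<Rightarrow> ('v, 'a) mpoly" where
  "node_poly C k = gate_poly (\<lambda>j. if j < k then node_poly C j else 0) (C ! k)"

declare node_poly.simps [simp del]

definition computes :: "('v, 'a::field) circuit \<Rightarrow> ('v, 'a) mpoly \<Rightarrow> bool" where
  "computes C f \<longleftrightarrow> node_poly C (output_node C) = f"


section \<open>Depth four circuits with a layer of powering gates\<close>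

text \<open>The node predicates describe the four layers of gates from the bottom up; sharing of nodes
  between different parents is allowed.\<close>

definition leaf_node :: "('v, 'a) circuit \<Rightarrow> nat \<Rightarrow> bool" where
  "leaf_node C k \<longleftrightarrow> (\<exists>v. C ! k = Var_Leaf v) \<or> (\<exists>c. C ! k = Const_Leaf c)"

definition P_node :: "('v, 'a) circuit \<Rightarrow> nat \<Rightarrow> bool" where
  "P_node C k \<longleftrightarrow> (\<exists>js. C ! k = Prod_Gate js \<and> (\<forall>j \<in> set js. leaf_node C j))"

definition SP_node :: "('v, 'a) circuit \<Rightarrow> nat \<Rightarrow> bool" where
  "SP_node C k \<longleftrightarrow> (\<exists>js. C ! k = Sum_Gate js \<and> (\<forall>j \<in> set js. P_node C j))"

definition WSP_node :: "('v, 'a) circuit \<Rightarrow> nat \<Rightarrow> bool" where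
  "WSP_node C k \<longleftrightarrow> (\<exists>j e. C ! k = Pow_Gate j e \<and> SP_node C j)"

definition SWSP_node :: "('v, 'a) circuit \<Rightarrow> nat \<Rightarrow> bool" where
  "SWSP_node C k \<longleftrightarrow> (\<exists>js. C ! k = Sum_Gate js \<and> (\<forall>j \<in> set js. WSP_node C j))"

definition SWSP_circuit :: "('v, 'a) circuit \<Rightarrow> bool" where
  "SWSP_circuit C \<longleftrightarrow> arith_circuit C \<and> SWSP_node C (output_node C)"


section \<open>Basic facts\<close>

lemma node_poly_eq:
  assumes "arith_circuit C" "k < length C"
  shows "node_poly C k = gate_poly (node_poly C) (C ! k)"
proof -
  have "\<forall>j \<in> gate_children (C ! k). j < k"
    using assms by (simp add: arith_circuit_def)
  then show ?thesis
    by (subst node_poly.simps) (cases "C ! k"; auto intro!: arg_cong[where f = sum_list]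
        arg_cong[where f = prod_list])
qed

lemma SWSP_circuit_sum_of_powers:
  fixes C :: "('v, 'a::field) circuit"
  assumes "SWSP_circuit C"
  shows "\<exists>qs. node_poly C (output_node C) = (\<Sum>(q, e)\<leftarrow>qs. node_poly C q ^ e)
           \<and> (\<forall>(q, e) \<in> set qs. SP_node C q)"
proof -
  have wf: "arith_circuit C" using assms by (simp add: SWSP_circuit_def)
  have len: "output_node C < length C"
    using wf by (simp add: arith_circuit_def output_node_def)
  obtain js where js: "C ! output_node C = Sum_Gate js" "\<forall>j \<in> set js. WSP_node C j"
    using assms by (auto simp: SWSP_circuit_def SWSP_node_def)
  have lt: "j < length C" if "j \<in> set js" for j
    using wf len js(1) that by (fastforce simp: arith_circuit_def)
  obtain f where f: "C ! j = Pow_Gate (fst (f j)) (snd (f j))" "SP_node C (fst (f j))"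
    if "j \<in> set js" for j
  proof -
    have "\<forall>j \<in> set js. \<exists>qe. C ! j = Pow_Gate (fst qe) (snd qe) \<and> SP_node C (fst qe)"
      using js(2) by (auto simp: WSP_node_def)
    then show thesis using that by metis
  qed
  have "node_poly C (output_node C) = (\<Sum>j\<leftarrow>js. node_poly C j)"
    using node_poly_eq[OF wf len] js(1) by simp
  also have "\<dots> = (\<Sum>j\<leftarrow>js. node_poly C (fst (f j)) ^ snd (f j))"
    using node_poly_eq[OF wf lt] f(1) by (intro arg_cong[where f = sum_list] map_cong) auto
  also have "\<dots> = (\<Sum>(q, e)\<leftarrow>map f js. node_poly C q ^ e)"
    by (simp add: case_prod_beta o_def)
  finally show ?thesis
    using f(2) by (intro exI[of _ "map f js"]) (auto, metis fst_conv)
qed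

end

theory Submission
  imports Defs "HOL-Library.Function_Algebras" "HOL-Library.Nat_Bijection"
begin

text \<open>The measure is the rank of the shifted partial derivatives, projected to multilinear
  monomials. Restrict \<open>IMM\<close> to a randomly labelled copy of \<open>k\<close> blocks, where each block is a
  de Bruijn graph with \<open>2\<^sup>q\<close> vertices per layer and \<open>r\<close> layers of edges (the variables \<open>Z\<close>),
  with \<open>k\<close> and \<open>r\<close> about \<open>\<surd>d\<close>. A monomial with many variables from \<open>Z\<close> rarely survives the
  labelling, so one labelling leaves only monomials of low degree in \<open>Z\<close>.

  Upper bound: the coefficient of a monomial of degree \<open>K\<close> in the other variables in \<open>Q ^ e\<close>
  is, for each \<open>j \<le> K\<close>, a multiple of \<open>Q\<^sub>0 ^ (e - j)\<close> by a polynomial of degree \<open>O(K t)\<close>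
  in \<open>Z\<close>; here \<open>Q\<^sub>0\<close> is the part of \<open>Q\<close> over \<open>Z\<close>. So a power contributes only
  \<open>K + 1\<close> times the number of small subsets of \<open>Z\<close> to the rank, over every field.

  Lower bound: a path is a bit string per block, and two paths share an edge only where \<open>q + 1\<close>
  consecutive bits agree. Hence for most shifts \<open>\<beta>\<close> disjoint from a path no other path with the same
  block endpoints is disjoint from \<open>\<beta>\<close>, the row of such a pair is a unit vector, and a second moment
  argument counts the different unit vectors.\<close>

section \<open>Overlaps of paths\<close>

text \<open>The parameters come from one balance. Extracting \<open>K\<close> variables from powers
  whose monomials have fewer than \<open>2 * h\<close> variables in \<open>Z\<close> enlarges the
  shifts by up to \<open>K * (2 * h)\<close>, while a path gains through its \<open>k * r\<close>
  edges in \<open>Z\<close>. If the shifts fall short of half of \<open>Z\<close> by a relative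
  \<delta>, the gain is about exp(\<delta> k r) and the loss exp(O(\<delta> K h)). As
  \<open>K\<close> is O(k), \<open>h\<close> may be a small constant times \<open>r\<close>; since
  labels kill fewer than \<open>B ^ h\<close> monomials, this \<open>h\<close> already caps the size
  bound at n^O(r). The obstacle is that \<delta> cannot be large: isolation needs (1 +
  O(\<delta>))^r, times a power of \<open>r\<close>, to stay below 2^q. So \<delta> r is O(log n)
  and the gain is n^O(k). Both caps are n^O(sqrt d) when \<open>k\<close> and \<open>r\<close> are
  about sqrt d. States and labels share the n vertices of a layer: about n^0.3 states, at least
  n^0.6 labels each. The bound d \<le> n^0.01 makes powers of \<open>r\<close> small against 2^q,
  and d = \<omega>(log^2 n) makes \<delta> small. Coefficient extraction in place of differentiation
  keeps all scalars harmless in every characteristic.\<close>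

text \<open>Counts the positions \<open>j < m\<close> whose window \<open>{j..j + q}\<close> meets \<open>E\<close>; the parameter \<open>s\<close>
  stands for an element beyond \<open>m\<close> whose influence still extends to the last \<open>s\<close> positions.\<close>

definition reach :: "nat \<Rightarrow> nat set \<Rightarrow> nat \<Rightarrow> nat \<Rightarrow> nat" where
  "reach q E m s = card {j. j < m \<and> ((\<exists>e\<in>E. j \<le> e \<and> e \<le> j + q) \<or> m \<le> j + s)}"

lemma reach_le: "reach q E m s \<le> m"
proof -
  have "reach q E m s \<le> card {..<m}" unfolding reach_def by (intro card_mono) auto
  then show ?thesis by simp
qed

lemma reach_empty: "reach q {} m s = min m s"
proof -
  have "{j. j < m \<and> m \<le> j + s} = {m - s..<m}" by auto
  then show ?thesis by (simp add: reach_def)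
qed

text \<open>A last position outside \<open>E\<close> counts exactly when the influence from beyond
  still extends to it, and it uses up one unit of that influence.\<close>

lemma reach_Suc_skip:
  assumes "E \<subseteq> {..<m}"
  shows "reach q E (Suc m) s = (if s = 0 then 0 else 1) + reach q E m (s - 1)"
proof -
  let ?A = "{j. j < m \<and> ((\<exists>e\<in>E. j \<le> e \<and> e \<le> j + q) \<or> m \<le> j + (s - 1))}"
  have "{j. j < Suc m \<and> ((\<exists>e\<in>E. j \<le> e \<and> e \<le> j + q) \<or> Suc m \<le> j + s)}
      = (if s = 0 then {} else {m}) \<union> ?A"
    using assms by (auto simp: less_Suc_eq)
  then show ?thesis by (simp add: reach_def card_Un_disjoint)
qed

text \<open>A last element of \<open>E\<close> renews the influence to its full length
  \<open>q\<close>, whatever was left of it.\<close>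

lemma reach_Suc_insert:
  assumes "E \<subseteq> {..<m}" "s \<le> q"
  shows "reach q (insert m E) (Suc m) s = Suc (reach q E m q)"
proof -
  let ?A = "{j. j < m \<and> ((\<exists>e\<in>E. j \<le> e \<and> e \<le> j + q) \<or> m \<le> j + q)}"
  have "{j. j < Suc m \<and> ((\<exists>e\<in>insert m E. j \<le> e \<and> e \<le> j + q) \<or> Suc m \<le> j + s)} = insert m ?A"
    using assms by (auto simp: less_Suc_eq)
  then show ?thesis by (simp add: reach_def)
qed

lemma sum_Pow_insert:
  assumes "finite A" "x \<notin> A"
  shows "(\<Sum>E\<in>Pow (insert x A). f E) = (\<Sum>E\<in>Pow A. f E) + (\<Sum>E\<in>Pow A. f (insert x E))"
proof -
  have "(\<Sum>E\<in>Pow (insert x A). f E) = (\<Sum>E\<in>Pow A. f E) + (\<Sum>E\<in>insert x ` Pow A. f E)"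
    unfolding Pow_insert using assms by (intro sum.union_disjoint) auto
  also have "(\<Sum>E\<in>insert x ` Pow A. f E) = (\<Sum>E\<in>Pow A. f (insert x E))"
    using assms by (subst sum.reindex) (auto simp: inj_on_def)
  finally show ?thesis .
qed

text \<open>\<open>E\<close> stands for the bits in which two strings differ, and \<open>b\<close>
  for the length of a prefix on which they must agree. The weight 1/2 is critical: a run of
  differences from e to e' has about 2^(e' - e) interiors but reaches e' - e + q + 1 positions, so
  each choice of end points contributes only about 2^(-q), unless the run is cut off at the left
  end.\<close>

definition reach_sum :: "nat \<Rightarrow> nat \<Rightarrow> nat \<Rightarrow> nat \<Rightarrow> real" where
  "reach_sum q b m s = (\<Sum>E\<in>Pow {b..<b + m}. (1 / 2) ^ reach q E (b + m) s)"

lemma reach_sum_0: "reach_sum q b 0 s = (1 / 2) ^ min b s"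
  by (simp add: reach_sum_def reach_empty)

lemma reach_sum_Suc:
  assumes "s \<le> q"
  shows "reach_sum q b (Suc m) s =
    (if s = 0 then 1 else 1 / 2) * reach_sum q b m (s - 1) + reach_sum q b m q / 2"
proof -
  have eq: "{b..<b + Suc m} = insert (b + m) {b..<b + m}" by auto
  have 1: "(\<Sum>E\<in>Pow {b..<b + m}. (1 / 2 :: real) ^ reach q E (Suc (b + m)) s)
      = (if s = 0 then 1 else 1 / 2) * reach_sum q b m (s - 1)"
    unfolding reach_sum_def sum_distrib_left
    by (intro sum.cong refl, subst reach_Suc_skip) auto
  have 2: "(\<Sum>E\<in>Pow {b..<b + m}. (1 / 2 :: real) ^ reach q (insert (b + m) E) (Suc (b + m)) s)
      = reach_sum q b m q / 2"
    unfolding reach_sum_def sum_divide_distrib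
    by (intro sum.cong refl, subst reach_Suc_insert) (use assms in auto)
  have "reach_sum q b (Suc m) s = (\<Sum>E\<in>Pow {b..<b + m}. (1 / 2) ^ reach q E (Suc (b + m)) s)
     + (\<Sum>E\<in>Pow {b..<b + m}. (1 / 2) ^ reach q (insert (b + m) E) (Suc (b + m)) s)"
    unfolding reach_sum_def eq by (subst sum_Pow_insert) auto
  then show ?thesis using 1 2 by simp
qed

text \<open>\<open>y\<close> is the defect at the left end: 0 for \<open>b = q\<close>, and 1 for
  \<open>b = 0\<close>, where runs are cut off. At each position the influence either drops by one
  or is reset to \<open>q\<close>, and a reset brings in the value at \<open>q\<close>, which is
  about \<open>e\<close> plus the defect so far. Hence the additive term grows quadratically in
  \<open>m\<close> and the factor cubically.\<close>

lemma reach_sum_le: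
  fixes y :: real
  assumes y: "0 \<le> y" "y \<le> 1" and start: "\<And>s. s \<le> q \<Longrightarrow> (1 / 2) ^ min b s \<le> (1 / 2) ^ s + (if s = 0 then 0 else y)"
    and m: "m ^ 3 \<le> 2 ^ q" and s: "s \<le> q" and q: "0 < q"
  defines "e \<equiv> (1 / 2 :: real) ^ q"
  shows "reach_sum q b m s
    \<le> (1 / 2) ^ s * (1 + (real m * y + real m ^ 3 * e)) + (if s = 0 then 0 else y + real m ^ 2 * e)"
  using m s
proof (induction m arbitrary: s)
  case 0
  then show ?case using start[of s] by (cases "s = 0") (simp_all add: reach_sum_0)
next
  case (Suc m)
  have e0: "e > 0" by (simp add: e_def)
  have "m ^ 3 \<le> Suc m ^ 3" by (intro power_mono) auto
  then have m3: "m ^ 3 \<le> 2 ^ q" using Suc.prems(1) by (rule order_trans)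
  then have "real (m ^ 3) \<le> real (2 ^ q)" by (simp only: of_nat_le_iff)
  then have m3e: "real m ^ 3 * e \<le> 1" by (simp add: e_def power_one_over field_simps)
  define M where "M = real m"
  have M0: "M \<ge> 0" by (simp add: M_def)
  define x where "x = M * y + M ^ 3 * e"
  define z where "z = y + M ^ 2 * e"
  have IH: "reach_sum q b m s \<le> (1 / 2) ^ s * (1 + x) + (if s = 0 then 0 else z)" if "s \<le> q" for s
    using Suc.IH[OF m3 that] by (simp only: x_def z_def M_def)
  \<comment> \<open>The hypothesis \<open>m ^ 3 \<le> 2 ^ q\<close> enters here: it keeps the value
    fed back by a reset of order \<open>e * M\<close>.\<close>
  have x: "x \<le> M + 1" using m3e y M0 mult_left_mono[of y 1 M] by (simp add: x_def M_def)
  have x0: "x \<ge> 0" using M0 y e0 by (simp add: x_def)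
  have Iq: "reach_sum q b m q \<le> e * (1 + x) + z" using IH[of q] q by (simp add: e_def)
  have mex: "e * (1 + x) \<le> e * (M + 2)" using x e0 by (intro mult_left_mono) auto
  have zz: "z + e * (1 + x) / 2 \<le> y + (M + 1) ^ 2 * e"
  proof -
    have "e * (M + 2) / 2 \<le> e * (2 * M + 1)" using e0 M0 by simp
    moreover have "(M + 1) ^ 2 * e = M ^ 2 * e + e * (2 * M + 1)" by (simp add: power2_eq_square algebra_simps)
    ultimately show ?thesis using mex unfolding z_def by linarith
  qed
  have xx: "x + (e * (1 + x) + z) / 2 \<le> (M + 1) * y + (M + 1) ^ 3 * e"
  proof -
    have "M ^ 2 * e / 2 + e * (M + 2) / 2 \<le> e * (3 * M ^ 2 + 3 * M + 1)"
    proof -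
      have "M ^ 2 / 2 + (M + 2) / 2 \<le> 3 * M ^ 2 + 3 * M + 1" 
      proof -
        have "3 * M ^ 2 + 3 * M + 1 - (M ^ 2 / 2 + (M + 2) / 2) = (5 / 2) * M ^ 2 + (5 / 2) * M"
          by (simp add: field_simps)
        moreover have "0 \<le> (5 / 2) * M ^ 2" "0 \<le> (5 / 2) * M" using M0 by auto
        ultimately show ?thesis by linarith
      qed
      then have "e * (M ^ 2 / 2 + (M + 2) / 2) \<le> e * (3 * M ^ 2 + 3 * M + 1)" using e0 by simp
      then show ?thesis by (simp add: algebra_simps)
    qed
    moreover have "(M + 1) ^ 3 * e = M ^ 3 * e + e * (3 * M ^ 2 + 3 * M + 1)"
      by (simp add: power3_eq_cube power2_eq_square algebra_simps)
    moreover have "(M + 1) * y = M * y + y" by (simp add: algebra_simps)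
    moreover have "A + (B + (y + C)) / 2 \<le> A + y + F" if "C / 2 + D / 2 \<le> F" "B \<le> D" for A B C D F :: real
      using that y(1) by (simp add: field_simps)
    ultimately have "x + (e * (1 + x) + z) / 2 \<le> x + y + e * (3 * M ^ 2 + 3 * M + 1)"
      using mex unfolding z_def by blast
    also have "\<dots> = (M + 1) * y + (M + 1) ^ 3 * e"
      using \<open>(M + 1) ^ 3 * e = _\<close> \<open>(M + 1) * y = _\<close> unfolding x_def by linarith
    finally show ?thesis .
  qed
  have M1: "real (Suc m) = M + 1" by (simp add: M_def)
  show ?case
  proof (cases "s = 0")
    case True
    have "reach_sum q b (Suc m) s = reach_sum q b m 0 + reach_sum q b m q / 2"
      using reach_sum_Suc[of s q b m] True by simp
    also have "\<dots> \<le> (1 + x) + (e * (1 + x) + z) / 2" using IH[of 0] Iq by (intro add_mono divide_right_mono) auto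
    also have "\<dots> \<le> 1 + ((M + 1) * y + (M + 1) ^ 3 * e)" using xx by simp
    finally show ?thesis by (simp only: M1 True power_0 if_True mult_1 add_0_right simp_thms)
  next
    case False
    have "reach_sum q b (Suc m) s = reach_sum q b m (s - 1) / 2 + reach_sum q b m q / 2"
      using reach_sum_Suc[of s q b m] False Suc.prems by simp
    also have "\<dots> \<le> ((1 / 2) ^ (s - 1) * (1 + x) + z) / 2 + (e * (1 + x) + z) / 2"
    proof -
      have "0 \<le> z" using y e0 by (simp add: z_def)
      have "s - 1 \<le> q" using Suc.prems by simp
      have "reach_sum q b m (s - 1) \<le> (1 / 2) ^ (s - 1) * (1 + x) + (if s - 1 = 0 then 0 else z)"
        by (rule IH[OF \<open>s - 1 \<le> q\<close>])
      also have "\<dots> \<le> (1 / 2) ^ (s - 1) * (1 + x) + z"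
        using \<open>0 \<le> z\<close> by (intro add_left_mono) simp
      finally have "reach_sum q b m (s - 1) \<le> (1 / 2) ^ (s - 1) * (1 + x) + z" .
      then show ?thesis using Iq by (intro add_mono divide_right_mono) auto
    qed
    also have "\<dots> = (1 / 2) ^ s * (1 + x) + (z + e * (1 + x) / 2)"
      using False by (cases s) (simp_all add: field_simps)
    also have "\<dots> \<le> (1 / 2) ^ s * (1 + ((M + 1) * y + (M + 1) ^ 3 * e)) + (y + (M + 1) ^ 2 * e)"
    proof -
      have "x \<le> (M + 1) * y + (M + 1) ^ 3 * e"
        unfolding x_def using M0 y e0 by (intro add_mono mult_right_mono power_mono) auto
      then show ?thesis by (intro add_mono[OF _ zz] mult_left_mono) auto
    qed
    finally show ?thesis by (simp only: M1 False if_False simp_thms)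
  qed
qed

text \<open>For strings with a common prefix of \<open>q\<close> bits the empty difference
  contributes 1, and every other one is compared with the critical weight. As \<open>reach\<close>
  is at most \<open>r\<close>, raising the weight from 1/2 to \<open>a\<close> costs at most
  \<open>(2 * a) ^ r\<close>.\<close>

lemma sum_power_reach_close:
  fixes a :: real
  assumes a: "1 / 2 \<le> a" and q: "0 < q" "q \<le> r" and r: "r ^ 3 \<le> 2 ^ q"
  shows "(\<Sum>E\<in>Pow {q..<r}. a ^ reach q E r 0) \<le> 1 + (2 * a) ^ r * (real r ^ 3 / 2 ^ q)"
proof -
  let ?m = "r - q"
  have m3: "?m ^ 3 \<le> r ^ 3" by (intro power_mono) auto
  have "reach_sum q q ?m 0 \<le> 1 + real ?m ^ 3 * (1 / 2) ^ q"
    using reach_sum_le[of 0 q q ?m 0] m3 r q by (simp add: min_def)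
  also have "real ?m ^ 3 * (1 / 2) ^ q \<le> real r ^ 3 * (1 / 2) ^ q"
    by (intro mult_right_mono power_mono) auto
  finally have le: "reach_sum q q ?m 0 \<le> 1 + real r ^ 3 / 2 ^ q" by (simp add: power_one_over field_simps)
  let ?P = "Pow {q..<r} - {{}}"
  have split: "(\<Sum>E\<in>Pow {q..<r}. f E) = f {} + (\<Sum>E\<in>?P. f E)" for f :: "nat set \<Rightarrow> real"
    by (rule sum.remove) auto
  have "reach_sum q q ?m 0 = 1 + (\<Sum>E\<in>?P. (1 / 2) ^ reach q E r 0)"
    unfolding reach_sum_def using split[of "\<lambda>E. (1 / 2) ^ reach q E r 0"] q by (simp add: reach_empty)
  then have le': "(\<Sum>E\<in>?P. (1 / 2) ^ reach q E r 0) \<le> real r ^ 3 / 2 ^ q" using le by simp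
  have "(\<Sum>E\<in>?P. a ^ reach q E r 0) \<le> (\<Sum>E\<in>?P. (2 * a) ^ r * (1 / 2) ^ reach q E r 0)"
  proof (rule sum_mono)
    fix E
    have "a ^ reach q E r 0 = (2 * a) ^ reach q E r 0 * (1 / 2) ^ reach q E r 0"
      by (subst power_mult_distrib[symmetric]) simp
    also have "\<dots> \<le> (2 * a) ^ r * (1 / 2) ^ reach q E r 0"
      using a reach_le by (intro mult_right_mono power_increasing) auto
    finally show "a ^ reach q E r 0 \<le> (2 * a) ^ r * (1 / 2) ^ reach q E r 0" .
  qed
  also have "\<dots> = (2 * a) ^ r * (\<Sum>E\<in>?P. (1 / 2) ^ reach q E r 0)" by (simp add: sum_distrib_left)
  also have "\<dots> \<le> (2 * a) ^ r * (real r ^ 3 / 2 ^ q)" using le' a by (intro mult_left_mono) auto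
  finally show ?thesis using split[of "\<lambda>E. a ^ reach q E r 0"] by (simp add: reach_empty)
qed

text \<open>Without a common prefix, differences near the left end reach fewer positions than a full
  run would, so the sum need not be close to 1; the linear bound is the price of the defect
  \<open>y = 1\<close>.\<close>

lemma sum_power_reach_all:
  fixes b :: real
  assumes b: "0 \<le> b" "b \<le> 1 / 2" and q: "0 < q" and r: "r ^ 3 \<le> 2 ^ q"
  shows "(\<Sum>E\<in>Pow {..<r}. b ^ reach q E r 0) \<le> real r + 2"
proof -
  have "real (r ^ 3) \<le> real (2 ^ q)" using r by (simp only: of_nat_le_iff)
  then have r3: "real r ^ 3 * (1 / 2) ^ q \<le> 1" by (simp add: power_one_over field_simps)
  have "(\<Sum>E\<in>Pow {..<r}. b ^ reach q E r 0) \<le> (\<Sum>E\<in>Pow {..<r}. (1 / 2) ^ reach q E r 0)"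
    using b by (intro sum_mono power_mono) auto
  also have "\<dots> = reach_sum q 0 r 0" by (simp add: reach_sum_def lessThan_atLeast0)
  also have "\<dots> \<le> 1 + (real r * 1 + real r ^ 3 * (1 / 2) ^ q)"
    using reach_sum_le[of 1 q 0 r 0] r q by simp
  finally show ?thesis using r3 by simp
qed

section \<open>Counting sets that contain a path\<close>

lemma real_diff_divide_self:
  assumes "l \<le> x" "0 < x"
  shows "real (x - l) / real x = 1 - real l / real x"
proof -
  have "real (x - l) = real x - real l" using assms by (simp add: of_nat_diff)
  then show ?thesis using assms by (simp only: diff_divide_distrib) simp
qed

text \<open>The ratio of the binomials is the probability that a random \<open>l\<close>-subset of
  an \<open>M\<close>-set misses \<open>i\<close> given elements. Each further element is missed
  with conditional probability \<open>1 - l / x\<close>, where the remaining ground set size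
  \<open>x\<close> is at most \<open>M\<close>.\<close>

lemma binomial_shrink_upper:
  fixes M l i :: nat
  assumes "i \<le> M" "l \<le> M"
  shows "real ((M - i) choose l) \<le> real (M choose l) * ((real M - real l) / real M) ^ i"
  using assms(1)
proof (induction i)
  case (Suc i)
  let ?x = "M - i"
  have pos: "?x > 0" using Suc by simp
  have "real ((?x - 1) choose l) \<le> real (?x choose l) * ((real M - real l) / real M)"
  proof (cases "l \<le> ?x")
    case True
    have "(?x - l) * (?x choose l) = ?x * ((?x - 1) choose l)"
      by (rule binomial_absorb_comp)
    then have "real (?x - l) * real (?x choose l) = real ?x * real ((?x - 1) choose l)"
      by (metis of_nat_mult)
    then have "real ((?x - 1) choose l) = real (?x choose l) * (real (?x - l) / real ?x)"
      using pos by (simp add: field_simps)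
    moreover have "real (?x - l) / real ?x \<le> (real M - real l) / real M"
    proof -
      have "real l / real M \<le> real l / real ?x" using pos by (intro divide_left_mono) auto
      moreover have "real (?x - l) / real ?x = 1 - real l / real ?x"
        by (rule real_diff_divide_self) (use True pos in auto)
      moreover have "(real M - real l) / real M = 1 - real l / real M"
        using pos by (simp add: diff_divide_distrib)
      ultimately show ?thesis by simp
    qed
    ultimately show ?thesis by (simp only: mult_left_mono of_nat_0_le_iff)
  next
    case False
    then show ?thesis using assms by (simp add: binomial_eq_0)
  qed
  also have "\<dots> \<le> (real (M choose l) * ((real M - real l) / real M) ^ i) * ((real M - real l) / real M)"
    using Suc assms by (intro mult_right_mono) auto
  finally show ?case by (simp only: diff_Suc_eq_diff_pred diff_commute[of M 1] power_Suc2 mult.assoc)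
qed simp

text \<open>The matching bound for containing \<open>i\<close> given elements: the conditional
  probabilities \<open>(l - i) / (M - i)\<close> never exceed \<open>l / M\<close>.\<close>

lemma binomial_shrink_both:
  fixes M l i :: nat
  assumes "i \<le> l" "l \<le> M"
  shows "real ((M - i) choose (l - i)) \<le> real (M choose l) * (real l / real M) ^ i"
  using assms(1)
proof (induction i)
  case (Suc i)
  let ?x = "M - i" and ?y = "l - i"
  have pos: "?x > 0" "?y > 0" using Suc assms by auto
  have "?y * (?x choose ?y) = ?x * ((?x - 1) choose (?y - 1))"
    using pos by (simp add: times_binomial_minus1_eq)
  then have "real ?y * real (?x choose ?y) = real ?x * real ((?x - 1) choose (?y - 1))"
    by (metis of_nat_mult)
  then have "real ((?x - 1) choose (?y - 1)) = real (?x choose ?y) * (real ?y / real ?x)"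
    using pos by (simp add: field_simps)
  also have "\<dots> \<le> real (?x choose ?y) * (real l / real M)"
  proof (intro mult_left_mono)
    have "?y * M \<le> l * ?x" using Suc assms by (simp add: diff_mult_distrib diff_mult_distrib2 mult.commute diff_le_mono2)
    then have "real ?y * real M \<le> real l * real ?x" by (metis of_nat_le_iff of_nat_mult)
    then show "real ?y / real ?x \<le> real l / real M" using pos by (simp add: divide_simps mult.commute del: of_nat_diff)
  qed simp
  also have "\<dots> \<le> (real (M choose l) * (real l / real M) ^ i) * (real l / real M)"
    using Suc by (intro mult_right_mono) auto
  finally show ?case by (simp only: diff_Suc_eq_diff_pred diff_commute[of _ 1] power_Suc2 mult.assoc)
qed simp

text \<open>The probability of missing \<open>D\<close> elements, now from below: each conditional
  factor is at least its value at the smallest ground set size \<open>N - D\<close>.\<close>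

lemma binomial_shrink_lower:
  fixes N D l :: nat
  assumes "D < N" "l \<le> N - D"
  shows "real (N choose l) * ((real (N - D) - real l) / real (N - D)) ^ D \<le> real ((N - D) choose l)"
proof -
  let ?a = "(real (N - D) - real l) / real (N - D)"
  have a0: "?a \<ge> 0" using assms by simp
  have "real (N choose l) * ?a ^ i \<le> real ((N - i) choose l)" if "i \<le> D" for i
    using that
  proof (induction i)
    case (Suc i)
    let ?x = "N - i"
    have pos: "?x > 0" using Suc assms by simp
    have le: "N - D \<le> ?x" "l \<le> ?x" using Suc assms by auto
    have "(?x - l) * (?x choose l) = ?x * ((?x - 1) choose l)"
      by (rule binomial_absorb_comp)
    then have "real (?x - l) * real (?x choose l) = real ?x * real ((?x - 1) choose l)"
      by (metis of_nat_mult)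
    then have eq: "real ((?x - 1) choose l) = real (?x choose l) * (real (?x - l) / real ?x)"
      using pos by (simp add: field_simps)
    have "real l / real ?x \<le> real l / real (N - D)" using le assms by (intro divide_left_mono) auto
    then have ge: "?a \<le> real (?x - l) / real ?x"
    proof -
      have "real (?x - l) / real ?x = 1 - real l / real ?x"
        by (rule real_diff_divide_self) (use le pos in auto)
      moreover have "?a = 1 - real l / real (N - D)"
        using assms by (simp add: diff_divide_distrib del: of_nat_diff)
      ultimately show ?thesis using \<open>real l / real ?x \<le> real l / real (N - D)\<close> by simp
    qed
    have "real (N choose l) * ?a ^ Suc i = (real (N choose l) * ?a ^ i) * ?a" by simp
    also have "\<dots> \<le> real (?x choose l) * ?a" using Suc a0 by (intro mult_right_mono) auto
    also have "\<dots> \<le> real (?x choose l) * (real (?x - l) / real ?x)" using ge by (intro mult_left_mono) auto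
    finally show ?case using eq by simp
  qed simp
  then show ?thesis by blast
qed

lemma binomial_growth:
  fixes N l j :: nat
  assumes "0 < l" "l \<le> N"
  shows "real (N choose (l + j)) \<le> real (N choose l) * ((real N - real l) / real l) ^ j"
proof (induction j)
  case (Suc j)
  let ?y = "l + j"
  have eq: "Suc ?y * (N choose Suc ?y) = (N - ?y) * (N choose ?y)"
    by (metis binomial_absorb_comp binomial_absorption)
  have "real (Suc ?y) * real (N choose Suc ?y) = real (N - ?y) * real (N choose ?y)"
    using eq by (metis of_nat_mult)
  then have "real (N choose Suc ?y) = real (N choose ?y) * (real (N - ?y) / real (Suc ?y))"
    by (simp add: field_simps)
  also have "\<dots> \<le> real (N choose ?y) * ((real N - real l) / real l)"
    using assms by (intro mult_left_mono frac_le) auto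
  also have "\<dots> \<le> (real (N choose l) * ((real N - real l) / real l) ^ j) * ((real N - real l) / real l)"
    using Suc assms by (intro mult_right_mono) auto
  finally show ?case by (simp only: add_Suc_right power_Suc2 mult.assoc)
qed simp

section \<open>Subset counts, collisions and isolated pairs\<close>

lemma card_small_subsets:
  assumes "finite Z" "2 * L \<le> card Z"
  shows "card {g. g \<subseteq> Z \<and> card g \<le> L} \<le> (L + 1) * (card Z choose L)"
proof -
  have "{g. g \<subseteq> Z \<and> card g \<le> L} = (\<Union>i\<in>{..L}. {g. g \<subseteq> Z \<and> card g = i})" by auto
  then have "card {g. g \<subseteq> Z \<and> card g \<le> L} \<le> (\<Sum>i\<le>L. card {g. g \<subseteq> Z \<and> card g = i})"
    by (simp add: card_UN_le)
  also have "\<dots> = (\<Sum>i\<le>L. card Z choose i)" using assms by (simp add: n_subsets)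
  also have "\<dots> \<le> (\<Sum>i\<le>L. card Z choose L)" using assms by (intro sum_mono binomial_mono) auto
  finally show ?thesis by simp
qed

text \<open>Cauchy-Schwarz for the fibre sizes of \<open>F\<close>: there are many values when few
  pairs collide.\<close>

lemma card_squared_le_card_image_mult_collisions:
  assumes "finite I"
  shows "(card I)\<^sup>2 \<le> card (F ` I) * card {(x, y). x \<in> I \<and> y \<in> I \<and> F x = F y}"
proof -
  let ?c = "\<lambda>t. {x \<in> I. F x = t}"
  have un: "I = (\<Union>t\<in>F ` I. ?c t)" by auto
  have "card (\<Union>t\<in>F ` I. ?c t) = (\<Sum>t\<in>F ` I. card (?c t))"
    using assms by (intro card_UN_disjoint) auto
  then have c1: "card I = (\<Sum>t\<in>F ` I. card (?c t))" using un by simp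
  have un2: "{(x, y). x \<in> I \<and> y \<in> I \<and> F x = F y} = (\<Union>t\<in>F ` I. ?c t \<times> ?c t)" by auto
  have "card (\<Union>t\<in>F ` I. ?c t \<times> ?c t) = (\<Sum>t\<in>F ` I. card (?c t \<times> ?c t))"
    using assms by (intro card_UN_disjoint) auto
  then have c2: "card {(x, y). x \<in> I \<and> y \<in> I \<and> F x = F y} = (\<Sum>t\<in>F ` I. (card (?c t))\<^sup>2)"
    unfolding un2 by (simp add: card_cartesian_product power2_eq_square)
  have "(\<Sum>t\<in>F ` I. real (card (?c t)))\<^sup>2 \<le> real (card (F ` I)) * (\<Sum>t\<in>F ` I. (real (card (?c t)))\<^sup>2)"
    using sum_squared_le_sum_of_squares[of "\<lambda>t. real (card (?c t))" "F ` I"]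
    by (simp add: mult.commute)
  then have "real ((card I)\<^sup>2) \<le> real (card (F ` I) * card {(x, y). x \<in> I \<and> y \<in> I \<and> F x = F y})"
    by (simp add: c1 c2)
  then show ?thesis by (simp only: of_nat_le_iff)
qed

lemma card_subsets_avoiding:
  assumes "finite Z" "A \<subseteq> Z"
  shows "card {b. b \<subseteq> Z \<and> card b = l \<and> b \<inter> A = {}} = (card Z - card A) choose l"
proof -
  have "{b. b \<subseteq> Z \<and> card b = l \<and> b \<inter> A = {}} = {b. b \<subseteq> Z - A \<and> card b = l}" by auto
  then show ?thesis using assms by (simp add: n_subsets card_Diff_subset finite_subset)
qed

lemma card_subsets_containing:
  assumes "finite Z" "A \<subseteq> Z"
  shows "card {b. A \<subseteq> b \<and> b \<subseteq> Z \<and> card b = l + card A} = (card Z - card A) choose l"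
proof -
  have fA: "finite A" using assms finite_subset by blast
  have "bij_betw (\<lambda>b. b \<union> A) {b. b \<subseteq> Z - A \<and> card b = l} {b. A \<subseteq> b \<and> b \<subseteq> Z \<and> card b = l + card A}"
  proof (rule bij_betw_byWitness[where f' = "\<lambda>b. b - A"])
    show "(\<lambda>b. b \<union> A) ` {b. b \<subseteq> Z - A \<and> card b = l} \<subseteq> {b. A \<subseteq> b \<and> b \<subseteq> Z \<and> card b = l + card A}"
    proof clarsimp
      fix b assume b: "b \<subseteq> Z - A"
      then have "finite b" using assms finite_subset by blast
      then show "b \<subseteq> Z \<and> A \<subseteq> Z \<and> card (b \<union> A) = card b + card A"
        using b assms fA by (auto intro!: card_Un_disjoint)
    qed
    show "(\<lambda>b. b - A) ` {b. A \<subseteq> b \<and> b \<subseteq> Z \<and> card b = l + card A} \<subseteq> {b. b \<subseteq> Z - A \<and> card b = l}"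
      using fA by (auto simp: card_Diff_subset)
  qed auto
  then have "card {b. A \<subseteq> b \<and> b \<subseteq> Z \<and> card b = l + card A} = card {b. b \<subseteq> Z - A \<and> card b = l}"
    by (simp add: bij_betw_same_card)
  then show ?thesis using assms fA by (simp add: n_subsets card_Diff_subset)
qed

text \<open>\<open>R\<close> will be equality of the edges outside \<open>Z\<close>, so the
  competitors \<open>p'\<close> are the paths that survive extraction of the same \<alpha>. In an
  isolated pair the shift \<open>b\<close> makes every competitor lose its multilinearity, and
  \<open>p\<close> alone survives.\<close>

definition isolated_pairs ::
    "'v set \<Rightarrow> 'p set \<Rightarrow> ('p \<Rightarrow> 'v set) \<Rightarrow> ('p \<Rightarrow> 'p \<Rightarrow> bool) \<Rightarrow> nat \<Rightarrow> ('p \<times> 'v set) set" where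
  "isolated_pairs Z P M R l = {(p, b). p \<in> P \<and> b \<subseteq> Z \<and> card b = l \<and> b \<inter> M p = {} \<and>
     (\<forall>p'\<in>P. R p p' \<and> p' \<noteq> p \<longrightarrow> b \<inter> M p' \<noteq> {})}"

lemma card_union_and_intersection:
  assumes "finite A" "finite B" "card A = D" "card B = D"
  shows "card (A \<union> B) = D + (D - card (A \<inter> B))"
proof -
  have "card (A \<inter> B) \<le> D" using card_mono[OF assms(1), of "A \<inter> B"] assms(3) by simp
  then show ?thesis using card_Un_Int[OF assms(1,2)] assms(3,4) by linarith
qed

text \<open>Union bound: among the sets that miss \<open>M p\<close>, the fraction that also misses
  \<open>M p'\<close> decays with the number of elements of \<open>M p'\<close> outside
  \<open>M p\<close>. All competitors together spoil at most half of the sets.\<close>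

lemma card_isolated_pairs_ge:
  assumes fin: "finite Z" "finite P"
    and M: "\<And>p. p \<in> P \<Longrightarrow> M p \<subseteq> Z \<and> card (M p) = D"
    and l: "l + D \<le> card Z" "D \<le> l"
    and close: "\<And>p. p \<in> P \<Longrightarrow> (\<Sum>p'\<in>{p'\<in>P. R p p' \<and> p' \<noteq> p}.
        ((real (card Z - D) - real l) / real (card Z - D)) ^ (D - card (M p \<inter> M p'))) \<le> 1 / 2"
  shows "real (card P) * real ((card Z - D) choose l) \<le> 2 * real (card (isolated_pairs Z P M R l))"
proof -
  define a where "a = (real (card Z - D) - real l) / real (card Z - D)"
  define C where "C = real ((card Z - D) choose l)"
  define G where "G p = {b. b \<subseteq> Z \<and> card b = l \<and> b \<inter> M p = {} \<and>
     (\<forall>p'\<in>P. R p p' \<and> p' \<noteq> p \<longrightarrow> b \<inter> M p' \<noteq> {})}" for p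
  define A where "A X = {b. b \<subseteq> Z \<and> card b = l \<and> b \<inter> X = {}}" for X
  have finsub: "finite {b. b \<subseteq> Z \<and> Q b}" for Q
    using fin by (auto intro: finite_subset[of _ "Pow Z"])
  have finG: "finite (G p)" for p unfolding G_def by (rule finsub)
  have finA: "finite (A X)" for X unfolding A_def by (rule finsub)
  have cA: "card (A X) = (card Z - card X) choose l" if "X \<subseteq> Z" for X
    unfolding A_def using card_subsets_avoiding[OF fin(1) that] .
  have "isolated_pairs Z P M R l = Sigma P G" by (auto simp: isolated_pairs_def G_def)
  then have cI: "card (isolated_pairs Z P M R l) = (\<Sum>p\<in>P. card (G p))"
    using fin finG by (simp add: card_SigmaI)
  have "C \<le> 2 * real (card (G p))" if p: "p \<in> P" for p
  proof -
    define P' where "P' = {p'\<in>P. R p p' \<and> p' \<noteq> p}"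
    have finP': "finite P'" using fin by (simp add: P'_def)
    have Mp: "M p \<subseteq> Z" "card (M p) = D" using M[OF p] by auto
    have "A (M p) \<subseteq> G p \<union> (\<Union>p'\<in>P'. A (M p \<union> M p'))" by (auto simp: A_def G_def P'_def)
    then have "card (A (M p)) \<le> card (G p \<union> (\<Union>p'\<in>P'. A (M p \<union> M p')))"
      using finP' finG finA by (intro card_mono) auto
    also have "\<dots> \<le> card (G p) + card (\<Union>p'\<in>P'. A (M p \<union> M p'))" by (rule card_Un_le)
    also have "\<dots> \<le> card (G p) + (\<Sum>p'\<in>P'. card (A (M p \<union> M p')))"
      using finP' by (intro add_left_mono card_UN_le)
    finally have 1: "real (card (A (M p))) \<le> real (card (G p)) + (\<Sum>p'\<in>P'. real (card (A (M p \<union> M p'))))"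
      by (simp only: of_nat_sum[symmetric] of_nat_add[symmetric] of_nat_le_iff)
    have 2: "real (card (A (M p))) = C" using cA[OF Mp(1)] Mp by (simp add: C_def)
    have "(\<Sum>p'\<in>P'. real (card (A (M p \<union> M p')))) \<le> (\<Sum>p'\<in>P'. C * a ^ (D - card (M p \<inter> M p')))"
    proof (rule sum_mono)
      fix p' assume "p' \<in> P'"
      then have p': "M p' \<subseteq> Z" "card (M p') = D" using M by (auto simp: P'_def)
      have finM: "finite (M p)" "finite (M p')" using Mp p' fin finite_subset by blast+
      have cu: "card (M p \<union> M p') = D + (D - card (M p \<inter> M p'))"
        by (rule card_union_and_intersection[OF finM Mp(2) p'(2)])
      have "card (A (M p \<union> M p')) = (card Z - D - (D - card (M p \<inter> M p'))) choose l"
        using cA[of "M p \<union> M p'"] Mp p' by (simp add: cu)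
      moreover have "D - card (M p \<inter> M p') \<le> card Z - D" "l \<le> card Z - D" using l by auto
      ultimately show "real (card (A (M p \<union> M p'))) \<le> C * a ^ (D - card (M p \<inter> M p'))"
        unfolding C_def a_def by (simp only: binomial_shrink_upper)
    qed
    also have "\<dots> = C * (\<Sum>p'\<in>P'. a ^ (D - card (M p \<inter> M p')))" by (simp only: sum_distrib_left)
    also have "\<dots> \<le> C * (1 / 2)"
      using close[OF p] unfolding P'_def a_def by (intro mult_left_mono) (auto simp: C_def)
    finally show ?thesis using 1 2 by linarith
  qed
  then have "(\<Sum>p\<in>P. C) \<le> (\<Sum>p\<in>P. 2 * real (card (G p)))" by (rule sum_mono)
  then show ?thesis unfolding cI C_def[symmetric]
    by (simp only: sum_constant sum_distrib_left[symmetric] of_nat_sum)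
qed

text \<open>Distinct isolated pairs can have the same union, so their number alone bounds no rank.
  Collisions over \<open>p\<close> and \<open>p'\<close> correspond to sets that contain both
  \<open>M p\<close> and \<open>M p'\<close>, which are rare when the two differ much;
  Cauchy-Schwarz then loses only the factor \<open>c\<close>.\<close>

lemma card_isolated_unions_ge:
  assumes fin: "finite Z" "finite P"
    and M: "\<And>p. p \<in> P \<Longrightarrow> M p \<subseteq> Z \<and> card (M p) = D"
    and l: "l + D \<le> card Z" "D \<le> l" "P \<noteq> {}"
    and close: "\<And>p. p \<in> P \<Longrightarrow> (\<Sum>p'\<in>{p'\<in>P. R p p' \<and> p' \<noteq> p}.
        ((real (card Z - D) - real l) / real (card Z - D)) ^ (D - card (M p \<inter> M p'))) \<le> 1 / 2"
    and far: "\<And>p. p \<in> P \<Longrightarrow> (\<Sum>p'\<in>P. (real l / real (card Z - D)) ^ (D - card (M p \<inter> M p'))) \<le> c"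
  shows "real (card P) * real ((card Z - D) choose l)
    \<le> 4 * c * real (card ((\<lambda>(p, b). b \<union> M p) ` isolated_pairs Z P M R l))"
proof -
  define I where "I = isolated_pairs Z P M R l"
  define F where "F = (\<lambda>(p, b). b \<union> M p)"
  define C where "C = real ((card Z - D) choose l)"
  define w where "w = real l / real (card Z - D)"
  define S where "S p p' = {t. M p \<union> M p' \<subseteq> t \<and> t \<subseteq> Z \<and> card t = l + D}" for p p'
  define Coll where "Coll = {(x, y). x \<in> I \<and> y \<in> I \<and> F x = F y}"
  have memI: "p \<in> P \<and> b \<subseteq> Z \<and> card b = l \<and> b \<inter> M p = {}" if "(p, b) \<in> I" for p b
    using that by (auto simp: I_def isolated_pairs_def)
  have finI: "finite I"
    by (rule finite_subset[of _ "P \<times> Pow Z"]) (use fin in \<open>auto simp: I_def isolated_pairs_def\<close>)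
  have finS: "finite (S p p')" for p p'
    unfolding S_def by (rule finite_subset[OF _ finite_Pow_iff[THEN iffD2, OF fin(1)]]) auto
  have "card Coll \<le> card (SIGMA p:P. SIGMA p':P. S p p')"
  \<comment> \<open>The common union recovers both shifts, since each shift is disjoint from its
    path.\<close>
  proof (rule card_inj_on_le[where f = "\<lambda>((p, b), (p', b')). (p, p', b \<union> M p)"])
    show "inj_on (\<lambda>((p, b), p', b'). (p, p', b \<union> M p)) Coll"
    proof (rule inj_onI)
      fix u v assume u: "u \<in> Coll" and v: "v \<in> Coll"
        and eq: "(\<lambda>((p, b), p', b'). (p, p', b \<union> M p)) u = (\<lambda>((p, b), p', b'). (p, p', b \<union> M p)) v"
      obtain p b1 p' b1' where u': "u = ((p, b1), (p', b1'))" by (cases u) auto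
      obtain b2 b2' where v': "v = ((p, b2), (p', b2'))" using eq u' by (cases v) auto
      have a: "(p, b1) \<in> I" "(p', b1') \<in> I" "b1 \<union> M p = b1' \<union> M p'"
        "(p, b2) \<in> I" "(p', b2') \<in> I" "b2 \<union> M p = b2' \<union> M p'" "b1 \<union> M p = b2 \<union> M p"
        using u v eq unfolding u' v' Coll_def F_def by auto
      have "b1 = (b1 \<union> M p) - M p" "b2 = (b2 \<union> M p) - M p"
        "b1' = (b1' \<union> M p') - M p'" "b2' = (b2' \<union> M p') - M p'"
        using memI a by blast+
      then show "u = v" using a unfolding u' v' by metis
    qed
    show "(\<lambda>((p, b), p', b'). (p, p', b \<union> M p)) ` Coll \<subseteq> (SIGMA p:P. SIGMA p':P. S p p')"
    proof (rule image_subsetI)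
      fix u assume u: "u \<in> Coll"
      obtain p b p' b' where u': "u = ((p, b), (p', b'))" by (metis surj_pair)
      have a: "(p, b) \<in> I" "(p', b') \<in> I" "b \<union> M p = b' \<union> M p'"
        using u unfolding u' Coll_def F_def by auto
      have p: "p \<in> P" "p' \<in> P" "b \<subseteq> Z" "card b = l" "b \<inter> M p = {}"
        using memI a by blast+
      have "finite b" "finite (M p)" using M[OF p(1)] p(3) fin finite_subset by blast+
      then have "card (b \<union> M p) = l + D" using p M[OF p(1)] by (simp add: card_Un_disjoint)
      then show "(\<lambda>((p, b), p', b'). (p, p', b \<union> M p)) u \<in> (SIGMA p:P. SIGMA p':P. S p p')"
        using a p M[OF p(1)] unfolding u' S_def by auto
    qed
    show "finite (SIGMA p:P. SIGMA p':P. S p p')" using fin finS by blast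
  qed
  also have "\<dots> = (\<Sum>p\<in>P. \<Sum>p'\<in>P. card (S p p'))" using fin finS by (simp add: card_SigmaI)
  finally have "real (card Coll) \<le> (\<Sum>p\<in>P. \<Sum>p'\<in>P. real (card (S p p')))"
    by (simp only: of_nat_sum[symmetric] of_nat_le_iff)
  also have "\<dots> \<le> (\<Sum>p\<in>P. \<Sum>p'\<in>P. C * w ^ (D - card (M p \<inter> M p')))"
  proof (intro sum_mono)
    fix p p' assume "p \<in> P" "p' \<in> P"
    then have p: "M p \<subseteq> Z" "card (M p) = D" "M p' \<subseteq> Z" "card (M p') = D" using M by auto
    have finM: "finite (M p)" "finite (M p')" using p fin finite_subset by blast+
    define i where "i = D - card (M p \<inter> M p')"
    have cu: "card (M p \<union> M p') = D + i"
      unfolding i_def by (rule card_union_and_intersection[OF finM p(2,4)])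
    have i: "i \<le> l" "l \<le> card Z - D" "i \<le> D" using l by (auto simp: i_def)
    have "S p p' = {t. M p \<union> M p' \<subseteq> t \<and> t \<subseteq> Z \<and> card t = (l - i) + card (M p \<union> M p')}"
      unfolding S_def cu using i by (simp add: algebra_simps)
    then have "card (S p p') = (card Z - card (M p \<union> M p')) choose (l - i)"
      using card_subsets_containing[of Z "M p \<union> M p'" "l - i"] fin p by (simp only: Un_subset_iff simp_thms)
    then have "card (S p p') = ((card Z - D) - i) choose (l - i)" by (simp add: cu)
    then show "real (card (S p p')) \<le> C * w ^ (D - card (M p \<inter> M p'))"
      unfolding C_def w_def i_def[symmetric] using binomial_shrink_both[OF i(1,2)] by simp
  qed
  also have "\<dots> = (\<Sum>p\<in>P. C * (\<Sum>p'\<in>P. w ^ (D - card (M p \<inter> M p'))))"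
    by (simp only: sum_distrib_left)
  also have "\<dots> \<le> (\<Sum>p\<in>P. C * c)"
    using far unfolding w_def by (intro sum_mono mult_left_mono) (auto simp: C_def)
  finally have coll: "real (card Coll) \<le> real (card P) * C * c" by simp
  define X where "X = real (card P) * C"
  have X: "X \<le> 2 * real (card I)" unfolding X_def C_def I_def
    by (rule card_isolated_pairs_ge) (use assms in auto)
  have Xpos: "X > 0" unfolding X_def C_def using fin l by (auto simp: card_gt_0_iff zero_less_binomial)
  have "X\<^sup>2 \<le> (2 * real (card I))\<^sup>2" using X Xpos by (intro power_mono) auto
  also have "\<dots> = 4 * real ((card I)\<^sup>2)" by (simp add: power_mult_distrib)
  also have "\<dots> \<le> 4 * real (card (F ` I) * card Coll)"
    using card_squared_le_card_image_mult_collisions[OF finI, of F]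
    unfolding Coll_def[symmetric] by linarith
  also have "\<dots> \<le> 4 * (real (card (F ` I)) * (X * c))"
    using coll unfolding X_def[symmetric] by (simp add: mult_left_mono)
  finally have "X * X \<le> X * (4 * c * real (card (F ` I)))" by (simp add: power2_eq_square mult_ac)
  then have "X \<le> 4 * c * real (card (F ` I))" using Xpos by simp
  then show ?thesis unfolding X_def C_def F_def I_def .
qed

section \<open>Coefficients of powers of sparse polynomials\<close>

lemma poly_mapping_sum_monomials:
  "p = (\<Sum>m\<in>Poly_Mapping.keys p. Poly_Mapping.single m (Poly_Mapping.lookup p m))"
proof (rule poly_mapping_eqI)
  fix k
  have "(\<Sum>m\<in>Poly_Mapping.keys p. Poly_Mapping.lookup p m when m = k)
      = (\<Sum>m\<in>Poly_Mapping.keys p. if m = k then Poly_Mapping.lookup p k else 0)"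
    by (intro sum.cong) (auto simp: when_def)
  then show "Poly_Mapping.lookup p k
      = Poly_Mapping.lookup (\<Sum>m\<in>Poly_Mapping.keys p. Poly_Mapping.single m (Poly_Mapping.lookup p m)) k"
    by (simp add: lookup_sum lookup_single in_keys_iff)
qed

lemma lookup_single_times:
  fixes R :: "('v, 'a::field) mpoly"
  shows "Poly_Mapping.lookup (Poly_Mapping.single a c * R) M
    = (\<Sum>b\<in>Poly_Mapping.keys R. if a + b = M then c * Poly_Mapping.lookup R b else 0)"
proof -
  have "Poly_Mapping.single a c * R
      = (\<Sum>b\<in>Poly_Mapping.keys R. Poly_Mapping.single (a + b) (c * Poly_Mapping.lookup R b))"
    by (subst (1) poly_mapping_sum_monomials[of R]) (simp add: sum_distrib_left mult_single)
  then show ?thesis by (simp add: lookup_sum lookup_single when_def)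
qed

lemma lookup_single_times_add:
  fixes R :: "('v, 'a::field) mpoly"
  shows "Poly_Mapping.lookup (Poly_Mapping.single a c * R) (a + b) = c * Poly_Mapping.lookup R b"
  by (simp add: lookup_single_times in_keys_iff)

lemma lookup_of_nat_times:
  fixes R :: "('v, 'a::field) mpoly"
  shows "Poly_Mapping.lookup (of_nat n * R) M = of_nat n * Poly_Mapping.lookup R M"
  by (induction n) (simp_all add: distrib_right lookup_add)

lemma keys_add_nat: "Poly_Mapping.keys (a + b :: 'v \<Rightarrow>\<^sub>0 nat) = Poly_Mapping.keys a \<union> Poly_Mapping.keys b"
  by (auto simp: in_keys_iff lookup_add)

lemma keys_power_subset:
  fixes p :: "('v, 'a::field) mpoly"
  assumes "\<And>m. m \<in> Poly_Mapping.keys p \<Longrightarrow> Poly_Mapping.keys m \<subseteq> Z" "m \<in> Poly_Mapping.keys (p ^ n)"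
  shows "Poly_Mapping.keys m \<subseteq> Z"
  using assms(2)
proof (induction n arbitrary: m)
  case (Suc n)
  then obtain a b where "m = a + b" "a \<in> Poly_Mapping.keys p" "b \<in> Poly_Mapping.keys (p ^ n)"
    using keys_mult[of p "p ^ n"] by (auto simp: subset_iff)
  then show ?case using assms(1) Suc.IH by (auto simp: keys_add_nat)
qed simp

definition sqfree_mon :: "'v set \<Rightarrow> ('v \<Rightarrow>\<^sub>0 nat)" where
  "sqfree_mon A = (\<Sum>v\<in>A. Poly_Mapping.single v 1)"

lemma lookup_sqfree_mon:
  "finite A \<Longrightarrow> Poly_Mapping.lookup (sqfree_mon A) v = (if v \<in> A then 1 else 0)"
  by (simp add: sqfree_mon_def lookup_sum lookup_single when_def)

lemma keys_sqfree_mon: "finite A \<Longrightarrow> Poly_Mapping.keys (sqfree_mon A) = A"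
  by (auto simp: in_keys_iff lookup_sqfree_mon split: if_splits)

text \<open>\<open>shifted_row F Z \<alpha> \<beta>\<close> lists the coefficients of the multilinear part of the polynomial
  obtained from \<open>F\<close> by extracting the coefficient of \<open>\<alpha>\<close> (a polynomial in the variables \<open>Z\<close>) and
  multiplying it with the monomial \<open>\<beta>\<close>.\<close>

definition shifted_row ::
    "('v, 'a::field) mpoly \<Rightarrow> 'v set \<Rightarrow> ('v \<Rightarrow>\<^sub>0 nat) \<Rightarrow> 'v set \<Rightarrow> 'v set \<Rightarrow> 'a" where
  "shifted_row F Z \<alpha> \<beta> \<tau> =
    (if \<beta> \<subseteq> \<tau> \<and> \<tau> \<subseteq> Z then Poly_Mapping.lookup F (\<alpha> + sqfree_mon (\<tau> - \<beta>)) else 0)"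

text \<open>For \<alpha> disjoint from \<open>Z\<close>, only such monomials can divide \<alpha>
  times a multilinear monomial in \<open>Z\<close>. The condition passes to factors and does the
  work of a restriction: monomials with a variable outside both \<open>Z\<close> and \<alpha> are
  ignored instead of being set to zero.\<close>

definition relevant :: "'v set \<Rightarrow> ('v \<Rightarrow>\<^sub>0 nat) \<Rightarrow> ('v \<Rightarrow>\<^sub>0 nat) \<Rightarrow> bool" where
  "relevant Z \<alpha> m \<longleftrightarrow> Poly_Mapping.keys m \<subseteq> Z \<union> Poly_Mapping.keys \<alpha> \<and> (\<forall>v\<in>Z. Poly_Mapping.lookup m v \<le> 1)"

lemma relevant_addD:
  assumes "relevant Z \<alpha> (a + b)"
  shows "relevant Z \<alpha> a" "relevant Z \<alpha> b"
  using assms by (auto simp: relevant_def keys_add_nat lookup_add)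

text \<open>Every factor has a variable outside \<open>Z\<close>, which relevance places in
  \<alpha>; so \<open>j\<close> factors use degree at least \<open>j\<close> in the variables of
  \<alpha>. Each factor is itself relevant and adds at most \<open>t\<close> variables of
  \<open>Z\<close>.\<close>

lemma relevant_power:
  fixes Q :: "('v, 'a::field) mpoly"
  assumes out: "\<And>m. m \<in> Poly_Mapping.keys Q \<Longrightarrow> \<not> Poly_Mapping.keys m \<subseteq> Z"
    and low: "\<And>m. m \<in> Poly_Mapping.keys Q \<Longrightarrow> relevant Z \<alpha> m \<Longrightarrow> card (Poly_Mapping.keys m \<inter> Z) \<le> t"
    and m: "m \<in> Poly_Mapping.keys (Q ^ j)" "relevant Z \<alpha> m"
  shows "j \<le> (\<Sum>v\<in>Poly_Mapping.keys \<alpha>. Poly_Mapping.lookup m v) \<and> card (Poly_Mapping.keys m \<inter> Z) \<le> j * t"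
  using m
proof (induction j arbitrary: m)
  case (Suc j)
  obtain a b where ab: "m = a + b" "a \<in> Poly_Mapping.keys Q" "b \<in> Poly_Mapping.keys (Q ^ j)"
    using Suc.prems(1) keys_mult[of Q "Q ^ j"] by (auto simp: subset_iff)
  have rel: "relevant Z \<alpha> a" "relevant Z \<alpha> b" using Suc.prems(2) ab relevant_addD by blast+
  note IH = Suc.IH[OF ab(3) rel(2)]
  obtain v where v: "v \<in> Poly_Mapping.keys a" "v \<notin> Z" using out[OF ab(2)] by blast
  then have va: "v \<in> Poly_Mapping.keys \<alpha>" using rel(1) by (auto simp: relevant_def)
  have "1 \<le> Poly_Mapping.lookup a v" using v by (simp add: in_keys_iff)
  also have "\<dots> \<le> (\<Sum>v\<in>Poly_Mapping.keys \<alpha>. Poly_Mapping.lookup a v)" using va by (intro member_le_sum) auto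
  finally have 1: "1 \<le> (\<Sum>v\<in>Poly_Mapping.keys \<alpha>. Poly_Mapping.lookup a v)" .
  have "Poly_Mapping.keys m \<inter> Z = (Poly_Mapping.keys a \<inter> Z) \<union> (Poly_Mapping.keys b \<inter> Z)"
    using ab by (auto simp: keys_add_nat)
  then have "card (Poly_Mapping.keys m \<inter> Z) \<le> card (Poly_Mapping.keys a \<inter> Z) + card (Poly_Mapping.keys b \<inter> Z)"
    by (simp add: card_Un_le)
  then show ?case using 1 IH low[OF ab(2) rel(1)] by (simp add: ab(1) lookup_add sum.distrib)
qed simp

section \<open>Shifted rows as vectors\<close>

interpretation fun_space: vector_space "\<lambda>(c::'a::field) (f::'b \<Rightarrow> 'a) x. c * f x"
  by unfold_locales (auto simp: fun_eq_iff algebra_simps)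

lemma shifted_row_add: "shifted_row (F + G) Z \<alpha> \<beta> = shifted_row F Z \<alpha> \<beta> + shifted_row G Z \<alpha> \<beta>"
  by (auto simp: shifted_row_def lookup_add fun_eq_iff)

lemma shifted_row_zero: "shifted_row 0 Z \<alpha> \<beta> = 0"
  by (auto simp: shifted_row_def fun_eq_iff)

lemma shifted_row_sum: "shifted_row (sum f I) Z \<alpha> \<beta> = (\<Sum>i\<in>I. shifted_row (f i) Z \<alpha> \<beta>)"
  by (induction I rule: infinite_finite_induct) (simp_all add: shifted_row_zero shifted_row_add)

lemma shifted_row_of_nat_times:
  "shifted_row (of_nat n * F) Z \<alpha> \<beta> = (\<lambda>\<tau>. of_nat n * shifted_row F Z \<alpha> \<beta> \<tau>)"
  by (auto simp: shifted_row_def lookup_of_nat_times fun_eq_iff)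

text \<open>Extracting \<alpha> leaves \<nu> times \<open>R\<close>, and \<nu> joins the shift. As
  \<nu> is disjoint from \<beta>, the enlarged shift is still multilinear.\<close>

lemma shifted_row_single_times:
  fixes R :: "('v, 'a::field) mpoly"
  assumes Z: "finite Z" "Poly_Mapping.keys \<alpha> \<inter> Z = {}" "\<nu> \<subseteq> Z - \<beta>"
  shows "shifted_row (Poly_Mapping.single (\<alpha> + sqfree_mon \<nu>) c * R) Z \<alpha> \<beta>
    = (\<lambda>\<tau>. c * shifted_row R Z 0 (\<beta> \<union> \<nu>) \<tau>)"
proof
  fix \<tau>
  let ?a = "\<alpha> + sqfree_mon \<nu>"
  show "shifted_row (Poly_Mapping.single ?a c * R) Z \<alpha> \<beta> \<tau> = c * shifted_row R Z 0 (\<beta> \<union> \<nu>) \<tau>"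
  proof (cases "\<beta> \<subseteq> \<tau> \<and> \<tau> \<subseteq> Z")
    case True
    have fin: "finite \<nu>" "finite \<tau>" using Z True finite_subset by blast+
    show ?thesis
    proof (cases "\<nu> \<subseteq> \<tau>")
      case sub: True
      have "\<alpha> + sqfree_mon (\<tau> - \<beta>) = ?a + sqfree_mon (\<tau> - (\<beta> \<union> \<nu>))"
        by (rule poly_mapping_eqI) (use sub fin Z in \<open>auto simp: lookup_add lookup_sqfree_mon\<close>)
      then show ?thesis using True sub by (simp add: shifted_row_def lookup_single_times_add)
    next
      \<comment> \<open>A column \<tau> that misses a variable of \<nu> has entry zero on both
        sides.\<close>
      case False
      then obtain v where v: "v \<in> \<nu>" "v \<notin> \<tau>" by blast
      have "?a + b \<noteq> \<alpha> + sqfree_mon (\<tau> - \<beta>)" for b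
      proof
        assume "?a + b = \<alpha> + sqfree_mon (\<tau> - \<beta>)"
        then have "Poly_Mapping.lookup (?a + b) v = Poly_Mapping.lookup (\<alpha> + sqfree_mon (\<tau> - \<beta>)) v" by simp
        then show False using v fin by (simp add: lookup_add lookup_sqfree_mon)
      qed
      then show ?thesis using False by (simp add: shifted_row_def lookup_single_times)
    qed
  qed (auto simp: shifted_row_def)
qed

text \<open>\<open>R\<close> involves only \<open>Z\<close>, so \<open>a\<close> has to supply all
  of \<alpha>, and the rest of \<open>a\<close> must be a squarefree part of \<tau> - \<beta>. For
  any other \<open>a\<close> no column receives an entry.\<close>

lemma shifted_row_single_times_zero:
  fixes R :: "('v, 'a::field) mpoly"
  assumes Z: "finite Z" and R: "\<And>b. b \<in> Poly_Mapping.keys R \<Longrightarrow> Poly_Mapping.keys b \<subseteq> Z"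
    and a: "\<And>\<nu>. \<nu> \<subseteq> Z - \<beta> \<Longrightarrow> a \<noteq> \<alpha> + sqfree_mon \<nu>" and \<alpha>: "Poly_Mapping.keys \<alpha> \<inter> Z = {}"
  shows "shifted_row (Poly_Mapping.single a c * R) Z \<alpha> \<beta> = 0"
proof -
  have "a + b \<noteq> \<alpha> + sqfree_mon (\<tau> - \<beta>)" if b: "b \<in> Poly_Mapping.keys R" and \<tau>: "\<tau> \<subseteq> Z" for b \<tau>
  proof
    assume eq: "a + b = \<alpha> + sqfree_mon (\<tau> - \<beta>)"
    have fin: "finite \<tau>" using Z \<tau> finite_subset by blast
    define \<nu> where "\<nu> = (\<tau> - \<beta>) \<inter> Poly_Mapping.keys a"
    have fin\<nu>: "finite \<nu>" using fin by (simp add: \<nu>_def)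
    have "a = \<alpha> + sqfree_mon \<nu>"
    proof (rule poly_mapping_eqI)
      fix v
      have e: "Poly_Mapping.lookup a v + Poly_Mapping.lookup b v
          = Poly_Mapping.lookup \<alpha> v + (if v \<in> \<tau> - \<beta> then 1 else 0)"
        using arg_cong[OF eq, of "\<lambda>m. Poly_Mapping.lookup m v"] fin by (simp add: lookup_add lookup_sqfree_mon)
      show "Poly_Mapping.lookup a v = Poly_Mapping.lookup (\<alpha> + sqfree_mon \<nu>) v"
      proof (cases "v \<in> Z")
        case True
        then have "Poly_Mapping.lookup \<alpha> v = 0" using \<alpha> by (auto simp: in_keys_iff)
        then show ?thesis using e fin\<nu>
          by (cases "Poly_Mapping.lookup a v = 0") (auto simp: lookup_add lookup_sqfree_mon \<nu>_def in_keys_iff split: if_splits)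
      next
        case False
        then have "Poly_Mapping.lookup b v = 0" using R[OF b] by (auto simp: in_keys_iff)
        then show ?thesis using e fin\<nu> False \<tau> by (auto simp: lookup_add lookup_sqfree_mon \<nu>_def)
      qed
    qed
    then show False using a[of \<nu>] \<tau> by (auto simp: \<nu>_def)
  qed
  then show ?thesis by (auto simp: shifted_row_def lookup_single_times fun_eq_iff)
qed

definition restrict_vars :: "'v set \<Rightarrow> ('v, 'a::field) mpoly \<Rightarrow> ('v, 'a) mpoly" where
  "restrict_vars Z Q = (\<Sum>m\<in>{m\<in>Poly_Mapping.keys Q. Poly_Mapping.keys m \<subseteq> Z}.
     Poly_Mapping.single m (Poly_Mapping.lookup Q m))"

lemma keys_sum_monomials_subset:
  "finite A \<Longrightarrow> Poly_Mapping.keys (\<Sum>m\<in>A. Poly_Mapping.single m (f m)) \<subseteq> A"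
  by (auto simp: in_keys_iff lookup_sum lookup_single when_def split: if_splits)

text \<open>Split \<open>Q\<close> into the monomials over \<open>Z\<close> alone
  (\<open>Q0\<close>) and the others (\<open>Q1\<close>). In \<open>Q1 ^ j * Q0 ^ (e - j)\<close>
  each monomial of \<open>Q1 ^ j\<close> either contributes nothing or merely enlarges the shift of
  \<open>Q0 ^ (e - j)\<close>. The generators depend on \<alpha> and \<beta> only through
  \<open>K\<close> and the size of \<beta>, so one family serves all rows; the binomial coefficients
  are scalars and may vanish in the field without harm.\<close>

lemma shifted_row_power_in_span:
  fixes Q :: "('v, 'a::field) mpoly"
  assumes Z: "finite Z" "Poly_Mapping.keys \<alpha> \<inter> Z = {}" "\<beta> \<subseteq> Z"
    and low: "\<And>m. m \<in> Poly_Mapping.keys Q \<Longrightarrow> relevant Z \<alpha> m \<Longrightarrow> card (Poly_Mapping.keys m \<inter> Z) \<le> t"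
    and K: "K = (\<Sum>v\<in>Poly_Mapping.keys \<alpha>. Poly_Mapping.lookup \<alpha> v)"
  shows "shifted_row (Q ^ e) Z \<alpha> \<beta> \<in> fun_space.span
    ((\<lambda>(j, \<gamma>). shifted_row (restrict_vars Z Q ^ (e - j)) Z 0 \<gamma>) ` ({..K} \<times> {\<gamma>. \<gamma> \<subseteq> Z \<and> card \<gamma> \<le> card \<beta> + K * t}))"
    (is "_ \<in> fun_space.span ?G")
proof -
  define Q1 where "Q1 = (\<Sum>m\<in>{m\<in>Poly_Mapping.keys Q. \<not> Poly_Mapping.keys m \<subseteq> Z}.
     Poly_Mapping.single m (Poly_Mapping.lookup Q m))"
  define Q0 where "Q0 = restrict_vars Z Q"
  define f where "f m = Poly_Mapping.single m (Poly_Mapping.lookup Q m)" for m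
  define A where "A = {m\<in>Poly_Mapping.keys Q. \<not> Poly_Mapping.keys m \<subseteq> Z}"
  define B where "B = {m\<in>Poly_Mapping.keys Q. Poly_Mapping.keys m \<subseteq> Z}"
  have AB: "finite A" "finite B" "A \<inter> B = {}" "Poly_Mapping.keys Q = A \<union> B" by (auto simp: A_def B_def)
  have "Q = sum f (Poly_Mapping.keys Q)" unfolding f_def by (rule poly_mapping_sum_monomials)
  also have "\<dots> = sum f A + sum f B" unfolding AB(4) using AB(1-3) by (rule sum.union_disjoint)
  also have "\<dots> = Q1 + Q0" by (simp add: Q1_def Q0_def restrict_vars_def A_def B_def f_def)
  finally have "Q = Q1 + Q0" .
  then have "Q ^ e = (Q1 + Q0) ^ e" by (rule arg_cong)
  then have expand: "Q ^ e = (\<Sum>j\<le>e. of_nat (e choose j) * (Q1 ^ j * Q0 ^ (e - j)))"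
    unfolding binomial_ring mult.assoc .
  have each: "shifted_row (Q1 ^ j * Q0 ^ (e - j)) Z \<alpha> \<beta> \<in> fun_space.span ?G" for j
  proof -
    let ?P = "Q1 ^ j" and ?R = "Q0 ^ (e - j)"
    have k1: "m \<in> Poly_Mapping.keys Q" "\<not> Poly_Mapping.keys m \<subseteq> Z" if "m \<in> Poly_Mapping.keys Q1" for m
      using that keys_sum_monomials_subset[of "{m\<in>Poly_Mapping.keys Q. \<not> Poly_Mapping.keys m \<subseteq> Z}" "Poly_Mapping.lookup Q"]
      by (auto simp: Q1_def)
    have k0: "Poly_Mapping.keys m \<subseteq> Z" if "m \<in> Poly_Mapping.keys Q0" for m
      using that keys_sum_monomials_subset[of "{m\<in>Poly_Mapping.keys Q. Poly_Mapping.keys m \<subseteq> Z}" "Poly_Mapping.lookup Q"]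
      by (auto simp: Q0_def restrict_vars_def)
    have kR: "Poly_Mapping.keys b \<subseteq> Z" if "b \<in> Poly_Mapping.keys ?R" for b
      using keys_power_subset[of Q0 Z] k0 that by blast
    have mono: "?P * ?R = (\<Sum>a\<in>Poly_Mapping.keys ?P. Poly_Mapping.single a (Poly_Mapping.lookup ?P a) * ?R)"
      unfolding sum_distrib_right[symmetric] poly_mapping_sum_monomials[symmetric] ..
    have "shifted_row (Poly_Mapping.single a (Poly_Mapping.lookup ?P a) * ?R) Z \<alpha> \<beta> \<in> fun_space.span ?G"
      if a: "a \<in> Poly_Mapping.keys ?P" for a
    proof (cases "\<exists>\<nu>\<subseteq>Z - \<beta>. a = \<alpha> + sqfree_mon \<nu>")
      case True
      then obtain \<nu> where \<nu>: "\<nu> \<subseteq> Z - \<beta>" "a = \<alpha> + sqfree_mon \<nu>" by blast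
      have fin: "finite \<nu>" "finite \<beta>" using \<nu> Z finite_subset by blast+
      have l0: "Poly_Mapping.lookup \<alpha> v = 0" if "v \<in> Z" for v using that Z(2) by (auto simp: in_keys_iff)
      have rel: "relevant Z \<alpha> a"
        using \<nu> Z fin by (auto simp: relevant_def keys_add_nat keys_sqfree_mon lookup_add lookup_sqfree_mon l0)
      have "(\<Sum>v\<in>Poly_Mapping.keys \<alpha>. Poly_Mapping.lookup a v) = K"
        unfolding K using \<nu> Z fin by (intro sum.cong) (auto simp: lookup_add lookup_sqfree_mon)
      moreover have "Poly_Mapping.keys a \<inter> Z = \<nu>"
        using \<nu> Z fin by (auto simp: keys_add_nat keys_sqfree_mon)
      ultimately have jt: "j \<le> K" "card \<nu> \<le> j * t"
        using relevant_power[of Q1 Z \<alpha> t a j] k1 low a rel by auto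
      have "card (\<beta> \<union> \<nu>) \<le> card \<beta> + card \<nu>" by (rule card_Un_le)
      also have "\<dots> \<le> card \<beta> + K * t" using jt mult_le_mono1[OF jt(1), of t] by linarith
      finally have "(j, \<beta> \<union> \<nu>) \<in> {..K} \<times> {\<gamma>. \<gamma> \<subseteq> Z \<and> card \<gamma> \<le> card \<beta> + K * t}"
        using jt \<nu> Z by auto
      then have "shifted_row ?R Z 0 (\<beta> \<union> \<nu>) \<in> ?G" unfolding Q0_def by force
      then show ?thesis unfolding \<nu>(2) shifted_row_single_times[OF Z(1,2) \<nu>(1)]
        by (intro fun_space.span_scale fun_space.span_base)
    next
      case False
      then have "shifted_row (Poly_Mapping.single a (Poly_Mapping.lookup ?P a) * ?R) Z \<alpha> \<beta> = 0"
        using shifted_row_single_times_zero[of Z ?R \<beta> a \<alpha>] Z kR by blast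
      then show ?thesis using fun_space.span_zero by simp
    qed
    then show ?thesis unfolding mono shifted_row_sum by (rule fun_space.span_sum)
  qed
  show ?thesis
    unfolding expand shifted_row_sum shifted_row_of_nat_times
    by (intro fun_space.span_sum fun_space.span_scale each)
qed

section \<open>Rank of a sum of powers\<close>

lemma sum_fun_apply: "sum f A x = (\<Sum>a\<in>A. f a x)"
  by (induction A rule: infinite_finite_induct) auto

text \<open>Unit vectors at distinct columns are independent, so a family that spans them is at
  least as large.\<close>

lemma card_indicators_le:
  fixes G :: "('b \<Rightarrow> 'a::field) set"
  assumes "finite G" "finite T" and ind: "\<And>t. t \<in> T \<Longrightarrow> (\<lambda>x. if x = t then 1 else 0) \<in> fun_space.span G"
  shows "card T \<le> card G"
proof -
  let ?i = "\<lambda>t x. if x = t then 1 else (0::'a)"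
  have inj: "inj_on ?i T" by (auto simp: inj_on_def fun_eq_iff split: if_splits)
  have "fun_space.independent (?i ` T)"
  proof (rule fun_space.independent_if_scalars_zero)
    fix f x assume z: "(\<Sum>x\<in>?i ` T. (\<lambda>y. f x * x y)) = 0" and "x \<in> ?i ` T"
    then obtain t where t: "t \<in> T" "x = ?i t" by blast
    have "(\<Sum>x\<in>?i ` T. (\<lambda>y. f x * x y)) t = (\<Sum>x\<in>?i ` T. f x * x t)" by (simp add: sum_fun_apply)
    also have "\<dots> = (\<Sum>u\<in>T. f (?i u) * ?i u t)" by (simp add: sum.reindex[OF inj] o_def)
    also have "\<dots> = (\<Sum>u\<in>T. if u = t then f (?i t) else 0)" by (intro sum.cong) auto
    also have "\<dots> = f x" using t assms by simp
    finally show "f x = 0" using z by simp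
  qed (use assms in auto)
  moreover have "?i ` T \<subseteq> fun_space.span G" using ind by auto
  ultimately have "card (?i ` T) \<le> card G" using fun_space.independent_span_bound[OF assms(1)] by blast
  then show ?thesis by (simp add: card_image[OF inj])
qed

text \<open>Every \<tau> may bring its own \<alpha> and \<beta>: for fixed \<open>K\<close> and
  \<open>l\<close> all these rows lie in the span of the one family \<open>G\<close>, whose size
  does not grow with the number of different \<alpha>.\<close>

lemma sum_of_powers_bound:
  fixes L :: "(('v, 'a::field) mpoly \<times> nat) list"
  assumes F: "F = (\<Sum>(Q, e)\<leftarrow>L. Q ^ e)" and Z: "finite Z" "finite T"
    and T: "\<And>\<tau>. \<tau> \<in> T \<Longrightarrow> \<exists>\<alpha> \<beta>. Poly_Mapping.keys \<alpha> \<inter> Z = {} \<and> \<beta> \<subseteq> Z \<and> card \<beta> = l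
      \<and> K = (\<Sum>v\<in>Poly_Mapping.keys \<alpha>. Poly_Mapping.lookup \<alpha> v)
      \<and> shifted_row F Z \<alpha> \<beta> = (\<lambda>x. if x = \<tau> then 1 else 0)
      \<and> (\<forall>(Q, e)\<in>set L. \<forall>m\<in>Poly_Mapping.keys Q. relevant Z \<alpha> m \<longrightarrow> card (Poly_Mapping.keys m \<inter> Z) \<le> t)"
  shows "card T \<le> card (set L) * ((K + 1) * card {\<gamma>. \<gamma> \<subseteq> Z \<and> card \<gamma> \<le> l + K * t})"
proof -
  define B where "B = {\<gamma>. \<gamma> \<subseteq> Z \<and> card \<gamma> \<le> l + K * t}"
  have finB: "finite B" unfolding B_def using Z by (auto intro: finite_subset[of _ "Pow Z"])
  define g where "g = (\<lambda>((Q :: ('v, 'a) mpoly, e :: nat), j, \<gamma>). shifted_row (restrict_vars Z Q ^ (e - j)) Z 0 \<gamma>)"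
  define G where "G = g ` (set L \<times> {..K} \<times> B)"
  have "card T \<le> card G"
  proof (rule card_indicators_le)
    fix \<tau> assume \<tau>: "\<tau> \<in> T"
    obtain \<alpha> \<beta> where ab: "Poly_Mapping.keys \<alpha> \<inter> Z = {}" "\<beta> \<subseteq> Z" "card \<beta> = l"
      "K = (\<Sum>v\<in>Poly_Mapping.keys \<alpha>. Poly_Mapping.lookup \<alpha> v)"
      "shifted_row F Z \<alpha> \<beta> = (\<lambda>x. if x = \<tau> then 1 else 0)"
      and low': "\<forall>(Q, e)\<in>set L. \<forall>m\<in>Poly_Mapping.keys Q. relevant Z \<alpha> m \<longrightarrow> card (Poly_Mapping.keys m \<inter> Z) \<le> t"
      using T[OF \<tau>] by (elim exE conjE) (rule that)
    have low: "card (Poly_Mapping.keys m \<inter> Z) \<le> t"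
      if "(Q, e) \<in> set L" "m \<in> Poly_Mapping.keys Q" "relevant Z \<alpha> m" for Q e m
      using low' that by blast
    have each: "shifted_row (Q ^ e) Z \<alpha> \<beta> \<in> fun_space.span G" if "(Q, e) \<in> set L" for Q e
    proof -
      have "shifted_row (Q ^ e) Z \<alpha> \<beta> \<in> fun_space.span
        ((\<lambda>(j, \<gamma>). shifted_row (restrict_vars Z Q ^ (e - j)) Z 0 \<gamma>) ` ({..K} \<times> {\<gamma>. \<gamma> \<subseteq> Z \<and> card \<gamma> \<le> card \<beta> + K * t}))"
        using Z(1) ab(1,2) low[OF that] ab(4) by (rule shifted_row_power_in_span)
      moreover have "(\<lambda>(j, \<gamma>). shifted_row (restrict_vars Z Q ^ (e - j)) Z 0 \<gamma>) ` ({..K} \<times> {\<gamma>. \<gamma> \<subseteq> Z \<and> card \<gamma> \<le> card \<beta> + K * t}) \<subseteq> G"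
      proof (clarsimp)
        fix j \<gamma> assume "j \<le> K" "\<gamma> \<subseteq> Z" "card \<gamma> \<le> card \<beta> + K * t"
        then have "((Q, e), j, \<gamma>) \<in> set L \<times> {..K} \<times> B" using that ab(3) by (auto simp: B_def)
        then have "g ((Q, e), j, \<gamma>) \<in> G" unfolding G_def by (rule imageI)
        then show "shifted_row (restrict_vars Z Q ^ (e - j)) Z 0 \<gamma> \<in> G" by (simp add: g_def)
      qed
      ultimately show ?thesis using fun_space.span_mono by blast
    qed
    have "shifted_row (\<Sum>(Q, e)\<leftarrow>M. Q ^ e) Z \<alpha> \<beta> \<in> fun_space.span G" if "set M \<subseteq> set L" for M
      using that
    proof (induction M)
      case Nil
      then show ?case using fun_space.span_zero[of G] by (simp add: shifted_row_zero zero_fun_def)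
    next
      case (Cons x M)
      obtain Q e where x: "x = (Q, e)" by (cases x)
      have "shifted_row (Q ^ e) Z \<alpha> \<beta> + shifted_row (\<Sum>(Q, e)\<leftarrow>M. Q ^ e) Z \<alpha> \<beta> \<in> fun_space.span G"
        using Cons each x by (intro fun_space.span_add) auto
      then show ?case by (simp add: shifted_row_add x plus_fun_def)
    qed
    from this[OF subset_refl] show "(\<lambda>x. if x = \<tau> then 1 else 0) \<in> fun_space.span G"
      unfolding F[symmetric] ab(5) .
  qed (use Z finB in \<open>auto simp: G_def\<close>)
  also have "card G \<le> card (set L \<times> {..K} \<times> B)" unfolding G_def using finB by (intro card_image_le) auto
  also have "\<dots> = card (set L) * ((K + 1) * card B)" by (simp add: card_cartesian_product)
  finally show ?thesis by (simp add: B_def)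
qed

section \<open>De Bruijn paths in the iterated matrix product\<close>

definition walk_edges :: "nat \<Rightarrow> (nat \<Rightarrow> nat) \<Rightarrow> imm_var set" where
  "walk_edges d \<pi> = (\<lambda>\<kappa>. (\<kappa>, walk_vertex d \<pi> (\<kappa> - 1), walk_vertex d \<pi> \<kappa>)) ` {1..d}"

lemma finite_walk_edges [simp]: "finite (walk_edges d \<pi>)"
  by (simp add: walk_edges_def)

lemma card_walk_edges: "card (walk_edges d \<pi>) = d"
  unfolding walk_edges_def by (subst card_image) (auto simp: inj_on_def)

lemma walk_edges_inj:
  assumes "\<pi> \<in> {1..<d} \<rightarrow>\<^sub>E {1..n}" "\<pi>' \<in> {1..<d} \<rightarrow>\<^sub>E {1..n}" "walk_edges d \<pi> = walk_edges d \<pi>'"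
  shows "\<pi> = \<pi>'"
proof (rule PiE_ext[OF assms(1,2)])
  fix \<kappa> assume \<kappa>: "\<kappa> \<in> {1..<d}"
  then have "(\<kappa>, walk_vertex d \<pi> (\<kappa> - 1), walk_vertex d \<pi> \<kappa>) \<in> walk_edges d \<pi>'"
    unfolding assms(3)[symmetric] by (auto simp: walk_edges_def)
  then have "walk_vertex d \<pi> \<kappa> = walk_vertex d \<pi>' \<kappa>" by (auto simp: walk_edges_def)
  then show "\<pi> \<kappa> = \<pi>' \<kappa>" using \<kappa> by (simp add: walk_vertex_def)
qed

lemma prod_mvar: "(\<Prod>x\<in>A. mvar (f x) :: ('v, 'a::field) mpoly) = Poly_Mapping.single (\<Sum>x\<in>A. Poly_Mapping.single (f x) 1) 1"
  by (induction A rule: infinite_finite_induct) (simp_all add: mvar_def mult_single single_one)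

lemma IMM_sum_monomials:
  "(IMM n d :: (imm_var, 'a::field) mpoly)
    = (\<Sum>\<pi>\<in>{1..<d} \<rightarrow>\<^sub>E {1..n}. Poly_Mapping.single (sqfree_mon (walk_edges d \<pi>)) 1)"
  unfolding IMM_def prod_mvar walk_edges_def sqfree_mon_def
  by (intro sum.cong refl, subst sum.reindex) (auto simp: inj_on_def)

lemma sqfree_mon_eq_iff: "finite A \<Longrightarrow> finite B \<Longrightarrow> sqfree_mon A = sqfree_mon B \<longleftrightarrow> A = B"
  by (metis keys_sqfree_mon)

text \<open>A walk is determined by its set of edges, so no two summands of \<open>IMM\<close> share
  a monomial and nothing cancels in any characteristic.\<close>

lemma lookup_IMM:
  assumes "finite E"
  shows "Poly_Mapping.lookup (IMM n d :: (imm_var, 'a::field) mpoly) (sqfree_mon E)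
    = (if \<exists>\<pi>\<in>{1..<d} \<rightarrow>\<^sub>E {1..n}. walk_edges d \<pi> = E then 1 else 0)"
proof -
  let ?W = "{1..<d} \<rightarrow>\<^sub>E {1..n}"
  have finW: "finite ?W" by (intro finite_PiE) auto
  have "Poly_Mapping.lookup (IMM n d :: (imm_var, 'a::field) mpoly) (sqfree_mon E)
      = (\<Sum>\<pi>\<in>?W. if walk_edges d \<pi> = E then 1 else 0)"
    unfolding IMM_sum_monomials lookup_sum lookup_single when_def
    using assms by (intro sum.cong refl) (simp add: sqfree_mon_eq_iff)
  also have "\<dots> = (if \<exists>\<pi>\<in>?W. walk_edges d \<pi> = E then 1 else 0)"
  proof (cases "\<exists>\<pi>\<in>?W. walk_edges d \<pi> = E")
    case True
    then obtain \<pi> where \<pi>: "\<pi> \<in> ?W" "walk_edges d \<pi> = E" by blast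
    have "(\<Sum>\<pi>\<in>?W. if walk_edges d \<pi> = E then 1 else 0) = (\<Sum>\<pi>'\<in>?W. if \<pi>' = \<pi> then 1 else (0::'a))"
    proof (intro sum.cong refl)
      fix \<pi>' assume "\<pi>' \<in> ?W"
      then have "walk_edges d \<pi>' = E \<longleftrightarrow> \<pi>' = \<pi>" using \<pi> walk_edges_inj[OF _ \<pi>(1), of \<pi>'] by blast
      then show "(if walk_edges d \<pi>' = E then 1 else 0) = (if \<pi>' = \<pi> then 1 else (0::'a))" by simp
    qed
    then show ?thesis using \<pi> True finW by simp
  qed auto
  finally show ?thesis .
qed

text \<open>Block \<open>i\<close> occupies the vertex layers \<open>lay i 0, \<dots>, lay i r\<close> below. A vertex is the set of
  ones among the next \<open>q\<close> bits of the path, so the last vertex of a block is \<open>{}\<close>; \<open>\<sigma>\<close> is the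
  random part of its label. The edges between blocks, and those after the last block (where all
  vertices are \<open>1\<close>), are the variables outside \<open>zvars\<close>.\<close>

locale skeleton =
  fixes n d k r q B :: nat and \<sigma> :: "nat \<Rightarrow> nat set \<Rightarrow> nat"
  assumes q: "1 \<le> q" "q \<le> r" and width: "2 ^ q * B \<le> n" and len: "k * (r + 1) + 1 \<le> d"
    and \<sigma>: "\<And>l v. v \<subseteq> {..<q} \<Longrightarrow> \<sigma> l v < B"
begin

text \<open>Each state owns an interval of \<open>B\<close> consecutive names, and \<sigma> picks
  one of them. So distinct states stay distinct for every \<sigma>, and a state can be read off its
  name without knowing \<sigma>.\<close>

definition code :: "nat \<Rightarrow> nat set \<Rightarrow> nat" where
  "code l v = 1 + set_encode v * B + \<sigma> l v"

lemma code_decode: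
  assumes "v \<subseteq> {..<q}"
  shows "(code l v - 1) div B = set_encode v" "(code l v - 1) mod B = \<sigma> l v"
  using \<sigma>[OF assms, of l] by (simp_all add: code_def)

lemma code_inj:
  assumes "v \<subseteq> {..<q}" "v' \<subseteq> {..<q}" "code l v = code l v'"
  shows "v = v'"
  using code_decode(1)[OF assms(1), of l] code_decode(1)[OF assms(2), of l] assms
  by (metis finite_lessThan finite_subset set_encode_eq)

lemma code_range:
  assumes "v \<subseteq> {..<q}"
  shows "code l v \<in> {1..n}"
proof -
  have "set_encode v \<le> (\<Sum>i\<in>{..<q}. 2 ^ i)"
    unfolding set_encode_def using assms by (intro sum_mono2) auto
  also have "\<dots> < 2 ^ q" by (simp add: lessThan_atLeast0 sum_power2)
  finally have "Suc (set_encode v) \<le> 2 ^ q" by simp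
  then have "Suc (set_encode v) * B \<le> 2 ^ q * B" by (rule mult_le_mono1)
  then show ?thesis using width \<sigma>[OF assms, of l] by (simp add: code_def)
qed

definition "paths = {..<k} \<rightarrow>\<^sub>E Pow {..<r}"

definition state :: "(nat \<Rightarrow> nat set) \<Rightarrow> nat \<Rightarrow> nat \<Rightarrow> nat set" where
  "state p i j = {s. s < q \<and> j + s \<in> p i}"

text \<open>An edge of the de Bruijn graph: dropping the last of its \<open>q + 1\<close> bits gives
  the tail state, dropping the first bit gives the head state. Bits past the end of a string read as
  0.\<close>

definition window :: "(nat \<Rightarrow> nat set) \<Rightarrow> nat \<Rightarrow> nat \<Rightarrow> nat set" where
  "window p i j = {s. s \<le> q \<and> j + s \<in> p i}"

text \<open>A block with \<open>r\<close> layers of edges has \<open>r + 1\<close> layers of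
  vertices. Layer 0 of the walk is the fixed vertex 1, hence the offset. The edge entering a layer
  belongs to the matrix of the same number, so \<open>zlayers\<close> lists the layers of
  heads.\<close>

definition lay :: "nat \<Rightarrow> nat \<Rightarrow> nat" where
  "lay i j = i * (r + 1) + j + 1"

definition vertex :: "(nat \<Rightarrow> nat set) \<Rightarrow> nat \<Rightarrow> nat" where
  "vertex p l = (let i = (l - 1) div (r + 1); j = (l - 1) mod (r + 1)
     in if i < k then code l (state p i j) else 1)"

definition path_walk :: "(nat \<Rightarrow> nat set) \<Rightarrow> nat \<Rightarrow> nat" where
  "path_walk p = restrict (vertex p) {1..<d}"

definition zlayers :: "nat set" where
  "zlayers = (\<lambda>(i, j). lay i j + 1) ` ({..<k} \<times> {..<r})"

definition zvar :: "nat \<Rightarrow> nat \<Rightarrow> nat set \<Rightarrow> imm_var" where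
  "zvar i j w = (lay i j + 1, code (lay i j) (w \<inter> {..<q}), code (lay i j + 1) {s. s < q \<and> Suc s \<in> w})"

text \<open>Only de Bruijn edges belong to \<open>Z\<close>. The other entries of these matrices
  occur in no path, and a monomial that contains one is never relevant.\<close>

definition zvars :: "imm_var set" where
  "zvars = (\<lambda>(i, j, w). zvar i j w) ` ({..<k} \<times> {..<r} \<times> Pow {..q})"

definition zedges :: "(nat \<Rightarrow> nat set) \<Rightarrow> imm_var set" where
  "zedges p = {e \<in> walk_edges d (path_walk p). fst e \<in> zlayers}"

definition yedges :: "(nat \<Rightarrow> nat set) \<Rightarrow> imm_var set" where
  "yedges p = {e \<in> walk_edges d (path_walk p). fst e \<notin> zlayers}"

lemma state_subset [simp]: "state p i j \<subseteq> {..<q}"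
  by (auto simp: state_def)

lemma lay_inj:
  assumes "lay i j = lay i' j'" "j \<le> r" "j' \<le> r"
  shows "i = i' \<and> j = j'"
proof -
  have e: "i * (r + 1) + j = i' * (r + 1) + j'" using assms by (simp add: lay_def)
  have "i = (i * (r + 1) + j) div (r + 1)" using assms by (simp add: div_add1_eq del: mult_Suc_right)
  moreover have "i' = (i' * (r + 1) + j') div (r + 1)" using assms by (simp add: div_add1_eq del: mult_Suc_right)
  ultimately have "i = i'" using e by simp
  then show ?thesis using e by simp
qed

lemma lay_Suc: "lay i j + 1 = lay i (j + 1)" "lay i (j + 1) - 1 = lay i j"
  by (simp_all add: lay_def)

lemma zlayersE:
  assumes "l \<in> zlayers"
  obtains i j where "i < k" "j < r" "l = lay i (j + 1)"
  using assms unfolding zlayers_def lay_Suc(1)[symmetric] by auto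

lemma zlayersI: "i < k \<Longrightarrow> j < r \<Longrightarrow> lay i (j + 1) \<in> zlayers"
  unfolding zlayers_def lay_Suc(1)[symmetric] by force

lemma lay_0_notin_zlayers: "lay i 0 \<notin> zlayers"
proof
  assume "lay i 0 \<in> zlayers"
  then obtain i' j' where "j' < r" "lay i 0 = lay i' (j' + 1)" by (rule zlayersE)
  then show False using lay_inj[of i 0 i' "j' + 1"] by simp
qed

lemma lay_div_mod:
  assumes "j \<le> r"
  shows "(lay i j - 1) div (r + 1) = i" "(lay i j - 1) mod (r + 1) = j"
  using assms by (simp_all add: lay_def div_add1_eq del: mult_Suc_right)

lemma lay_of:
  assumes "1 \<le> l" "(l - 1) div (r + 1) < k"
  obtains i j where "i < k" "j \<le> r" "l = lay i j"
proof (rule that)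
  show "(l - 1) div (r + 1) < k" by fact
  show "(l - 1) mod (r + 1) \<le> r" by (metis add.commute less_Suc_eq_le mod_less_divisor plus_1_eq_Suc zero_less_Suc)
  show "l = lay ((l - 1) div (r + 1)) ((l - 1) mod (r + 1))"
    using assms(1) div_mult_mod_eq[of "l - 1" "r + 1"] by (simp only: lay_def)
qed

lemma vertex_lay: "i < k \<Longrightarrow> j \<le> r \<Longrightarrow> vertex p (lay i j) = code (lay i j) (state p i j)"
  unfolding vertex_def by (simp only: lay_div_mod Let_def if_True)

lemma lay_less: assumes "i < k" "j \<le> r" shows "lay i j < d"
proof -
  have "(i + 1) * (r + 1) \<le> k * (r + 1)" using assms(1) by (intro mult_le_mono1) simp
  then show ?thesis using assms(2) len by (simp add: lay_def)
qed

lemma vertex_range: "vertex p l \<in> {1..n}"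
proof -
  have "code 0 {} \<in> {1..n}" by (rule code_range) simp
  then have "1 \<in> {1..n}" by auto
  then show ?thesis using code_range[OF state_subset] unfolding vertex_def Let_def by auto
qed

lemma path_walk_in: "path_walk p \<in> {1..<d} \<rightarrow>\<^sub>E {1..n}"
  unfolding path_walk_def using vertex_range by (simp add: restrict_PiE_iff)

lemma vertex_end: "vertex p d = 1"
proof -
  have "k * (r + 1) \<le> d - 1" using len by simp
  then have "k \<le> (d - 1) div (r + 1)" by (metis div_le_mono nonzero_mult_div_cancel_right add_is_0 one_neq_zero)
  then show ?thesis by (simp add: vertex_def)
qed

lemma walk_vertex_path: "1 \<le> l \<Longrightarrow> l \<le> d \<Longrightarrow> walk_vertex d (path_walk p) l = vertex p l"
  using vertex_end by (auto simp: walk_vertex_def path_walk_def)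

lemma window_tail: "window p i j \<inter> {..<q} = state p i j"
  by (auto simp: window_def state_def)

lemma window_head: "{s. s < q \<and> Suc s \<in> window p i j} = state p i (j + 1)"
  by (auto simp: window_def state_def)

lemma zvar_window: "zvar i j (window p i j) = (lay i j + 1, code (lay i j) (state p i j), code (lay i (j + 1)) (state p i (j + 1)))"
  unfolding zvar_def window_tail window_head by (simp add: lay_def)

lemma zvar_inj:
  assumes "zvar i j w = zvar i' j' w'" "j < r" "j' < r" "w \<subseteq> {..q}" "w' \<subseteq> {..q}"
  shows "i = i' \<and> j = j' \<and> w = w'"
proof -
  have "lay i j = lay i' j'" using assms(1) by (simp add: zvar_def)
  then have ij: "i = i'" "j = j'" using lay_inj[of i j i' j'] assms(2,3) by auto
  have sub: "v \<inter> {..<q} \<subseteq> {..<q}" "{s. s < q \<and> Suc s \<in> v} \<subseteq> {..<q}" for v by auto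
  have t: "w \<inter> {..<q} = w' \<inter> {..<q}"
    by (rule code_inj[of _ _ "lay i j"]) (use sub assms(1) ij in \<open>auto simp: zvar_def\<close>)
  have h: "{s. s < q \<and> Suc s \<in> w} = {s. s < q \<and> Suc s \<in> w'}"
    by (rule code_inj[of _ _ "lay i j + 1"]) (use sub assms(1) ij in \<open>auto simp: zvar_def\<close>)
  have "s \<in> w \<longleftrightarrow> s \<in> w'" for s
  proof (cases "s < q")
    case True
    then show ?thesis using t by blast
  next
    case False
    show ?thesis
    proof (cases "s = q")
      case True
      \<comment> \<open>The last bit of a window is visible only in the head state, at position
        \<open>q - 1\<close>.\<close>
      then obtain s' where "s = Suc s'" "s' < q" using q by (cases s) auto
      then show ?thesis using h by blast
    next
      case F: False
      then show ?thesis using False assms(4,5) by auto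
    qed
  qed
  then show ?thesis using ij by blast
qed

lemma finite_zvars [simp]: "finite zvars"
  by (simp add: zvars_def)

lemma card_zvars: "card zvars = k * r * 2 ^ (q + 1)"
proof -
  have "inj_on (\<lambda>(i, j, w). zvar i j w) ({..<k} \<times> {..<r} \<times> Pow {..q})"
    by (rule inj_onI) (clarify, drule zvar_inj, auto)
  then have "card zvars = card ({..<k} \<times> {..<r} \<times> Pow {..q})" unfolding zvars_def by (rule card_image)
  then show ?thesis by (simp add: card_cartesian_product card_Pow mult.assoc)
qed

lemma path_edge:
  assumes "i < k" "j < r"
  shows "(lay i j + 1, walk_vertex d (path_walk p) (lay i j + 1 - 1), walk_vertex d (path_walk p) (lay i j + 1))
    = zvar i j (window p i j)"
proof -
  have "lay i (j + 1) < d" "lay i j < d" "1 \<le> lay i j" "1 \<le> lay i (j + 1)"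
    using assms lay_less[of i "j + 1"] lay_less[of i j] by (auto simp: lay_def)
  then have "walk_vertex d (path_walk p) (lay i j) = code (lay i j) (state p i j)"
    "walk_vertex d (path_walk p) (lay i (j + 1)) = code (lay i (j + 1)) (state p i (j + 1))"
    using assms vertex_lay[of i j p] vertex_lay[of i "j + 1" p]
    by (simp_all only: walk_vertex_path less_imp_le Suc_leI flip: Suc_eq_plus1)
  moreover have "lay i j + 1 = lay i (j + 1)" by (simp add: lay_def)
  ultimately show ?thesis unfolding zvar_window add_diff_cancel_right' by simp
qed

lemma zedges_eq: "zedges p = (\<lambda>(i, j). zvar i j (window p i j)) ` ({..<k} \<times> {..<r})"
proof
  show "zedges p \<subseteq> (\<lambda>(i, j). zvar i j (window p i j)) ` ({..<k} \<times> {..<r})"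
  proof
    fix e assume "e \<in> zedges p"
    then obtain \<kappa> where e: "e = (\<kappa>, walk_vertex d (path_walk p) (\<kappa> - 1), walk_vertex d (path_walk p) \<kappa>)"
      and "\<kappa> \<in> zlayers" by (auto simp: zedges_def walk_edges_def)
    then obtain i j where ij: "i < k" "j < r" "\<kappa> = lay i j + 1" by (auto simp: zlayers_def)
    have "e = (\<lambda>(i, j). zvar i j (window p i j)) (i, j)" unfolding e ij(3) path_edge[OF ij(1,2)] by simp
    then show "e \<in> (\<lambda>(i, j). zvar i j (window p i j)) ` ({..<k} \<times> {..<r})" using ij by blast
  qed
  show "(\<lambda>(i, j). zvar i j (window p i j)) ` ({..<k} \<times> {..<r}) \<subseteq> zedges p"
  proof clarsimp
    fix i j assume ij: "i < k" "j < r"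
    have "lay i j + 1 \<in> {1..d}" using lay_less[of i j] ij by simp
    then have "zvar i j (window p i j) \<in> walk_edges d (path_walk p)"
      unfolding path_edge[OF ij, symmetric] walk_edges_def by blast
    then show "zvar i j (window p i j) \<in> zedges p" using ij by (auto simp: zedges_def zvar_def zlayers_def)
  qed
qed

lemma finite_edges [simp]: "finite (zedges p)" "finite (yedges p)"
  by (simp_all add: zedges_def yedges_def)

lemma zedges_subset: "zedges p \<subseteq> zvars"
proof
  fix e assume "e \<in> zedges p"
  then obtain i j where ij: "i < k" "j < r" "e = (\<lambda>(i, j, w). zvar i j w) (i, j, window p i j)"
    unfolding zedges_eq by auto
  have "(i, j, window p i j) \<in> {..<k} \<times> {..<r} \<times> Pow {..q}" using ij by (auto simp: window_def)
  then show "e \<in> zvars" unfolding zvars_def ij(3) by (rule imageI)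
qed

lemma card_zedges: "card (zedges p) = k * r"
proof -
  have "inj_on (\<lambda>(i, j). zvar i j (window p i j)) ({..<k} \<times> {..<r})"
    by (rule inj_onI) (clarify, drule zvar_inj, auto simp: window_def)
  then show ?thesis by (simp add: zedges_eq card_image card_cartesian_product)
qed

lemma fst_zvars: "e \<in> zvars \<Longrightarrow> fst e \<in> zlayers"
  by (auto simp: zvars_def zlayers_def zvar_def)

lemma walk_edges_path: "walk_edges d (path_walk p) = yedges p \<union> zedges p" "yedges p \<inter> zvars = {}"
  using fst_zvars by (auto simp: yedges_def zedges_def)

lemma card_yedges: "card (yedges p) = d - k * r"
proof -
  have "yedges p = walk_edges d (path_walk p) - zedges p" by (auto simp: yedges_def zedges_def)
  then show ?thesis using card_zedges[of p]
    by (simp add: card_Diff_subset card_walk_edges zedges_def)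
qed

text \<open>Edges of \<open>Z\<close> in consecutive layers share a vertex, so their windows agree
  on \<open>q\<close> bits and glue to one string per block. The edge leaving a block is outside
  \<open>Z\<close>, hence an edge of \<open>p\<close>, and pins the last state to \<open>{}\<close>;
  this forces the bits beyond \<open>r\<close> to be 0.\<close>

lemma walk_of_path:
  assumes p: "p \<in> paths" and \<pi>: "\<pi> \<in> {1..<d} \<rightarrow>\<^sub>E {1..n}"
    and E: "walk_edges d \<pi> = yedges p \<union> \<mu>" "\<mu> \<subseteq> zvars"
  shows "\<exists>p'\<in>paths. path_walk p' = \<pi>"
proof -
  define vx where "vx = walk_vertex d \<pi>"
  have edge: "(\<kappa>, vx (\<kappa> - 1), vx \<kappa>) \<in> yedges p \<union> \<mu>" if "\<kappa> \<in> {1..d}" for \<kappa>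
    using that unfolding E(1)[symmetric] walk_edges_def vx_def by blast
  have y: "vx (\<kappa> - 1) = walk_vertex d (path_walk p) (\<kappa> - 1)" "vx \<kappa> = walk_vertex d (path_walk p) \<kappa>"
    if "\<kappa> \<in> {1..d}" "\<kappa> \<notin> zlayers" for \<kappa>
  proof -
    have "(\<kappa>, vx (\<kappa> - 1), vx \<kappa>) \<in> walk_edges d (path_walk p)"
    proof -
      have "(\<kappa>, vx (\<kappa> - 1), vx \<kappa>) \<notin> zvars" using fst_zvars[of "(\<kappa>, vx (\<kappa> - 1), vx \<kappa>)"] that(2) by auto
      then have "(\<kappa>, vx (\<kappa> - 1), vx \<kappa>) \<in> yedges p" using edge[OF that(1)] E(2) by blast
      then show ?thesis by (simp add: yedges_def)
    qed
    then show "vx (\<kappa> - 1) = walk_vertex d (path_walk p) (\<kappa> - 1)" "vx \<kappa> = walk_vertex d (path_walk p) \<kappa>"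
      by (auto simp: walk_edges_def)
  qed
  define good where "good i j w \<longleftrightarrow> w \<subseteq> {..q} \<and> vx (lay i j) = code (lay i j) (w \<inter> {..<q})
      \<and> vx (lay i (j + 1)) = code (lay i (j + 1)) {s. s < q \<and> Suc s \<in> w}" for i j w
  have ex: "\<exists>w. good i j w" if "i < k" "j < r" for i j
  proof -
    define \<kappa> where "\<kappa> = lay i (j + 1)"
    have \<kappa>: "\<kappa> - 1 = lay i j" "\<kappa> \<in> zlayers"
      using that zlayersI by (simp_all only: \<kappa>_def lay_Suc)
    have "1 \<le> \<kappa>" "\<kappa> < d" using lay_less[of i "j + 1"] that by (simp_all add: \<kappa>_def) (simp add: lay_def)
    then have \<kappa>d: "\<kappa> \<in> {1..d}" by simp
    have "(\<kappa>, vx (\<kappa> - 1), vx \<kappa>) \<notin> yedges p" using \<kappa>(2) by (simp add: yedges_def)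
    then have "(\<kappa>, vx (\<kappa> - 1), vx \<kappa>) \<in> zvars" using edge[OF \<kappa>d] E(2) by blast
    then obtain i' j' w where w: "j' < r" "w \<subseteq> {..q}" "(\<kappa>, vx (\<kappa> - 1), vx \<kappa>) = zvar i' j' w"
      by (auto simp: zvars_def)
    have "\<kappa> = lay i' j' + 1" using w(3) by (simp add: zvar_def)
    then have "lay i (j + 1) = lay i' (j' + 1)" unfolding \<kappa>_def lay_Suc .
    then have ij: "i' = i" "j' = j" using lay_inj[of i "j + 1" i' "j' + 1"] w(1) that by auto
    have "vx (\<kappa> - 1) = code (lay i j) (w \<inter> {..<q})" "vx \<kappa> = code (lay i j + 1) {s. s < q \<and> Suc s \<in> w}"
      using w(3) unfolding zvar_def ij prod.inject by blast+
    then show ?thesis using w(2) unfolding good_def \<kappa>(1) unfolding \<kappa>_def lay_Suc(1) by blast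
  qed
  define w where "w i j = (SOME w. good i j w)" for i j
  have "good i j (w i j)" if "i < k" "j < r" for i j
    unfolding w_def using ex[OF that] by (rule someI_ex)
  then have w: "\<And>i j. i < k \<Longrightarrow> j < r \<Longrightarrow> w i j \<subseteq> {..q}"
    "\<And>i j. i < k \<Longrightarrow> j < r \<Longrightarrow> vx (lay i j) = code (lay i j) (w i j \<inter> {..<q})"
    "\<And>i j. i < k \<Longrightarrow> j < r \<Longrightarrow> vx (lay i (j + 1)) = code (lay i (j + 1)) {s. s < q \<and> Suc s \<in> w i j}"
    unfolding good_def by blast+
  have last: "{s. s < q \<and> Suc s \<in> w i j} = {}" if "i < k" "j < r" "j + 1 = r" for i j
  proof -
    define \<kappa> where "\<kappa> = lay (i + 1) 0"
    have \<kappa>1: "\<kappa> = lay i r + 1" by (simp add: \<kappa>_def lay_def)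
    have "1 \<le> lay i r" by (simp add: lay_def)
    moreover have "lay i r < d" using lay_less[of i r] that by simp
    moreover have "\<kappa> \<notin> zlayers" unfolding \<kappa>_def by (rule lay_0_notin_zlayers)
    moreover have "\<kappa> - 1 = lay i r" by (simp add: \<kappa>1)
    moreover have "\<kappa> \<in> {1..d}" using \<open>lay i r < d\<close> by (simp add: \<kappa>1)
    ultimately have \<kappa>: "\<kappa> - 1 = lay i r" "\<kappa> \<in> {1..d}" "\<kappa> \<notin> zlayers" "1 \<le> lay i r" "lay i r < d"
      by blast+
    then have "vx (lay i r) = code (lay i r) (state p i r)"
      using y(1)[OF \<kappa>(2,3)] that \<kappa>(4,5) unfolding \<kappa>(1) by (simp add: walk_vertex_path vertex_lay)
    moreover have "p i \<subseteq> {..<r}" using p that(1) by (auto simp: paths_def PiE_iff)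
    then have "state p i r = {}" by (auto simp: state_def)
    ultimately have "code (lay i r) {s. s < q \<and> Suc s \<in> w i j} = code (lay i r) {}"
      using w(3)[OF that(1,2)] unfolding that(3) by simp
    then show ?thesis by (rule code_inj[rotated 2]) auto
  qed
  \<comment> \<open>Bit \<open>s\<close> of a window moves step by step to bit 0 of the window
    \<open>s\<close> layers later; at the end of the block \<open>last\<close> takes over.\<close>
  have bits: "s \<in> w i j \<longleftrightarrow> j + s < r \<and> 0 \<in> w i (j + s)" if "i < k" "j < r" "s \<le> q" for i j s
    using that
  proof (induction s arbitrary: j)
    case (Suc s)
    have "Suc s \<in> w i j \<longleftrightarrow> s \<in> {s. s < q \<and> Suc s \<in> w i j}" using Suc.prems by simp
    also have "\<dots> \<longleftrightarrow> j + Suc s < r \<and> 0 \<in> w i (j + Suc s)"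
    proof (cases "j + 1 < r")
      case True
      have "code (lay i (j + 1)) {s. s < q \<and> Suc s \<in> w i j} = code (lay i (j + 1)) (w i (j + 1) \<inter> {..<q})"
        using w(2)[OF Suc.prems(1) True] w(3)[OF Suc.prems(1,2)] by (rule trans[OF sym, rotated])
      then have "{s. s < q \<and> Suc s \<in> w i j} = w i (j + 1) \<inter> {..<q}"
        by (rule code_inj[rotated 2]) auto
      then show ?thesis using Suc.IH[of "j + 1"] Suc.prems True by auto
    next
      case False
      then show ?thesis using last[of i j] Suc.prems by auto
    qed
    finally show ?case .
  qed simp
  define p' where "p' = restrict (\<lambda>i. {j. j < r \<and> 0 \<in> w i j}) {..<k}"
  have p': "p' \<in> paths" by (auto simp: p'_def paths_def)
  have tail: "w i j \<inter> {..<q} = state p' i j" if "i < k" "j < r" for i j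
    using bits[OF that] that w(1)[OF that] by (auto simp: state_def p'_def)
  have head: "{s. s < q \<and> Suc s \<in> w i j} = state p' i (j + 1)" if "i < k" "j < r" for i j
    using bits[OF that, of "Suc _"] that by (auto simp: state_def p'_def)
  have "path_walk p' = \<pi>"
  proof (rule PiE_ext[OF path_walk_in \<pi>])
    fix l assume l: "l \<in> {1..<d}"
    have "vertex p' l = vx l"
    proof (cases "(l - 1) div (r + 1) < k")
      case True
      then obtain i j where ij: "i < k" "j \<le> r" "l = lay i j" using lay_of[of l] l by auto
      show ?thesis
      proof (cases "j < r")
        case True
        then show ?thesis using ij w(2)[OF ij(1) True] tail[OF ij(1) True] by (simp add: vertex_lay)
      next
        case False
        then have j: "j = (r - 1) + 1" "r - 1 < r" using ij q by auto
        show ?thesis using ij w(3)[OF ij(1) j(2)] head[OF ij(1) j(2)] j(1) by (simp add: vertex_lay)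
      qed
    next
      case False
      have "l \<notin> zlayers"
      proof
        assume "l \<in> zlayers"
        then obtain i j where "i < k" "j < r" "l = lay i (j + 1)" by (rule zlayersE)
        then show False using False lay_div_mod(1)[of "j + 1" i] by simp
      qed
      then have "vx l = vertex p l" using y(2)[of l] l by (simp add: walk_vertex_path)
      then show ?thesis using False by (simp add: vertex_def)
    qed
    then show "path_walk p' l = \<pi> l" using l by (simp add: path_walk_def vx_def walk_vertex_def)
  qed
  then show ?thesis using p' by blast
qed

text \<open>A nonzero entry at \<tau> yields a path \<open>p'\<close> with the same edges outside
  \<open>Z\<close> as \<open>p\<close> and with \<open>zedges p' = \<tau> - \<beta>\<close>, which
  is disjoint from \<beta>. Isolation forces \<open>p' = p\<close>, and this determines
  \<tau>.\<close>

lemma isolated_shifted_row: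
  assumes "(p, \<beta>) \<in> isolated_pairs zvars paths zedges (\<lambda>p p'. yedges p = yedges p') l"
  shows "shifted_row (IMM n d :: (imm_var, 'a::field) mpoly) zvars (sqfree_mon (yedges p)) \<beta>
    = (\<lambda>\<tau>. if \<tau> = \<beta> \<union> zedges p then 1 else 0)"
proof
  fix \<tau>
  have iso: "p \<in> paths" "\<beta> \<subseteq> zvars" "\<beta> \<inter> zedges p = {}"
    "\<And>p'. p' \<in> paths \<Longrightarrow> yedges p = yedges p' \<Longrightarrow> p' \<noteq> p \<Longrightarrow> \<beta> \<inter> zedges p' \<noteq> {}"
    using assms by (auto simp: isolated_pairs_def)
  show "shifted_row (IMM n d :: (imm_var, 'a::field) mpoly) zvars (sqfree_mon (yedges p)) \<beta> \<tau>
    = (if \<tau> = \<beta> \<union> zedges p then 1 else 0)"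
  proof (cases "\<beta> \<subseteq> \<tau> \<and> \<tau> \<subseteq> zvars")
    case True
    then have fin: "finite \<tau>" using finite_zvars finite_subset by blast
    have "sqfree_mon (yedges p) + sqfree_mon (\<tau> - \<beta>) = sqfree_mon (yedges p \<union> (\<tau> - \<beta>))"
      unfolding sqfree_mon_def using fin walk_edges_path(2)[of p] True
      by (intro sum.union_disjoint[symmetric]) auto
    then have "shifted_row (IMM n d :: (imm_var, 'a) mpoly) zvars (sqfree_mon (yedges p)) \<beta> \<tau>
        = (if \<exists>\<pi>\<in>{1..<d} \<rightarrow>\<^sub>E {1..n}. walk_edges d \<pi> = yedges p \<union> (\<tau> - \<beta>) then 1 else 0)"
      using True fin by (simp add: shifted_row_def lookup_IMM)
    moreover have "(\<exists>\<pi>\<in>{1..<d} \<rightarrow>\<^sub>E {1..n}. walk_edges d \<pi> = yedges p \<union> (\<tau> - \<beta>)) \<longleftrightarrow> \<tau> = \<beta> \<union> zedges p"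
    proof
      assume "\<exists>\<pi>\<in>{1..<d} \<rightarrow>\<^sub>E {1..n}. walk_edges d \<pi> = yedges p \<union> (\<tau> - \<beta>)"
      then obtain \<pi> where \<pi>: "\<pi> \<in> {1..<d} \<rightarrow>\<^sub>E {1..n}" "walk_edges d \<pi> = yedges p \<union> (\<tau> - \<beta>)" by blast
      obtain p' where p': "p' \<in> paths" "path_walk p' = \<pi>"
        using walk_of_path[OF iso(1) \<pi>] True by blast
      have eq: "walk_edges d (path_walk p') = yedges p \<union> (\<tau> - \<beta>)" using p' \<pi> by simp
      have "yedges p' = yedges p"
        unfolding yedges_def[of p'] eq using True fst_zvars by (auto simp: yedges_def)
      moreover have "zedges p' = \<tau> - \<beta>"
        unfolding zedges_def[of p'] eq using True fst_zvars by (auto simp: yedges_def)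
      ultimately have "p' = p" "\<tau> - \<beta> = zedges p'" using iso(4)[OF p'(1)] by auto
      then show "\<tau> = \<beta> \<union> zedges p" using True by auto
    next
      assume "\<tau> = \<beta> \<union> zedges p"
      then have "\<tau> - \<beta> = zedges p" using iso(3) by auto
      then show "\<exists>\<pi>\<in>{1..<d} \<rightarrow>\<^sub>E {1..n}. walk_edges d \<pi> = yedges p \<union> (\<tau> - \<beta>)"
        using path_walk_in[of p] walk_edges_path(1)[of p] by auto
    qed
    ultimately show ?thesis by simp
  next
    case False
    then show ?thesis using iso(2) zedges_subset by (auto simp: shifted_row_def)
  qed
qed

section \<open>Overlap sums over pairs of paths\<close>

definition sdiff :: "nat set \<Rightarrow> nat set \<Rightarrow> nat set" where
  "sdiff X Y = (X - Y) \<union> (Y - X)"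

text \<open>Two paths use different edges in a layer exactly when the window there meets the
  symmetric difference of their strings. Nothing lies beyond the end of a block, so the influence
  parameter is 0.\<close>

lemma card_zedges_diff:
  "k * r - card (zedges p \<inter> zedges p') = (\<Sum>i<k. reach q (sdiff (p i) (p' i)) r 0)"
proof -
  define A where "A = {(i, j). i < k \<and> j < r \<and> window p i j = window p' i j}"
  define C where "C = (SIGMA i:{..<k}. {j. j < r \<and> window p i j \<noteq> window p' i j})"
  have w: "window p i j \<subseteq> {..q}" for p i j by (auto simp: window_def)
  have "zedges p \<inter> zedges p' = (\<lambda>(i, j). zvar i j (window p i j)) ` A"
  proof
    show "zedges p \<inter> zedges p' \<subseteq> (\<lambda>(i, j). zvar i j (window p i j)) ` A"
    proof
      fix e assume "e \<in> zedges p \<inter> zedges p'"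
      then obtain i j i' j' where e: "i < k" "j < r" "e = zvar i j (window p i j)"
        "i' < k" "j' < r" "e = zvar i' j' (window p' i' j')" unfolding zedges_eq by auto
      then have "i = i' \<and> j = j' \<and> window p i j = window p' i' j'" using w by (intro zvar_inj) auto
      then have "(i, j) \<in> A" using e by (auto simp: A_def)
      then show "e \<in> (\<lambda>(i, j). zvar i j (window p i j)) ` A" using e(3) by force
    qed
    have A: "A \<subseteq> {..<k} \<times> {..<r}" by (auto simp: A_def)
    have "(\<lambda>(i, j). zvar i j (window p i j)) ` A = (\<lambda>(i, j). zvar i j (window p' i j)) ` A"
      by (rule image_cong) (auto simp: A_def)
    then show "(\<lambda>(i, j). zvar i j (window p i j)) ` A \<subseteq> zedges p \<inter> zedges p'"
      using image_mono[OF A, of "\<lambda>(i, j). zvar i j (window p i j)"]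
        image_mono[OF A, of "\<lambda>(i, j). zvar i j (window p' i j)"] by (simp add: zedges_eq)
  qed
  moreover have "inj_on (\<lambda>(i, j). zvar i j (window p i j)) A"
    using w by (intro inj_onI) (clarsimp simp: A_def, drule zvar_inj, auto)
  ultimately have cA: "card (zedges p \<inter> zedges p') = card A" by (simp add: card_image)
  have AC: "{..<k} \<times> {..<r} = A \<union> C" "A \<inter> C = {}" by (auto simp: A_def C_def)
  have "finite (A \<union> C)" unfolding AC(1)[symmetric] by simp
  then have "card (A \<union> C) = card A + card C" using AC(2) by (intro card_Un_disjoint) auto
  moreover have "card (A \<union> C) = k * r" unfolding AC(1)[symmetric] by (simp add: card_cartesian_product)
  ultimately have "k * r - card (zedges p \<inter> zedges p') = card C" using cA by simp
  also have "card C = (\<Sum>i<k. card {j. j < r \<and> window p i j \<noteq> window p' i j})"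
    unfolding C_def by (subst card_SigmaI) auto
  also have "\<dots> = (\<Sum>i<k. reach q (sdiff (p i) (p' i)) r 0)"
  proof (intro sum.cong refl)
    fix i
    have "window p i j \<noteq> window p' i j \<longleftrightarrow> (\<exists>e\<in>sdiff (p i) (p' i). j \<le> e \<and> e \<le> j + q)" for j
    proof
      assume "window p i j \<noteq> window p' i j"
      then obtain s where "s \<le> q" "j + s \<in> sdiff (p i) (p' i)" by (auto simp: window_def sdiff_def)
      then show "\<exists>e\<in>sdiff (p i) (p' i). j \<le> e \<and> e \<le> j + q" by (intro bexI[of _ "j + s"]) auto
    next
      assume "\<exists>e\<in>sdiff (p i) (p' i). j \<le> e \<and> e \<le> j + q"
      then obtain e where e: "e \<in> sdiff (p i) (p' i)" "j \<le> e" "e \<le> j + q" by blast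
      then have "(e - j \<in> window p i j) \<noteq> (e - j \<in> window p' i j)" by (auto simp: window_def sdiff_def)
      then show "window p i j \<noteq> window p' i j" by blast
    qed
    then have "{j. j < r \<and> window p i j \<noteq> window p' i j}
        = {j. j < r \<and> ((\<exists>e\<in>sdiff (p i) (p' i). j \<le> e \<and> e \<le> j + q) \<or> r \<le> j + 0)}" by auto
    then show "card {j. j < r \<and> window p i j \<noteq> window p' i j} = reach q (sdiff (p i) (p' i)) r 0"
      by (simp only: reach_def)
  qed
  finally show ?thesis .
qed

text \<open>As \<open>sdiff (p i)\<close> is an involution, summing over \<open>p'\<close> is
  summing over the differences. These vary independently across blocks, and the sum becomes a
  \<open>k\<close>-th power.\<close>

lemma sum_overlaps:
  fixes \<theta> :: real
  assumes p: "p \<in> paths" and S: "S \<subseteq> Pow {..<r}"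
  shows "(\<Sum>p'\<in>{..<k} \<rightarrow>\<^sub>E Pow {..<r}. if \<forall>i<k. sdiff (p i) (p' i) \<in> S then \<theta> ^ (k * r - card (zedges p \<inter> zedges p')) else 0)
    = (\<Sum>E\<in>S. \<theta> ^ reach q E r 0) ^ k"
proof -
  have fS: "finite S" using S finite_subset by blast
  define T where "T i = {x. x \<subseteq> {..<r} \<and> sdiff (p i) x \<in> S}" for i
  have fT: "finite (T i)" for i unfolding T_def by (rule finite_subset[of _ "Pow {..<r}"]) auto
  have one: "(\<Sum>x\<in>T i. \<theta> ^ reach q (sdiff (p i) x) r 0) = (\<Sum>E\<in>S. \<theta> ^ reach q E r 0)" if "i < k" for i
  proof (rule sum.reindex_bij_witness[of _ "sdiff (p i)" "sdiff (p i)"])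
    have pi: "p i \<subseteq> {..<r}" using p that by (auto simp: paths_def)
    have inv: "sdiff (p i) (sdiff (p i) x) = x" for x by (auto simp: sdiff_def)
    show "sdiff (p i) (sdiff (p i) x) = x" for x by (rule inv)
    show "sdiff (p i) (sdiff (p i) x) = x" for x by (rule inv)
    show "sdiff (p i) x \<in> T i" if "x \<in> S" for x
      using that S pi inv by (auto simp: T_def sdiff_def)
  qed (auto simp: T_def)
  have "(\<Sum>E\<in>S. \<theta> ^ reach q E r 0) ^ k = (\<Prod>i\<in>{..<k}. \<Sum>x\<in>T i. \<theta> ^ reach q (sdiff (p i) x) r 0)"
    using one by simp
  also have "\<dots> = (\<Sum>p'\<in>PiE {..<k} T. \<Prod>i\<in>{..<k}. \<theta> ^ reach q (sdiff (p i) (p' i)) r 0)"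
    using fT by (intro prod_sum_PiE) auto
  also have "\<dots> = (\<Sum>p'\<in>PiE {..<k} T. \<theta> ^ (k * r - card (zedges p \<inter> zedges p')))"
    by (simp add: card_zedges_diff power_sum)
  also have "\<dots> = (\<Sum>p'\<in>{..<k} \<rightarrow>\<^sub>E Pow {..<r}. if \<forall>i<k. sdiff (p i) (p' i) \<in> S then \<theta> ^ (k * r - card (zedges p \<inter> zedges p')) else 0)"
  proof (rule sum.mono_neutral_cong_left)
    show "finite ({..<k} \<rightarrow>\<^sub>E Pow {..<r})" by (intro finite_PiE) auto
    show "PiE {..<k} T \<subseteq> {..<k} \<rightarrow>\<^sub>E Pow {..<r}" by (intro PiE_mono) (auto simp: T_def)
  qed (auto simp: T_def PiE_iff split: if_splits)
  finally show ?thesis ..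
qed

lemma finite_paths [simp]: "finite paths"
  unfolding paths_def by (intro finite_PiE) auto

lemma card_paths: "card paths = 2 ^ (k * r)"
  by (simp add: paths_def card_PiE card_Pow power_mult mult.commute[of k])

lemma sum_overlaps_all:
  assumes p: "p \<in> paths" and b: "0 \<le> b" "b \<le> 1 / 2" and r: "r ^ 3 \<le> 2 ^ q"
  shows "(\<Sum>p'\<in>paths. b ^ (k * r - card (zedges p \<inter> zedges p'))) \<le> (real r + 2) ^ k"
proof -
  have "\<forall>i<k. sdiff (p i) (p' i) \<in> Pow {..<r}" if "p' \<in> paths" for p'
    using p that by (fastforce simp: paths_def sdiff_def PiE_iff)
  then have "(\<Sum>p'\<in>paths. b ^ (k * r - card (zedges p \<inter> zedges p'))) = (\<Sum>E\<in>Pow {..<r}. b ^ reach q E r 0) ^ k"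
    unfolding sum_overlaps[OF p subset_refl, symmetric] paths_def[symmetric]
    by (intro sum.cong) auto
  also have "\<dots> \<le> (real r + 2) ^ k"
    using sum_power_reach_all[OF b _ r] q b by (intro power_mono sum_nonneg) auto
  finally show ?thesis .
qed

text \<open>The edge entering the first layer of a block lies outside \<open>Z\<close>, and its head
  state consists of the first \<open>q\<close> bits of the block.\<close>

lemma same_yedges_start:
  assumes p: "p \<in> paths" "p' \<in> paths" "yedges p = yedges p'" "i < k"
  shows "sdiff (p i) (p' i) \<in> Pow {q..<r}"
proof -
  have l: "lay i 0 \<in> {1..d}" "lay i 0 \<notin> zlayers"
  proof -
    have "1 \<le> lay i 0" by (simp add: lay_def)
    then show "lay i 0 \<in> {1..d}" using lay_less[of i 0] p(4) by simp
    show "lay i 0 \<notin> zlayers" by (rule lay_0_notin_zlayers)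
  qed
  then have "(lay i 0, walk_vertex d (path_walk p) (lay i 0 - 1), walk_vertex d (path_walk p) (lay i 0)) \<in> yedges p'"
    unfolding p(3)[symmetric] by (auto simp: yedges_def walk_edges_def)
  then have "walk_vertex d (path_walk p) (lay i 0) = walk_vertex d (path_walk p') (lay i 0)"
    by (auto simp: yedges_def walk_edges_def)
  then have "code (lay i 0) (state p i 0) = code (lay i 0) (state p' i 0)"
    using l(1) p(4) by (simp add: walk_vertex_path vertex_lay)
  then have s: "state p i 0 = state p' i 0" by (rule code_inj[OF state_subset state_subset])
  have "p i \<subseteq> {..<r}" "p' i \<subseteq> {..<r}" using p by (auto simp: paths_def)
  moreover have "e \<in> p i \<longleftrightarrow> e \<in> p' i" if "e < q" for e
    using s that by (auto simp: state_def set_eq_iff)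
  ultimately show ?thesis by (force simp: sdiff_def not_less[symmetric])
qed

text \<open>The competitors are among the strings that share the first \<open>q\<close> bits of
  every block with \<open>p\<close>; the subtracted 1 is the weight of \<open>p\<close>
  itself.\<close>

lemma sum_overlaps_close:
  assumes p: "p \<in> paths" and a: "1 / 2 \<le> a" and r: "r ^ 3 \<le> 2 ^ q"
  shows "(\<Sum>p'\<in>{p'\<in>paths. yedges p = yedges p' \<and> p' \<noteq> p}. a ^ (k * r - card (zedges p \<inter> zedges p')))
    \<le> (1 + (2 * a) ^ r * (real r ^ 3 / 2 ^ q)) ^ k - 1"
proof -
  define f where "f p' = a ^ (k * r - card (zedges p \<inter> zedges p'))" for p'
  define P where "P = {p'\<in>paths. \<forall>i<k. sdiff (p i) (p' i) \<in> Pow {q..<r}}"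
  have f0: "f p' \<ge> 0" for p' using a by (simp add: f_def)
  have pP: "p \<in> P" "finite P" using p by (auto simp: P_def sdiff_def)
  have "(\<Sum>p'\<in>{p'\<in>paths. yedges p = yedges p' \<and> p' \<noteq> p}. f p') \<le> (\<Sum>p'\<in>P - {p}. f p')"
    using same_yedges_start[OF p] pP f0 by (intro sum_mono2) (auto simp: P_def)
  also have "\<dots> = (\<Sum>p'\<in>P. f p') - f p" using pP by (simp add: sum_diff1)
  also have "f p = 1" by (simp add: f_def card_zedges)
  also have "(\<Sum>p'\<in>P. f p') = (\<Sum>E\<in>Pow {q..<r}. a ^ reach q E r 0) ^ k"
  proof -
    have S: "Pow {q..<r} \<subseteq> Pow {..<r}" by auto
    show ?thesis
      unfolding sum_overlaps[OF p S, symmetric] P_def f_def paths_def[symmetric]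
      by (rule sum.inter_filter) simp
  qed
  also have "\<dots> \<le> (1 + (2 * a) ^ r * (real r ^ 3 / 2 ^ q)) ^ k"
    using sum_power_reach_close[OF a _ q(2) r] q a by (intro power_mono sum_nonneg) auto
  finally show ?thesis by (simp add: f_def)
qed

end

section \<open>Restrictions that kill high-degree monomials\<close>

context skeleton
begin

lemma zvars_head:
  assumes "(\<kappa>, a, c) \<in> zvars"
  shows "\<kappa> \<in> zlayers \<and> (\<exists>v\<subseteq>{..<q}. c = code \<kappa> v)"
proof -
  obtain i j w where "i < k" "j < r" "(\<kappa>, a, c) = zvar i j w" using assms by (auto simp: zvars_def)
  then have "\<kappa> = lay i (j + 1)" "c = code \<kappa> {s. s < q \<and> Suc s \<in> w}" by (simp_all add: zvar_def lay_def)
  moreover have "{s. s < q \<and> Suc s \<in> w} \<subseteq> {..<q}" by auto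
  ultimately show ?thesis using zlayersI \<open>i < k\<close> \<open>j < r\<close> by blast
qed

text \<open>Two de Bruijn edges with the same head differ only in bit 0 of the window. Heads are
  counted since labels are independent per vertex, while edges can share vertices.\<close>

lemma card_le_twice_heads:
  assumes X: "X \<subseteq> zvars"
  shows "card X \<le> 2 * card ((\<lambda>(\<kappa>, a, c). (\<kappa>, c)) ` X)"
proof -
  let ?h = "\<lambda>(\<kappa> :: nat, a :: nat, c :: nat). (\<kappa>, c)"
  have finX: "finite X" using X finite_zvars finite_subset by blast
  have fib: "card {x \<in> X. ?h x = y} \<le> 2" if y: "y \<in> ?h ` X" for y
  proof -
    obtain x0 where x0: "x0 \<in> X" "y = ?h x0" using y by blast
    obtain i j w where ij: "j < r" "w \<subseteq> {..q}" "x0 = zvar i j w"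
      using x0(1) X by (auto simp: zvars_def)
    have "{x \<in> X. ?h x = y} \<subseteq> {zvar i j (insert 0 w), zvar i j (w - {0})}"
    proof
      fix x assume "x \<in> {x \<in> X. ?h x = y}"
      then have x: "x \<in> X" "?h x = ?h x0" using x0 by auto
      obtain i' j' w' where ij': "j' < r" "w' \<subseteq> {..q}" "x = zvar i' j' w'"
        using x(1) X by (auto simp: zvars_def)
      have e: "lay i' j' + 1 = lay i j + 1"
        "code (lay i' j' + 1) {s. s < q \<and> Suc s \<in> w'} = code (lay i j + 1) {s. s < q \<and> Suc s \<in> w}"
        using x(2) unfolding ij(3) ij'(3) zvar_def case_prod_conv prod.inject by blast+
      have "lay i' j' = lay i j" using e(1) by simp
      then have eq: "i' = i" "j' = j" using lay_inj[of i' j' i j] ij(1) ij'(1) by auto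
      have h: "{s. s < q \<and> Suc s \<in> w'} = {s. s < q \<and> Suc s \<in> w}"
        using e(2) unfolding eq by (rule code_inj[rotated 2]) auto
      have "s \<in> w' \<longleftrightarrow> s \<in> w" if nz: "s \<noteq> 0" for s
      proof (cases "s \<le> q")
        case True
        obtain s0 where s0: "s = Suc s0" using nz by (cases s) auto
        have "s0 \<in> {s. s < q \<and> Suc s \<in> w'} \<longleftrightarrow> s0 \<in> {s. s < q \<and> Suc s \<in> w}" unfolding h ..
        then show ?thesis using True by (simp add: s0)
      next
        case False
        then show ?thesis using ij(2) ij'(2) by auto
      qed
      then have m: "w' - {0} = w - {0}" by auto
      have "w' = insert 0 w \<or> w' = w - {0}"
      proof (cases "0 \<in> w'")
        case True
        then have "w' = insert 0 (w' - {0})" by (rule insert_Diff[symmetric])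
        then show ?thesis unfolding m by (simp only: insert_Diff_single simp_thms)
      next
        case False
        then show ?thesis using m by (metis Diff_empty Diff_insert0)
      qed
      then show "x \<in> {zvar i j (insert 0 w), zvar i j (w - {0})}" unfolding ij'(3) eq by blast
    qed
    then have "card {x \<in> X. ?h x = y} \<le> card {zvar i j (insert 0 w), zvar i j (w - {0})}"
      by (intro card_mono) auto
    also have "\<dots> \<le> 2" by (simp add: card_insert_if)
    finally show ?thesis .
  qed
  have "X = (\<Union>y\<in>?h ` X. {x \<in> X. ?h x = y})" by auto
  then have "card X \<le> (\<Sum>y\<in>?h ` X. card {x \<in> X. ?h x = y})"
    using card_UN_le[of "?h ` X" "\<lambda>y. {x \<in> X. ?h x = y}"] finX by simp
  also have "\<dots> \<le> (\<Sum>y\<in>?h ` X. 2)" using fib by (intro sum_mono)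
  finally show ?thesis by simp
qed

end

text \<open>Among all labellings \<open>\<sigma>\<close>, a set \<open>X\<close> with at least \<open>2 * h\<close> variables survives in a fraction of
  at most \<open>1 / B ^ h\<close>: its edges have at least \<open>h\<close> heads, and each prescribes one value of \<open>\<sigma>\<close>.\<close>

lemma exists_killing_labels:
  fixes q r B k h :: nat and \<X> :: "imm_var set set"
  assumes q: "1 \<le> q" "q \<le> r" and B: "0 < B" and \<X>: "finite \<X>" "card \<X> < B ^ h"
  shows "\<exists>\<sigma>. (\<forall>l v. \<sigma> l v < B) \<and> (\<forall>X\<in>\<X>. X \<subseteq> skeleton.zvars k r q B \<sigma> \<longrightarrow> card X < 2 * h)"
proof -
  \<comment> \<open>The possible heads, each with an independent label; \<Phi> is the sample
    space.\<close>
  define A where "A = skeleton.zlayers k r \<times> Pow {..<q}"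
  define \<Phi> where "\<Phi> = A \<rightarrow>\<^sub>E {..<B}"
  define \<sigma> where "\<sigma> f = (\<lambda>l v. if (l, v) \<in> A then f (l, v) else 0)" for f :: "nat \<times> nat set \<Rightarrow> nat"
  have \<sigma>B: "\<sigma> f l v < B" if "f \<in> \<Phi>" for f l v using that B by (auto simp: \<sigma>_def \<Phi>_def PiE_iff)
  have skel: "skeleton (2 ^ q * B) (k * (r + 1) + 1) k r q B (\<sigma> f)" if "f \<in> \<Phi>" for f
    by unfold_locales (use q \<sigma>B[OF that] in auto)
  define F where "F X = {f \<in> \<Phi>. X \<subseteq> skeleton.zvars k r q B (\<sigma> f)}" for X
  have \<Phi>: "(\<lambda>x. if x \<in> A then 0 else undefined) \<in> \<Phi>" using B by (auto simp: \<Phi>_def)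
  have finA: "finite A"
  proof -
    obtain f where "f \<in> \<Phi>" using \<Phi> by blast
    interpret skeleton "2 ^ q * B" "k * (r + 1) + 1" k r q B "\<sigma> f" by (rule skel[OF \<open>f \<in> \<Phi>\<close>])
    show ?thesis by (simp add: A_def zlayers_def)
  qed
  have fin\<Phi>: "finite \<Phi>" unfolding \<Phi>_def using finA by (intro finite_PiE) auto
  have card\<Phi>: "card \<Phi> = B ^ card A" unfolding \<Phi>_def using finA by (simp add: card_PiE)
  have bad: "card (F X) * B ^ h \<le> B ^ card A" if X: "2 * h \<le> card X" for X
  proof (cases "F X = {}")
    case False
    then obtain f0 where f0: "f0 \<in> \<Phi>" "X \<subseteq> skeleton.zvars k r q B (\<sigma> f0)" by (auto simp: F_def)
    interpret S0: skeleton "2 ^ q * B" "k * (r + 1) + 1" k r q B "\<sigma> f0" by (rule skel[OF f0(1)])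
    define H where "H = (\<lambda>(\<kappa>, a, c). (\<kappa>, c)) ` X"
    have "finite X" using f0(2) S0.finite_zvars finite_subset by blast
    then have finH: "finite H" by (simp add: H_def)
    have hH: "h \<le> card H" using S0.card_le_twice_heads[OF f0(2)] X unfolding H_def by linarith
    \<comment> \<open>Division by \<open>B\<close> decodes the vertex from its name without
      reference to a labelling; hence all labellings under which \<open>X\<close> survives agree on
      the same set \<open>A'\<close>.\<close>
    define loc where "loc = (\<lambda>(\<kappa> :: nat, c). (\<kappa>, set_decode ((c - 1) div B)))"
    have key: "loc (\<kappa>, c) \<in> A \<and> f (loc (\<kappa>, c)) = (c - 1) mod B" if f: "f \<in> F X" and kc: "(\<kappa>, c) \<in> H" for f \<kappa> c
    proof -
      have f\<Phi>: "f \<in> \<Phi>" "X \<subseteq> skeleton.zvars k r q B (\<sigma> f)" using f by (auto simp: F_def)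
      interpret S: skeleton "2 ^ q * B" "k * (r + 1) + 1" k r q B "\<sigma> f" by (rule skel[OF f\<Phi>(1)])
      obtain a where "(\<kappa>, a, c) \<in> X" using kc by (auto simp: H_def)
      then have "(\<kappa>, a, c) \<in> S.zvars" using f\<Phi>(2) by blast
      then obtain v where v: "\<kappa> \<in> S.zlayers" "v \<subseteq> {..<q}" "c = S.code \<kappa> v" using S.zvars_head by blast
      have fv: "finite v" using v(2) finite_subset by blast
      have l: "loc (\<kappa>, c) = (\<kappa>, v)" using S.code_decode(1)[OF v(2), of \<kappa>] fv by (simp add: loc_def v(3))
      have A: "(\<kappa>, v) \<in> A" using v by (simp add: A_def)
      have "(c - 1) mod B = f (\<kappa>, v)" unfolding v(3) S.code_decode(2)[OF v(2)] using A by (simp add: \<sigma>_def)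
      then show ?thesis using A unfolding l by simp
    qed
    have f0F: "f0 \<in> F X" using f0 by (simp add: F_def)
    define A' where "A' = loc ` H"
    have A'A: "A' \<subseteq> A" using key[OF f0F] by (auto simp: A'_def)
    have code: "c = 1 + ((c - 1) div B) * B + (c - 1) mod B" if kc: "(\<kappa>, c) \<in> H" for \<kappa> c
    proof -
      obtain a where "(\<kappa>, a, c) \<in> X" using kc by (auto simp: H_def)
      then have "\<exists>v\<subseteq>{..<q}. c = S0.code \<kappa> v" using f0(2) S0.zvars_head by blast
      then have "1 \<le> c" by (auto simp: S0.code_def)
      then show ?thesis by simp
    qed
    have "inj_on loc H"
    proof (rule inj_onI)
      fix x y assume xy: "x \<in> H" "y \<in> H" "loc x = loc y"
      obtain \<kappa> c \<kappa>' c' where eq: "x = (\<kappa>, c)" "y = (\<kappa>', c')" by (cases x, cases y)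
      have "(c - 1) mod B = (c' - 1) mod B"
        using key[OF f0F, of \<kappa> c] key[OF f0F, of \<kappa>' c'] xy unfolding eq by simp
      moreover have "(c - 1) div B = (c' - 1) div B" "\<kappa> = \<kappa>'"
        using xy(3) unfolding eq loc_def by (auto dest: arg_cong[of _ _ set_encode])
      ultimately show "x = y" using code xy(1,2) unfolding eq by metis
    qed
    then have cA': "card A' = card H" by (simp add: A'_def card_image)
    have "F X \<subseteq> PiE A (\<lambda>x. if x \<in> A' then {f0 x} else {..<B})"
    proof
      fix f assume f: "f \<in> F X"
      have "f x = f0 x" if xA: "x \<in> A'" for x
      proof -
        obtain \<kappa> c where "(\<kappa>, c) \<in> H" "x = loc (\<kappa>, c)" using xA by (auto simp: A'_def)
        then show ?thesis using key[OF f] key[OF f0F] by simp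
      qed
      then show "f \<in> PiE A (\<lambda>x. if x \<in> A' then {f0 x} else {..<B})"
        using f by (auto simp: F_def \<Phi>_def PiE_iff)
    qed
    then have "card (F X) \<le> card (PiE A (\<lambda>x. if x \<in> A' then {f0 x} else {..<B}))"
      using finA by (intro card_mono finite_PiE) auto
    also have "\<dots> = (\<Prod>x\<in>A. if x \<in> A' then 1 else B)"
      using finA by (simp add: card_PiE if_distrib cong: if_cong)
    also have "\<dots> = B ^ card (A - A')"
    proof -
      have "(\<Prod>x\<in>A. if x \<in> A' then 1 else B) = (\<Prod>x\<in>A - A'. B)"
        by (rule prod.mono_neutral_cong_right) (use finA in auto)
      then show ?thesis by simp
    qed
    also have "card (A - A') = card A - card H" using A'A finA cA' by (simp add: card_Diff_subset finite_subset)
    finally have "card (F X) * B ^ h \<le> B ^ (card A - card H) * B ^ card H"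
      using hH B by (intro mult_mono power_increasing) auto
    also have "\<dots> = B ^ card A" using card_mono[OF finA A'A] by (simp add: power_add[symmetric] cA')
    finally show ?thesis .
  qed simp
  \<comment> \<open>Union bound over the large members of the family, which number fewer than
    \<open>B ^ h\<close>.\<close>
  have "\<exists>f\<in>\<Phi>. f \<notin> (\<Union>X\<in>{X\<in>\<X>. 2 * h \<le> card X}. F X)"
  proof (rule ccontr)
    assume "\<not> ?thesis"
    then have "\<Phi> \<subseteq> (\<Union>X\<in>{X\<in>\<X>. 2 * h \<le> card X}. F X)" by blast
    then have "card \<Phi> \<le> card (\<Union>X\<in>{X\<in>\<X>. 2 * h \<le> card X}. F X)"
      using \<X> fin\<Phi> by (intro card_mono) (auto simp: F_def)
    also have "\<dots> \<le> (\<Sum>X\<in>{X\<in>\<X>. 2 * h \<le> card X}. card (F X))" using \<X> by (intro card_UN_le) auto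
    finally have "B ^ card A * B ^ h \<le> (\<Sum>X\<in>{X\<in>\<X>. 2 * h \<le> card X}. card (F X)) * B ^ h"
      unfolding card\<Phi> by (rule mult_le_mono1)
    also have "\<dots> = (\<Sum>X\<in>{X\<in>\<X>. 2 * h \<le> card X}. card (F X) * B ^ h)" by (rule sum_distrib_right)
    also have "\<dots> \<le> (\<Sum>X\<in>{X\<in>\<X>. 2 * h \<le> card X}. B ^ card A)" using bad by (intro sum_mono) auto
    also have "\<dots> \<le> card \<X> * B ^ card A" using \<X> by (simp add: card_mono)
    also have "\<dots> < B ^ h * B ^ card A" using \<X>(2) B by simp
    finally show False by (simp add: mult.commute)
  qed
  then obtain f where f: "f \<in> \<Phi>" "f \<notin> (\<Union>X\<in>{X\<in>\<X>. 2 * h \<le> card X}. F X)" by blast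
  have "card X < 2 * h" if "X \<in> \<X>" "X \<subseteq> skeleton.zvars k r q B (\<sigma> f)" for X
  proof (rule ccontr)
    assume "\<not> card X < 2 * h"
    then have "f \<in> (\<Union>X\<in>{X\<in>\<X>. 2 * h \<le> card X}. F X)" using that f(1) by (auto simp: F_def)
    then show False using f(2) by blast
  qed
  then show ?thesis using \<sigma>B[OF f(1)] by blast
qed

section \<open>Sparse powers computed by a circuit\<close>

lemma prod_list_singles:
  assumes "\<And>x. x \<in> set xs \<Longrightarrow> \<exists>m c. f x = (Poly_Mapping.single m c :: ('v, 'a::field) mpoly)"
  shows "\<exists>m c. (\<Prod>x\<leftarrow>xs. f x) = Poly_Mapping.single m c"
  using assms
proof (induction xs)
  case Nil
  then show ?case by (simp flip: single_one) blast
next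
  case (Cons x xs)
  then obtain m c m' c' where "f x = Poly_Mapping.single m c" "(\<Prod>x\<leftarrow>xs. f x) = Poly_Mapping.single m' c'"
    by (metis list.set_intros)
  then show ?case by (auto simp: mult_single)
qed

lemma keys_sum_list: "Poly_Mapping.keys (\<Sum>x\<leftarrow>xs. f x) \<subseteq> (\<Union>x\<in>set xs. Poly_Mapping.keys (f x))"
proof (induction xs)
  case (Cons x xs)
  then show ?case using keys_add[of "f x" "\<Sum>x\<leftarrow>xs. f x"] by auto
qed simp

text \<open>A product gate over leaves is a scalar multiple of one monomial, so all the
  \<open>Q\<close> together involve at most one monomial per node. The union bound over labellings
  will run over this common set \<open>M\<close>.\<close>

lemma SWSP_circuit_sparse_powers:
  fixes C :: "('v, 'a::field) circuit"
  assumes "SWSP_circuit C" "computes C F"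
  shows "\<exists>L M. F = (\<Sum>(Q, e)\<leftarrow>L. Q ^ e) \<and> card (set L) \<le> circuit_size C
    \<and> finite M \<and> card M \<le> circuit_size C \<and> (\<forall>(Q, e)\<in>set L. Poly_Mapping.keys Q \<subseteq> M)"
proof -
  have wf: "arith_circuit C" using assms by (simp add: SWSP_circuit_def)
  have len: "output_node C < length C" using wf by (simp add: arith_circuit_def output_node_def)
  have child: "j < length C" if "k < length C" "j \<in> gate_children (C ! k)" for j k
    using wf that by (meson arith_circuit_def order.strict_trans)
  obtain js where js: "C ! output_node C = Sum_Gate js" "\<forall>j\<in>set js. WSP_node C j"
    using assms by (auto simp: SWSP_circuit_def SWSP_node_def)
  have jlt: "j < length C" if "j \<in> set js" for j using child[OF len, of j] js(1) that by simp
  \<comment> \<open>The default pair is never met for nodes in \<open>js\<close>, which are powering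
    gates.\<close>
  define g where "g j = (case C ! j of Pow_Gate i e \<Rightarrow> (node_poly C i, e) | _ \<Rightarrow> (0, 0))" for j
  define L where "L = map g js"
  \<comment> \<open>Inclusion rather than equality, since a zero constant among the leaves leaves no
    monomial.\<close>
  define mon where "mon i = (SOME m. Poly_Mapping.keys (node_poly C i) \<subseteq> {m})" for i
  define M where "M = mon ` {..<length C}"
  have P: "Poly_Mapping.keys (node_poly C i) \<subseteq> {mon i}" if i: "P_node C i" "i < length C" for i
  proof -
    obtain ks where ks: "C ! i = Prod_Gate ks" "\<forall>j\<in>set ks. leaf_node C j" using i by (auto simp: P_node_def)
    have "\<exists>m c. node_poly C j = Poly_Mapping.single m c" if "j \<in> set ks" for j
    proof -
      have "j < length C" using child[OF i(2), of j] ks(1) that by simp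
      then have "node_poly C j = gate_poly (node_poly C) (C ! j)" by (rule node_poly_eq[OF wf])
      moreover have "leaf_node C j" using ks that by blast
      ultimately show ?thesis
        unfolding leaf_node_def by (metis gate_poly.simps(1,2) mvar_def mconst_def)
    qed
    then obtain m c where "node_poly C i = Poly_Mapping.single m c"
      using prod_list_singles[of ks "node_poly C"] node_poly_eq[OF wf i(2)] ks(1) by auto
    then have "\<exists>m. Poly_Mapping.keys (node_poly C i) \<subseteq> {m}" by auto
    then show ?thesis unfolding mon_def by (rule someI_ex)
  qed
  have SP: "Poly_Mapping.keys (node_poly C i) \<subseteq> M" if i: "SP_node C i" "i < length C" for i
  proof -
    obtain ks where ks: "C ! i = Sum_Gate ks" "\<forall>j\<in>set ks. P_node C j" using i by (auto simp: SP_node_def)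
    have "Poly_Mapping.keys (node_poly C i) \<subseteq> (\<Union>j\<in>set ks. Poly_Mapping.keys (node_poly C j))"
      using keys_sum_list[of "node_poly C" ks] node_poly_eq[OF wf i(2)] ks(1) by simp
    also have "\<dots> \<subseteq> M"
    proof
      fix m assume "m \<in> (\<Union>j\<in>set ks. Poly_Mapping.keys (node_poly C j))"
      then obtain j where j: "j \<in> set ks" "m \<in> Poly_Mapping.keys (node_poly C j)" by blast
      have "j < length C" using child[OF i(2), of j] ks(1) j(1) by simp
      then show "m \<in> M" using P[of j] ks(2) j by (auto simp: M_def)
    qed
    finally show ?thesis .
  qed
  have gj: "node_poly C j = fst (g j) ^ snd (g j) \<and> Poly_Mapping.keys (fst (g j)) \<subseteq> M" if j: "j \<in> set js" for j
  proof -
    obtain i e where ie: "C ! j = Pow_Gate i e" "SP_node C i" using js(2) j by (auto simp: WSP_node_def)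
    have "i < length C" using child[OF jlt[OF j], of i] ie(1) by simp
    then show ?thesis using SP[OF ie(2)] node_poly_eq[OF wf jlt[OF j]] ie(1) by (simp add: g_def)
  qed
  have "F = (\<Sum>j\<leftarrow>js. node_poly C j)"
    using assms(2) node_poly_eq[OF wf len] js(1) by (simp add: computes_def)
  also have "\<dots> = (\<Sum>j\<leftarrow>js. fst (g j) ^ snd (g j))"
    using gj by (intro arg_cong[where f = sum_list] map_cong) auto
  also have "\<dots> = (\<Sum>(Q, e)\<leftarrow>L. Q ^ e)" by (simp add: L_def case_prod_beta o_def)
  finally have "F = (\<Sum>(Q, e)\<leftarrow>L. Q ^ e)" .
  moreover have "card (set L) \<le> circuit_size C"
  proof -
    have "set L \<subseteq> g ` {..<length C}" using jlt by (auto simp: L_def)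
    then have "card (set L) \<le> card (g ` {..<length C})" by (intro card_mono) auto
    also have "\<dots> \<le> length C" using card_image_le[of "{..<length C}" g] by simp
    finally show ?thesis by (simp add: circuit_size_def)
  qed
  moreover have "card M \<le> circuit_size C" using card_image_le[of "{..<length C}" mon] by (simp add: M_def circuit_size_def)
  moreover have "\<forall>(Q, e)\<in>set L. Poly_Mapping.keys Q \<subseteq> M"
  proof clarify
    fix Q e m assume "(Q, e) \<in> set L" "m \<in> Poly_Mapping.keys Q"
    then show "m \<in> M" using gj by (auto simp: L_def) (metis fst_conv subsetD)
  qed
  ultimately show ?thesis by (intro exI[of _ L] exI[of _ M]) (simp add: M_def)
qed

section \<open>The size bound\<close>

text \<open>\<open>card T\<close> is bounded above by the common span of the powers and below by the
  isolated pairs. Smallness of the circuit allows one labelling to handle all its monomials at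
  once.\<close>

lemma SWSP_circuit_finite_bound:
  fixes C :: "(imm_var, 'a::field) circuit" and n d k r q B h l :: nat
  defines "N \<equiv> k * r * 2 ^ (q + 1)" and "D \<equiv> k * r" and "K \<equiv> d - k * r"
  assumes C: "SWSP_circuit C" "computes C (IMM n d)" and small: "circuit_size C < B ^ h"
    and q: "1 \<le> q" "q \<le> r" and B: "0 < B" "2 ^ q * B \<le> n" and len: "k * (r + 1) + 1 \<le> d"
    and l: "D \<le> l" "l + D \<le> N" "2 * (l + K * (2 * h)) \<le> N"
    and half: "1 / 2 \<le> (real (N - D) - real l) / real (N - D)"
    and r: "r ^ 3 \<le> 2 ^ q"
    and iso: "(1 + (2 * ((real (N - D) - real l) / real (N - D))) ^ r * (real r ^ 3 / 2 ^ q)) ^ k \<le> 3 / 2"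
  shows "2 ^ D * real ((N - D) choose l)
    \<le> 4 * (real r + 2) ^ k * (real (circuit_size C) * (real K + 1) * ((real (l + K * (2 * h)) + 1) * real (N choose (l + K * (2 * h)))))"
proof -
  define s where "s = circuit_size C"
  obtain L :: "((imm_var, 'a) mpoly \<times> nat) list" and M where LM: "IMM n d = (\<Sum>(Q, e)\<leftarrow>L. Q ^ e)" "card (set L) \<le> s"
    "finite M" "card M \<le> s" and keysM: "\<forall>(Q, e)\<in>set L. Poly_Mapping.keys Q \<subseteq> M"
    using SWSP_circuit_sparse_powers[OF C, folded s_def] by (elim exE conjE) (rule that)
  have keysQ: "Poly_Mapping.keys Q \<subseteq> M" if "(Q, e) \<in> set L" for Q e using keysM that by blast
  \<comment> \<open>Selected by matrix index alone, because the labelling, and with it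
    \<open>Z\<close>, is fixed only afterwards. For relevant monomials it coincides with the part in
    \<open>Z\<close>.\<close>
  define zpart where "zpart m = {e \<in> Poly_Mapping.keys m. fst e \<in> skeleton.zlayers k r}" for m :: "imm_var \<Rightarrow>\<^sub>0 nat"
  have "card (zpart ` M) \<le> s" using card_image_le[OF LM(3), of zpart] LM(4) by simp
  then have "card (zpart ` M) < B ^ h" using small by (simp add: s_def)
  then obtain \<sigma> where lab: "\<forall>l v. \<sigma> l v < B"
    "\<forall>X\<in>zpart ` M. X \<subseteq> skeleton.zvars k r q B \<sigma> \<longrightarrow> card X < 2 * h"
    using exists_killing_labels[OF q B(1), of "zpart ` M" h k] LM(3) by blast
  interpret skeleton n d k r q B \<sigma>
    by unfold_locales (use q B len lab(1) in auto)
  have N: "card zvars = N" by (simp only: card_zvars N_def)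
  define I where "I = isolated_pairs zvars paths zedges (\<lambda>p p'. yedges p = yedges p') l"
  define T where "T = (\<lambda>(p, b). b \<union> zedges p) ` I"
  have "isolated_pairs zvars paths zedges (\<lambda>p p'. yedges p = yedges p') l \<subseteq> paths \<times> Pow zvars"
    by (auto simp: isolated_pairs_def)
  then have finT: "finite T" unfolding T_def I_def by (intro finite_imageI) (rule finite_subset, auto)
  have low: "card (Poly_Mapping.keys m \<inter> zvars) \<le> 2 * h"
    if "(Q, e) \<in> set L" "m \<in> Poly_Mapping.keys Q" "relevant zvars (sqfree_mon (yedges p)) m" for Q e m p
  proof -
    have k: "Poly_Mapping.keys m \<subseteq> zvars \<union> yedges p"
      using that(3) by (simp add: relevant_def keys_sqfree_mon)
    have "zpart m \<subseteq> zvars" using k by (auto simp: zpart_def yedges_def)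
    moreover have "zpart m \<in> zpart ` M" using that keysQ by blast
    ultimately have "card (zpart m) < 2 * h" using lab(2) by blast
    moreover have "zpart m = Poly_Mapping.keys m \<inter> zvars"
      using k fst_zvars by (auto simp: zpart_def yedges_def)
    ultimately show ?thesis by simp
  qed
  have upper: "card T \<le> card (set L) * ((K + 1) * card {\<gamma>. \<gamma> \<subseteq> zvars \<and> card \<gamma> \<le> l + K * (2 * h)})"
  proof (rule sum_of_powers_bound[OF LM(1) finite_zvars finT])
    fix \<tau> assume "\<tau> \<in> T"
    then obtain p \<beta> where p: "(p, \<beta>) \<in> I" "\<tau> = \<beta> \<union> zedges p" by (auto simp: T_def)
    show "\<exists>\<alpha> \<beta>. Poly_Mapping.keys \<alpha> \<inter> zvars = {} \<and> \<beta> \<subseteq> zvars \<and> card \<beta> = l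
      \<and> K = (\<Sum>v\<in>Poly_Mapping.keys \<alpha>. Poly_Mapping.lookup \<alpha> v)
      \<and> shifted_row (IMM n d :: (imm_var, 'a) mpoly) zvars \<alpha> \<beta> = (\<lambda>x. if x = \<tau> then 1 else 0)
      \<and> (\<forall>(Q, e)\<in>set L. \<forall>m\<in>Poly_Mapping.keys Q. relevant zvars \<alpha> m \<longrightarrow> card (Poly_Mapping.keys m \<inter> zvars) \<le> 2 * h)"
    proof (intro exI conjI)
      show "Poly_Mapping.keys (sqfree_mon (yedges p)) \<inter> zvars = {}"
        using walk_edges_path(2) by (simp add: keys_sqfree_mon)
      show "\<beta> \<subseteq> zvars" "card \<beta> = l" using p(1) by (auto simp: I_def isolated_pairs_def)
      show "K = (\<Sum>v\<in>Poly_Mapping.keys (sqfree_mon (yedges p)). Poly_Mapping.lookup (sqfree_mon (yedges p)) v)"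
        by (simp add: keys_sqfree_mon lookup_sqfree_mon card_yedges K_def)
      show "shifted_row (IMM n d :: (imm_var, 'a) mpoly) zvars (sqfree_mon (yedges p)) \<beta> = (\<lambda>x. if x = \<tau> then 1 else 0)"
        using isolated_shifted_row[of p \<beta> l] p unfolding I_def by simp
      show "\<forall>(Q, e)\<in>set L. \<forall>m\<in>Poly_Mapping.keys Q. relevant zvars (sqfree_mon (yedges p)) m
          \<longrightarrow> card (Poly_Mapping.keys m \<inter> zvars) \<le> 2 * h"
        using low by blast
    qed
  qed
  define c where "c = (real r + 2) ^ k"
  define J where "J = l + K * (2 * h)"
  have b: "0 \<le> real l / real (N - D)" "real l / real (N - D) \<le> 1 / 2"
  proof -
    have "N - D > 0" using half by (cases "N - D = 0") auto
    then show "real l / real (N - D) \<le> 1 / 2" using half by (simp add: diff_divide_distrib del: of_nat_diff)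
  qed simp
  have "restrict (\<lambda>_. {}) {..<k} \<in> paths" by (auto simp: paths_def)
  then have ne: "paths \<noteq> {}" by blast
  have "real (card paths) * real ((card zvars - D) choose l) \<le> 4 * c * real (card T)"
    unfolding T_def I_def
  proof (rule card_isolated_unions_ge)
    show "zedges p \<subseteq> zvars \<and> card (zedges p) = D" for p
      using zedges_subset card_zedges by (simp add: D_def)
    show "(\<Sum>p'\<in>{p'\<in>paths. yedges p = yedges p' \<and> p' \<noteq> p}.
        ((real (card zvars - D) - real l) / real (card zvars - D)) ^ (D - card (zedges p \<inter> zedges p'))) \<le> 1 / 2"
      if "p \<in> paths" for p
      using sum_overlaps_close[OF that half r] iso unfolding N D_def by simp
    show "(\<Sum>p'\<in>paths. (real l / real (card zvars - D)) ^ (D - card (zedges p \<inter> zedges p'))) \<le> c"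
      if "p \<in> paths" for p
      using sum_overlaps_all[OF that b r] unfolding N D_def c_def by simp
  qed (use l N ne in auto)
  then have "2 ^ D * real ((N - D) choose l) \<le> 4 * c * real (card T)"
    by (simp add: card_paths N D_def)
  also have "\<dots> \<le> 4 * c * (real s * ((real K + 1) * ((real J + 1) * real (N choose J))))"
  proof (rule mult_left_mono)
    have "card {\<gamma>. \<gamma> \<subseteq> zvars \<and> card \<gamma> \<le> J} \<le> (J + 1) * (N choose J)"
      using card_small_subsets[of zvars J] l(3) unfolding N J_def by simp
    then have "card T \<le> s * ((K + 1) * ((J + 1) * (N choose J)))"
      using upper LM(2) unfolding J_def[symmetric] by (meson le_trans mult_le_mono le_refl)
    then have "real (card T) \<le> real (s * ((K + 1) * ((J + 1) * (N choose J))))" by (simp only: of_nat_le_iff)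
    then show "real (card T) \<le> real s * ((real K + 1) * ((real J + 1) * real (N choose J)))"
      by (simp only: of_nat_mult of_nat_add of_nat_1)
    show "0 \<le> 4 * c" by (simp add: c_def)
  qed
  finally show ?thesis unfolding c_def J_def s_def by (simp only: mult.assoc)
qed

text \<open>Both binomials of the previous bound are compared with \<open>N choose l\<close>:
  removing \<open>D\<close> elements from the ground set costs at most the factor
  \<open>a ^ D\<close>, and enlarging the subsets costs a power of
  \<open>(N - l) / l\<close>.\<close>

lemma SWSP_circuit_size_bound:
  fixes C :: "(imm_var, 'a::field) circuit" and n d k r q B h l :: nat
  defines "N \<equiv> k * r * 2 ^ (q + 1)" and "D \<equiv> k * r" and "K \<equiv> d - k * r"
  defines "a \<equiv> (real (N - D) - real l) / real (N - D)"
  assumes C: "SWSP_circuit C" "computes C (IMM n d)" and small: "circuit_size C < B ^ h"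
    and q: "1 \<le> q" "q \<le> r" and B: "0 < B" "2 ^ q * B \<le> n" and len: "k * (r + 1) + 1 \<le> d"
    and l: "0 < l" "D \<le> l" "l + D \<le> N" "2 * (l + K * (2 * h)) \<le> N" "D < N"
    and half: "1 / 2 \<le> a"
    and r: "r ^ 3 \<le> 2 ^ q"
    and iso: "(1 + (2 * a) ^ r * (real r ^ 3 / 2 ^ q)) ^ k \<le> 3 / 2"
  shows "(2 * a) ^ D \<le> 4 * (real r + 2) ^ k * (real (circuit_size C) * (real K + 1)
    * ((real (l + K * (2 * h)) + 1) * ((real N - real l) / real l) ^ (K * (2 * h))))"
proof -
  define J where "J = K * (2 * h)"
  define w where "w = (real N - real l) / real l"
  define Y where "Y = 4 * (real r + 2) ^ k * (real (circuit_size C) * (real K + 1) * (real (l + J) + 1))"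
  have Y0: "Y \<ge> 0" by (simp add: Y_def)
  have lN: "l \<le> N - D" "l \<le> N" using l by auto
  have pos: "real (N choose l) > 0" using lN by simp
  have "(2 * a) ^ D * real (N choose l) = 2 ^ D * (real (N choose l) * a ^ D)" by (simp add: power_mult_distrib)
  also have "\<dots> \<le> 2 ^ D * real ((N - D) choose l)"
    unfolding a_def using binomial_shrink_lower[OF l(5) lN(1)] by (intro mult_left_mono) auto
  also have "\<dots> \<le> Y * real (N choose (l + J))"
    using SWSP_circuit_finite_bound[OF C small q B len] l(2-4) half iso r
    unfolding Y_def J_def N_def D_def K_def a_def by (simp only: mult.assoc)
  also have "\<dots> \<le> Y * (real (N choose l) * w ^ J)"
    unfolding w_def using binomial_growth[OF l(1) lN(2)] Y0 by (intro mult_left_mono) auto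
  finally have "(2 * a) ^ D * real (N choose l) \<le> (Y * w ^ J) * real (N choose l)" by (simp only: mult_ac)
  then have "(2 * a) ^ D \<le> Y * w ^ J" using pos by simp
  then show ?thesis unfolding Y_def w_def J_def by (simp only: mult.assoc)
qed

section \<open>Choice of the parameters\<close>

lemma exp_half_le:
  fixes x :: real
  assumes "0 \<le> x" "x \<le> 1"
  shows "exp (x / 2) \<le> 1 + x"
proof -
  have "exp (x / 2) \<le> 1 + x / 2 + (x / 2)\<^sup>2" using assms by (intro exp_bound) auto
  also have "(x / 2)\<^sup>2 \<le> x / 2"
    using assms mult_left_le[of "x / 2" "x / 2"] by (simp add: power2_eq_square)
  finally show ?thesis by simp
qed

text \<open>Rounding to a power of two costs a factor of at most 2, absorbed by the gap between the
  exponents 0.29 and 0.3.\<close>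

lemma power_two_bounds:
  fixes L :: real
  assumes L: "1000 \<le> L"
  obtains q :: nat where "1 \<le> q" "real q \<le> L" "2 ^ q \<le> exp (0.3 * L)" "exp (0.29 * L) \<le> 2 ^ q"
proof -
  define q where "q = nat \<lfloor>0.3 * L / ln 2\<rfloor>"
  have ln2: "0.5 \<le> ln (2::real)" "ln (2::real) \<le> 1"
    using ln_2_less_1 ln2_ge_two_thirds by auto
  have nn: "0 \<le> 0.3 * L / ln 2" using L ln2 by simp
  then have q: "real q \<le> 0.3 * L / ln 2" "0.3 * L / ln 2 < real q + 1"
    unfolding q_def by linarith+
  have p: "(2::real) ^ q = exp (real q * ln 2)" by (simp add: exp_of_nat_mult)
  have up: "real q * ln 2 \<le> 0.3 * L" using q(1) ln2 by (simp add: pos_le_divide_eq)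
  have lo: "0.3 * L < (real q + 1) * ln 2" using q(2) ln2 by (simp add: pos_divide_less_eq)
  show thesis
  proof (rule that[of q])
    have "0.3 * L / ln 2 \<ge> 0.3 * L / 1" using ln2 L by (intro divide_left_mono) auto
    then have "real q + 1 > 300" using q(2) L by linarith
    then show "1 \<le> q" by linarith
    have "real q * 0.5 \<le> real q * ln 2" using ln2 by (intro mult_left_mono) auto
    then show "real q \<le> L" using up L by linarith
    show "2 ^ q \<le> exp (0.3 * L)" unfolding p using up by simp
    have "0.29 * L \<le> real q * ln 2" using lo ln2 L by (simp add: distrib_right)
    then show "exp (0.29 * L) \<le> 2 ^ q" unfolding p by simp
  qed
qed

text \<open>With \<open>k = r = m\<close>, compare logarithms in units of \<open>L * m\<close>: the
  gain is 0.05; the losses are 0.025 from enlarged shifts, 0.006 from collisions and 0.001 from the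
  assumed size. Terms linear in \<open>L\<close> are dominated as \<open>m\<close> is large.\<close>

lemma SWSP_circuit_size_exp:
  fixes C :: "(imm_var, 'a::field) circuit" and n d m :: nat
  defines "L \<equiv> ln (real n)"
  assumes L: "1000 \<le> L" and m: "1000 * L \<le> real m" and d: "(m + 1)\<^sup>2 \<le> d" "d < (m + 2)\<^sup>2"
    and mE: "real m \<le> exp (0.005 * L)"
    and C: "SWSP_circuit C" "computes C (IMM n d)"
  shows "exp (0.001 * L * (real m + 2)) \<le> real (circuit_size C)"
proof (rule ccontr)
  assume "\<not> ?thesis"
  then have sz: "real (circuit_size C) < exp (0.001 * L * (real m + 2))" by simp
  have n: "real n = exp L" unfolding L_def using L by (cases "n = 0") (auto simp: L_def)
  have E: "exp (s * L) \<le> exp (t * L)" if "s \<le> t" for s t using that L by (simp add: mult_right_mono)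
  have two: "2 \<le> exp (0.001 * L)"
  proof -
    have "2 \<le> exp (1::real)" using exp_ge_add_one_self[of 1] by simp
    also have "\<dots> \<le> exp (0.001 * L)" using L by simp
    finally show ?thesis .
  qed
  have mm: "real m \<ge> 1000000" using m L by linarith
  obtain q where q: "1 \<le> q" "real q \<le> L" "2 ^ q \<le> exp (0.3 * L)" "exp (0.29 * L) \<le> 2 ^ q"
    by (rule power_two_bounds[OF L])
  have qm: "q \<le> m" using q(2) m L by linarith
  define B where "B = n div 2 ^ q"
  \<comment> \<open>Large enough for \<open>B ^ h\<close> to exceed the assumed size, small enough
    for \<open>J\<close> to stay below \<open>m * m / 40\<close>.\<close>
  define h where "h = m div 400"
  define N where "N = m * m * 2 ^ (q + 1)"
  define D where "D = m * m"
  define K where "K = d - m * m"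
  define J where "J = K * (2 * h)"
  define M where "M = N - D"
  \<comment> \<open>Now \<open>(2 * a) ^ m\<close> is at most \<open>exp (0.2 * L)\<close>, below
    \<open>2 ^ q\<close>, while \<open>(1 + \<delta>) ^ D\<close> still reaches
    \<open>exp (0.05 * L * m)\<close>.\<close>
  define \<delta> where "\<delta> = 0.1 * L / real m"
  \<comment> \<open>This places \<open>2 * a\<close> between \<open>1 + \<delta>\<close> and
    \<open>1 + 2 * \<delta>\<close>.\<close>
  define l where "l = nat \<lfloor>real M * (1 - \<delta>) / 2\<rfloor>"
  define a where "a = (real M - real l) / real M"
  define w where "w = (real N - real l) / real l"
  define s where "s = real (circuit_size C)"
  have \<delta>m: "\<delta> * real m = 0.1 * L" using mm by (simp add: \<delta>_def)
  have \<delta>1: "\<delta> \<le> 0.0001" unfolding \<delta>_def using m mm by (simp add: pos_divide_le_eq)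
  have \<delta>2: "100 / real m \<le> \<delta>" unfolding \<delta>_def using L mm by (intro divide_right_mono) auto
  have \<delta>0: "0 < \<delta>" using \<delta>2 mm by (smt (verit) divide_pos_pos)
  have q3: "real m ^ 3 * 8 \<le> 2 ^ q"
  proof -
    have "real m ^ 3 * 8 \<le> exp (0.005 * L) ^ 3 * (exp (0.001 * L) ^ 3)"
      using mE power_mono[OF two, of 3] by (intro mult_mono power_mono) auto
    also have "\<dots> = exp (0.018 * L)" by (simp add: exp_of_nat_mult[symmetric] exp_add[symmetric])
    also have "\<dots> \<le> exp (0.29 * L)" by (rule E) simp
    finally show ?thesis using q(4) by linarith
  qed
  have r3: "m ^ 3 \<le> 2 ^ q"
  proof -
    have "0 \<le> real m ^ 3" by simp
    then have "real m ^ 3 \<le> 2 ^ q" using q3 by linarith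
    then have "real (m ^ 3) \<le> real (2 ^ q)" by simp
    then show ?thesis by (simp only: of_nat_le_iff)
  qed
  have m1: "real m \<le> real m ^ 3" using mm by (intro self_le_power) auto
  have q8: "real m * 8 \<le> 2 ^ q" using q3 m1 by linarith
  have N: "real N = real m * real m * (2 * 2 ^ q)" by (simp add: N_def)
  have D: "real D = real m * real m" by (simp add: D_def)
  have D0: "real D \<ge> real m" unfolding D using mm by simp
  have DN: "D < N"
  proof -
    have "(1::nat) < 2 ^ (q + 1)" by (rule one_less_power) auto
    moreover have "0 < m * m" using mm by simp
    ultimately have "m * m * 1 < m * m * 2 ^ (q + 1)" by (intro mult_strict_left_mono)
    then show ?thesis by (simp only: D_def N_def mult_1_right)
  qed
  have M: "real M = real N - real D" unfolding M_def using DN by simp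
  have MD: "real M \<ge> real D * 2 ^ q"
  proof -
    have "real D * 1 \<le> real D * 2 ^ q" by (intro mult_left_mono) auto
    then show ?thesis unfolding M N D by linarith
  qed
  have MDm: "real M \<ge> real D * (real m * 8)"
    using MD mult_left_mono[OF q8, of "real D"] by linarith
  have Mm: "real M \<ge> 8 * real m * real D" using MDm by (simp add: mult_ac)
  have M8: "real M \<ge> 8 * real D"
  proof -
    have "8 * real D * 1 \<le> 8 * real D * real m" using mm by (intro mult_left_mono) auto
    then show ?thesis using Mm by (simp add: mult_ac)
  qed
  have M0: "real M > 0" using M8 D0 mm by linarith
  have lb: "2 * real l \<le> real M - real M * \<delta>" "real M - real M * \<delta> < 2 * real l + 2"
  proof -
    define x where "x = real M * (1 - \<delta>) / 2"
    have "2 * x = real M * (1 - \<delta>)" by (simp add: x_def)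
    then have x: "2 * x = real M - real M * \<delta>" by (simp only: right_diff_distrib mult_1_right)
    have "0 \<le> x" unfolding x_def using \<delta>1 by simp
    then have "real l \<le> x" "x < real l + 1" unfolding l_def x_def[symmetric] by linarith+
    then show "2 * real l \<le> real M - real M * \<delta>" "real M - real M * \<delta> < 2 * real l + 2"
      using x by linarith+
  qed
  have M\<delta>: "2 \<le> real M * \<delta>" "real D + 3 \<le> 3 * (real M * \<delta>)"
  proof -
    have "real M * \<delta> \<ge> (8 * real m * real D) * (100 / real m)"
      using Mm \<delta>2 mm by (intro mult_mono) auto
    then have "real M * \<delta> \<ge> 800 * real D" using mm by simp
    then show "2 \<le> real M * \<delta>" "real D + 3 \<le> 3 * (real M * \<delta>)" using D0 mm by linarith+
  qed
  have \<delta>1': "10000 * \<delta> \<le> 1" using \<delta>1 by simp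
  have M\<delta>1: "10000 * (real M * \<delta>) \<le> real M"
    using mult_left_mono[OF \<delta>1', of "real M"] by (simp add: mult_ac)
  have l4: "real M / 4 \<le> real l" using lb(2) M\<delta>1 M8 D0 mm by linarith
  have lM: "real l \<le> real M / 2" using lb(1) M\<delta>(1) by simp
  have a_eq: "2 * a = (2 * (real M - real l)) / real M" by (simp add: a_def)
  have a1: "1 + \<delta> \<le> 2 * a"
  proof -
    have "(1 + \<delta>) * real M \<le> 2 * (real M - real l)" using lb(1) by (simp add: algebra_simps)
    then show ?thesis unfolding a_eq using M0 by (simp add: pos_le_divide_eq)
  qed
  have a2: "2 * a \<le> 1 + 2 * \<delta>"
  proof -
    have "2 * (real M - real l) \<le> (1 + 2 * \<delta>) * real M" using lb(2) M\<delta>(1) by (simp add: algebra_simps)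
    then show ?thesis unfolding a_eq using M0 by (simp add: pos_divide_le_eq)
  qed
  have Dl: "D \<le> l"
  proof -
    have "real D \<le> real l" using M8 l4 by linarith
    then show ?thesis by simp
  qed
  have l0: "0 < l" using Dl D0 mm by linarith
  have K: "real K \<le> 5 * real m"
  proof -
    have "d < m * m + 4 * m + 4" using d(2) by (simp add: power2_eq_square algebra_simps)
    then have "K < 4 * m + 4" unfolding K_def by linarith
    then show ?thesis using mm by linarith
  qed
  have h: "real h \<le> real m / 400" "real m / 400 - 1 \<le> real h"
    unfolding h_def by linarith+
  have J: "real J \<le> real m * real m / 40"
  proof -
    have "real J = real K * (2 * real h)" by (simp add: J_def)
    also have "\<dots> \<le> (5 * real m) * (2 * (real m / 400))" using K h(1) by (intro mult_mono) auto
    finally show ?thesis by simp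
  qed
  have lJ: "2 * (l + J) \<le> N"
  proof -
    have "real (2 * (l + J)) \<le> real N" using lM J M unfolding of_nat_mult of_nat_add D[symmetric]
      using D0 mm by simp
    then show ?thesis by (simp only: of_nat_le_iff)
  qed
  have lDN: "l + D \<le> N"
  proof -
    have "real (l + D) \<le> real N" using lM M M0 by simp
    then show ?thesis by (simp only: of_nat_le_iff)
  qed
  have nq: "real n \<ge> 2 ^ q * exp (0.7 * L)"
  proof -
    have "2 ^ q * exp (0.7 * L) \<le> exp (0.3 * L) * exp (0.7 * L)" using q(3) by (intro mult_right_mono) auto
    also have "\<dots> = exp L" by (simp add: exp_add[symmetric])
    finally show ?thesis using n by simp
  qed
  have Bge: "exp (0.6 * L) \<le> real B"
  proof -
    have "n = B * 2 ^ q + n mod 2 ^ q" unfolding B_def by (rule div_mult_mod_eq[symmetric])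
    moreover have "n mod 2 ^ q < 2 ^ q" by simp
    ultimately have "n < B * 2 ^ q + 2 ^ q" by linarith
    then have "n < (B + 1) * 2 ^ q" by simp
    then have "real n < real ((B + 1) * 2 ^ q)" by (simp only: of_nat_less_iff)
    then have "real n < (real B + 1) * 2 ^ q" by (simp add: algebra_simps)
    with nq have "2 ^ q * exp (0.7 * L) < (real B + 1) * 2 ^ q" by (rule le_less_trans)
    then have "exp (0.7 * L) * 2 ^ q < (real B + 1) * 2 ^ q" by (simp only: mult.commute)
    then have "exp (0.7 * L) < real B + 1" by (rule mult_right_less_imp_less) simp
    moreover have "2 * exp (0.6 * L) \<le> exp (0.001 * L) * exp (0.6 * L)" using two by simp
    moreover have "exp (0.001 * L) * exp (0.6 * L) \<le> exp (0.7 * L)" using L by (simp add: exp_add[symmetric])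
    moreover have "1 \<le> exp (0.6 * L)" using L by simp
    ultimately show ?thesis by linarith
  qed
  have small: "circuit_size C < B ^ h"
  proof -
    have "0.001 * L * (real m + 2) \<le> real h * (0.6 * L)"
    proof -
      have "real m + 2 \<le> 600 * real h" using h(2) mm by linarith
      then have "0.001 * (real m + 2) \<le> real h * 0.6" by simp
      then have "L * (0.001 * (real m + 2)) \<le> L * (real h * 0.6)" using L by (intro mult_left_mono) auto
      then show ?thesis by (simp add: mult_ac)
    qed
    then have "exp (0.001 * L * (real m + 2)) \<le> exp (0.6 * L) ^ h" by (simp add: exp_of_nat_mult[symmetric])
    also have "\<dots> \<le> real B ^ h" using Bge by (intro power_mono) auto
    finally have "real (circuit_size C) < real B ^ h" using sz by (rule less_le_trans[rotated])
    then have "real (circuit_size C) < real (B ^ h)" by (simp only: of_nat_power)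
    then show ?thesis by (simp only: of_nat_less_iff)
  qed
  \<comment> \<open>The upper bound on the degree enters through \<open>mE\<close>:
    \<open>m ^ 4\<close> is at most \<open>exp (0.02 * L)\<close>, and 0.2 + 0.02 stays below
    0.29.\<close>
  have iso: "(1 + (2 * a) ^ m * (real m ^ 3 / 2 ^ q)) ^ m \<le> 3 / 2"
  proof -
    define x where "x = (2 * a) ^ m * (real m ^ 3 / 2 ^ q)"
    have a0: "0 \<le> 2 * a" using a1 \<delta>0 by linarith
    have x0: "0 \<le> x" unfolding x_def using a0 by simp
    have "(2 * a) ^ m \<le> exp (2 * \<delta>) ^ m"
      using a2 a0 exp_ge_add_one_self[of "2 * \<delta>"] by (intro power_mono) linarith+
    also have "\<dots> = exp (0.2 * L)" using \<delta>m by (simp add: exp_of_nat_mult[symmetric] mult.commute)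
    finally have am: "(2 * a) ^ m \<le> exp (0.2 * L)" .
    have "x * real m = (2 * a) ^ m * (real m ^ 4 / 2 ^ q)" by (simp add: x_def power4_eq_xxxx power3_eq_cube)
    also have "\<dots> \<le> exp (0.2 * L) * (exp (0.005 * L) ^ 4 / exp (0.29 * L))"
      using am mE q(4) a0 by (intro mult_mono frac_le power_mono divide_nonneg_nonneg) auto
    also have "\<dots> = exp (- 0.07 * L)"
      by (simp add: exp_of_nat_mult[symmetric] exp_add[symmetric] exp_diff[symmetric])
    also have "\<dots> \<le> 0.3"
    proof -
      have "1 + 0.07 * L \<le> exp (0.07 * L)" by (rule exp_ge_add_one_self)
      moreover have "10 \<le> 1 + 0.07 * L" using L by simp
      ultimately have "10 \<le> exp (0.07 * L)" by (rule order_trans[rotated])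
      then have "inverse (exp (0.07 * L)) \<le> inverse 10" by (intro le_imp_inverse_le) auto
      then show ?thesis by (simp add: exp_minus)
    qed
    finally have xm: "x * real m \<le> 0.3" .
    have "(1 + x) ^ m \<le> exp x ^ m" using x0 by (intro power_mono exp_ge_add_one_self) auto
    also have "\<dots> = exp (x * real m)" by (simp add: exp_of_nat_mult[symmetric] mult.commute)
    also have "\<dots> \<le> exp 0.3" using xm by simp
    also have "\<dots> \<le> 1 + 0.3 + 0.3\<^sup>2" by (rule exp_bound) auto
    also have "\<dots> \<le> (3 / 2 :: real)" by (simp add: power2_eq_square)
    finally show ?thesis unfolding x_def .
  qed
  have len: "m * (m + 1) + 1 \<le> d" using d(1) by (simp add: power2_eq_square)
  have qB: "2 ^ q * B \<le> n" unfolding B_def by (rule times_div_less_eq_dividend)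
  have Bpos: "0 < B" using Bge exp_gt_zero[of "0.6 * L"] by (cases "B = 0") auto
  have half: "1 / 2 \<le> a" using a1 \<delta>0 by linarith
  have main: "(2 * a) ^ D \<le> 4 * (real m + 2) ^ m * (s * (real K + 1) * ((real (l + J) + 1) * w ^ J))"
    unfolding s_def J_def w_def a_def M_def K_def D_def N_def
    by (rule SWSP_circuit_size_bound[OF C small q(1) qm Bpos qB len])
      (use l0 Dl lDN lJ DN half r3 iso in \<open>simp_all only: J_def a_def M_def K_def D_def N_def\<close>)
  \<comment> \<open>The actual excess is about \<open>2 * \<delta>\<close>; the factor 10 absorbs
    the rounding of \<open>l\<close> and the difference between \<open>N\<close> and
    \<open>M\<close>.\<close>
  have w: "w \<le> 1 + 10 * \<delta>"
  proof -
    have "real M * (1 - \<delta>) - 2 < 2 * real l" using lb(2) by (simp add: algebra_simps)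
    then have "(real M * (1 - \<delta>) - 2) * (1 + 5 * \<delta>) \<le> 2 * real l * (1 + 5 * \<delta>)"
      using \<delta>0 by (intro mult_right_mono) auto
    moreover have "(real M * (1 - \<delta>) - 2) * (1 + 5 * \<delta>)
        = real M + 4 * (real M * \<delta>) - 5 * (real M * \<delta> * \<delta>) - 2 - 10 * \<delta>" by (simp add: algebra_simps)
    moreover have "10000 * (real M * \<delta> * \<delta>) \<le> real M * \<delta>"
      using mult_left_mono[OF \<delta>1', of "real M * \<delta>"] \<delta>0 by (simp add: mult_ac)
    ultimately have "real N \<le> 2 * real l * (1 + 5 * \<delta>)" using M\<delta> M \<delta>1' by linarith
    then have "real N - real l \<le> (1 + 10 * \<delta>) * real l" by (simp add: algebra_simps)
    then show ?thesis unfolding w_def using l0 by (simp add: pos_divide_le_eq)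
  qed
  have w0: "0 \<le> w" unfolding w_def using lDN by simp
  have wJ: "w ^ J \<le> exp (0.025 * L * real m)"
  proof -
    have "w ^ J \<le> exp (10 * \<delta>) ^ J" using w w0 exp_ge_add_one_self[of "10 * \<delta>"] by (intro power_mono) linarith+
    also have "\<dots> = exp (10 * \<delta> * real J)" by (simp add: exp_of_nat_mult[symmetric] mult.commute)
    also have "\<dots> \<le> exp (10 * \<delta> * (real m * real m / 40))" using J \<delta>0 by (simp add: mult_left_mono)
    also have "10 * \<delta> * (real m * real m / 40) = 0.25 * (\<delta> * real m) * real m" by simp
    also have "\<dots> = 0.025 * L * real m" unfolding \<delta>m by simp
    finally show ?thesis .
  qed
  have lhs: "exp (0.05 * L * real m) \<le> (2 * a) ^ D"
  proof -
    have "exp (0.05 * L * real m) = exp (\<delta> / 2) ^ D"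
    proof -
      have "real D * (\<delta> / 2) = (\<delta> * real m) * real m / 2" by (simp add: D)
      also have "\<dots> = 0.05 * L * real m" unfolding \<delta>m by simp
      finally show ?thesis by (metis exp_of_nat_mult)
    qed
    also have "\<dots> \<le> (1 + \<delta>) ^ D" using \<delta>0 \<delta>1 by (intro power_mono exp_half_le) auto
    also have "\<dots> \<le> (2 * a) ^ D" using a1 \<delta>0 by (intro power_mono) linarith+
    finally show ?thesis .
  qed
  have m2: "(real m + 2) ^ m \<le> exp (0.006 * L * real m)"
  proof -
    have "real m + 2 \<le> 2 * real m" using mm by linarith
    also have "\<dots> \<le> exp (0.001 * L) * exp (0.005 * L)" using two mE by (intro mult_mono) auto
    also have "\<dots> = exp (0.006 * L)" by (simp add: exp_add[symmetric])
    finally have "(real m + 2) ^ m \<le> exp (0.006 * L) ^ m" by (intro power_mono) auto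
    then show ?thesis by (simp add: exp_of_nat_mult[symmetric] mult_ac)
  qed
  have poly: "4 * (real K + 1) * (real (l + J) + 1) \<le> exp (2 * L)"
  proof -
    have "4 * real K + 4 \<le> 32 * real m" using K mm by linarith
    then have "4 * (real K + 1) \<le> 32 * real m" by simp
    also have "32 * real m \<le> exp (0.001 * L) ^ 5 * exp (0.005 * L)"
      using mE power_mono[OF two, of 5] by (intro mult_mono) auto
    also have "\<dots> = exp (0.01 * L)" by (simp add: exp_of_nat_mult[symmetric] exp_add[symmetric])
    also have "\<dots> \<le> exp (1 * L)" by (rule E) simp
    finally have 1: "4 * (real K + 1) \<le> exp L" by simp
    have "l + J + 1 \<le> 2 * (l + J)" using l0 by simp
    then have "l + J + 1 \<le> N" using lJ by (rule order_trans)
    then have "real (l + J + 1) \<le> real N" by (simp only: of_nat_le_iff)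
    then have "real (l + J) + 1 \<le> real N" by (simp only: of_nat_add of_nat_1)
    also have "real N = 2 * (real m * real m) * 2 ^ q" by (simp add: N)
    also have "\<dots> \<le> exp (0.001 * L) * (exp (0.005 * L) * exp (0.005 * L)) * exp (0.3 * L)"
      using two mE q(3) by (intro mult_mono) auto
    also have "\<dots> = exp (0.311 * L)" by (simp add: exp_add[symmetric])
    also have "\<dots> \<le> exp (1 * L)" by (rule E) simp
    finally have 2: "real (l + J) + 1 \<le> exp L" by simp
    have "4 * (real K + 1) * (real (l + J) + 1) \<le> exp L * exp L" using 1 2 by (intro mult_mono) auto
    then show ?thesis by (simp add: exp_add[symmetric])
  qed
  have s0: "0 \<le> s" by (simp add: s_def)
  have "exp (0.05 * L * real m) \<le> (real m + 2) ^ m * (s * ((4 * (real K + 1) * (real (l + J) + 1)) * w ^ J))"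
    using lhs main by (simp only: mult_ac)
  also have "\<dots> \<le> exp (0.006 * L * real m) * (s * (exp (2 * L) * exp (0.025 * L * real m)))"
    using m2 poly wJ s0 w0 by (intro mult_mono mult_left_mono mult_nonneg_nonneg) auto
  also have "\<dots> = s * exp (0.031 * L * real m + 2 * L)" by (simp add: exp_add[symmetric] algebra_simps)
  also have "\<dots> < exp (0.001 * L * (real m + 2)) * exp (0.031 * L * real m + 2 * L)"
    using sz by (simp add: s_def)
  also have "\<dots> = exp (0.032 * (L * real m) + 2.002 * L)" by (simp add: exp_add[symmetric] algebra_simps)
  finally have "0.05 * L * real m < 0.032 * (L * real m) + 2.002 * L" by simp
  moreover have "L * 1000000 \<le> L * real m" using mm L by (intro mult_left_mono) auto
  ultimately show False using L by simp
qed

theorem theorem2: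
  shows "\<exists>c > (0::real). \<forall>d :: nat \<Rightarrow> nat.
    (\<lambda>n. real (d n)) \<in> \<omega>(\<lambda>n. (ln (real n))\<^sup>2) \<longrightarrow>
    (\<forall>\<^sub>F n in sequentially. real (d n) \<le> real n powr 0.01) \<longrightarrow>
    (\<forall>\<^sub>F n in sequentially. \<forall>C :: (imm_var, 'a::field) circuit.
       SWSP_circuit C \<longrightarrow> computes C (IMM n (d n)) \<longrightarrow>
       real (circuit_size C) \<ge> real n powr (c * sqrt (real (d n))))"
proof (intro exI[of _ "0.001"] conjI allI impI)
  fix d :: "nat \<Rightarrow> nat"
  assume om: "(\<lambda>n. real (d n)) \<in> \<omega>(\<lambda>n. (ln (real n))\<^sup>2)"
    and up: "\<forall>\<^sub>F n in sequentially. real (d n) \<le> real n powr 0.01"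
  \<comment> \<open>With 1002 there is room for rounding: \<open>m\<close> may be almost 2 below
    \<open>r\<close> and must still be at least \<open>1000 * L\<close>.\<close>
  have e1: "\<forall>\<^sub>F n in sequentially. norm (real (d n)) \<ge> 1002\<^sup>2 * norm ((ln (real n))\<^sup>2)"
    using landau_omega.smallD[OF om, of "1002\<^sup>2"] by simp
  have "filterlim (\<lambda>n. ln (real n)) at_top sequentially"
    by (rule filterlim_compose[OF ln_at_top filterlim_real_sequentially])
  then have e2: "\<forall>\<^sub>F n in sequentially. 1000 \<le> ln (real n)" by (simp add: filterlim_at_top)
  show "\<forall>\<^sub>F n in sequentially. \<forall>C :: (imm_var, 'a::field) circuit.
       SWSP_circuit C \<longrightarrow> computes C (IMM n (d n)) \<longrightarrow>
       real (circuit_size C) \<ge> real n powr (0.001 * sqrt (real (d n)))"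
    using e1 e2 up
  proof eventually_elim
    fix n
    assume d1: "norm (real (d n)) \<ge> 1002\<^sup>2 * norm ((ln (real n))\<^sup>2)" and L: "1000 \<le> ln (real n)"
      and d2: "real (d n) \<le> real n powr 0.01"
    define L where "L = ln (real n)"
    have n0: "real n > 0" using L by (cases "n = 0") auto
    define r where "r = sqrt (real (d n))"
    have r2: "r\<^sup>2 = real (d n)" by (simp add: r_def)
    have "(1002 * L)\<^sup>2 \<le> r\<^sup>2" using d1 unfolding r2 by (simp add: power_mult_distrib L_def)
    then have rL: "1002 * L \<le> r" by (rule power2_le_imp_le) (simp add: r_def)
    \<comment> \<open>One below the integer part: then \<open>m\<close> blocks of
      \<open>m + 1\<close> vertex layers fit into \<open>d n\<close>, and only O(m) edges remain
      outside \<open>Z\<close>.\<close>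
    define m where "m = nat \<lfloor>r\<rfloor> - 1"
    have r0: "0 \<le> r" by (simp add: r_def)
    have L': "1000 \<le> L" using L by (simp add: L_def)
    have m: "real m + 1 \<le> r" "r < real m + 2"
      using rL L' unfolding m_def by linarith+
    have "(real m + 1)\<^sup>2 \<le> r\<^sup>2" using m(1) by (intro power_mono) auto
    then have "real ((m + 1)\<^sup>2) \<le> real (d n)" by (simp add: r2 add.commute)
    then have dm1: "(m + 1)\<^sup>2 \<le> d n" by (simp only: of_nat_le_iff)
    have "r\<^sup>2 < (real m + 2)\<^sup>2" using m(2) r0 by (intro power_strict_mono) auto
    then have "real (d n) < real ((m + 2)\<^sup>2)" by (simp add: r2 add.commute)
    then have dm2: "d n < (m + 2)\<^sup>2" by (simp only: of_nat_less_iff)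
    have "r\<^sup>2 \<le> (exp (0.005 * L))\<^sup>2"
      using d2 n0 by (simp add: r2 powr_def L_def exp_double[symmetric])
    then have "r \<le> exp (0.005 * L)" by (rule power2_le_imp_le) simp
    then have mE: "real m \<le> exp (0.005 * L)" using m(1) by linarith
    have mL: "1000 * L \<le> real m" using rL m(2) L' by linarith
    have "real n powr (0.001 * sqrt (real (d n))) = exp (0.001 * L * r)"
      using n0 by (simp add: powr_def L_def r_def mult_ac)
    also have "\<dots> \<le> exp (0.001 * L * (real m + 2))" using m(2) L' by (simp add: mult_left_mono)
    finally have fin: "real n powr (0.001 * sqrt (real (d n))) \<le> exp (0.001 * L * (real m + 2))" .
    show "\<forall>C :: (imm_var, 'a::field) circuit. SWSP_circuit C \<longrightarrow> computes C (IMM n (d n)) \<longrightarrow>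
       real (circuit_size C) \<ge> real n powr (0.001 * sqrt (real (d n)))"
    proof (intro allI impI)
      fix C :: "(imm_var, 'a) circuit"
      assume "SWSP_circuit C" "computes C (IMM n (d n))"
      then show "real (circuit_size C) \<ge> real n powr (0.001 * sqrt (real (d n)))"
        using SWSP_circuit_size_exp[of n m "d n" C] L' mL dm1 dm2 mE fin unfolding L_def by linarith
    qed
  qed
qed simp

end
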